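(* Let $S$ be a local ring, let $(x,y)$ be a pair of exact zero-divisors in $S$, and let $R=S/(x)$. Let $M$ and $N$ be $R$-modules such that $yN=0$. If there exists an integer $n\ge 2$ such that $\operatorname{Ext}_R^i(M,N)=0$ for $1\le i\le n$, then $\operatorname{Ext}_S^i(M,N)\cong \operatorname{Hom}_S(M,N)$ for $0\le i<n$. Consequently, if moreover $N=M\neq 0$, then $\operatorname{Ext}_S^i(M,M)\neq 0$ for $0<i<n$.
   Context: "Local ring" means commutative Noetherian local ring. A pair $(x,y)$ of elements of a local ring $S$ is a pair of exact zero-divisors if $x$ is nonzero, $x$ belongs to the maximal ideal of $S$, and $\operatorname{ann}_S(x)=(y)$ and $\operatorname{ann}_S(y)=(x)$. Every $R$-module is regarded as an $S$-module via the quotient map $S\to R$. Modules are not assumed finitely generated. *)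

theory Defs
  imports "HOL-Algebra.Module" "HOL-Algebra.QuotRing" "HOL-Algebra.Ring_Divisibility" "HOL-Library.FSet"
begin

section \<open>Local rings and exact zero-divisors\<close>

locale noetherian_local_ring = cring S + noetherian_ring S for S (structure) +
  assumes unique_maximalideal: "\<exists>!\<mm>. maximalideal \<mm> S"

definition max_ideal :: "('a, 'b) ring_scheme \<Rightarrow> 'a set"
  where "max_ideal S = (THE \<mm>. maximalideal \<mm> S)"

definition annihilator :: "('a, 'b) ring_scheme \<Rightarrow> 'a \<Rightarrow> 'a set"
  where "annihilator S x = {s \<in> carrier S. s \<otimes>\<^bsub>S\<^esub> x = \<zero>\<^bsub>S\<^esub>}"

definition exact_zero_divisors :: "('a, 'b) ring_scheme \<Rightarrow> 'a \<Rightarrow> 'a \<Rightarrow> bool"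
  where "exact_zero_divisors S x y \<longleftrightarrow>
    x \<in> carrier S \<and> y \<in> carrier S \<and> x \<noteq> \<zero>\<^bsub>S\<^esub> \<and> x \<in> max_ideal S \<and>
    annihilator S x = PIdl\<^bsub>S\<^esub> y \<and> annihilator S y = PIdl\<^bsub>S\<^esub> x"


section \<open>Modules\<close>

text \<open>
  Module records inherit the fields \<open>mult\<close> and \<open>one\<close> from ring records; these carry no meaning
  for modules and are left unspecified below.
\<close>

definition zero_module :: "('r, 'm) module \<Rightarrow> bool"
  where "zero_module M \<longleftrightarrow> carrier M = {\<zero>\<^bsub>M\<^esub>}"

text \<open>Homomorphisms are taken to be extensional, so that equality in \<open>Hom\<close> is equality of maps on
  the carrier.\<close>

definition lin_maps ::
    "('r, 'x) ring_scheme \<Rightarrow> ('r, 'm) module \<Rightarrow> ('r, 'n) module \<Rightarrow> ('m \<Rightarrow> 'n) set"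
  where "lin_maps R M N = {f \<in> hom (add_monoid M) (add_monoid N) \<inter> extensional (carrier M).
    \<forall>a \<in> carrier R. \<forall>u \<in> carrier M. f (a \<odot>\<^bsub>M\<^esub> u) = a \<odot>\<^bsub>N\<^esub> f u}"

definition Hom_mod ::
    "('r, 'x) ring_scheme \<Rightarrow> ('r, 'm) module \<Rightarrow> ('r, 'n) module \<Rightarrow> ('r, 'm \<Rightarrow> 'n) module"
  where "Hom_mod R M N =
    \<lparr>carrier = lin_maps R M N, mult = undefined, one = undefined,
     zero = (\<lambda>u \<in> carrier M. \<zero>\<^bsub>N\<^esub>),
     add = (\<lambda>f g. \<lambda>u \<in> carrier M. f u \<oplus>\<^bsub>N\<^esub> g u),
     smult = (\<lambda>a f. \<lambda>u \<in> carrier M. a \<odot>\<^bsub>N\<^esub> f u)\<rparr>"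

definition mod_iso :: "('r, 'x) ring_scheme \<Rightarrow> ('r, 'm) module \<Rightarrow> ('r, 'n) module \<Rightarrow> bool"
  where "mod_iso R M N \<longleftrightarrow> (\<exists>f \<in> lin_maps R M N. bij_betw f (carrier M) (carrier N))"

text \<open>The quotient of the submodule of \<open>M\<close> with carrier \<open>Z\<close> by its submodule \<open>B\<close>.\<close>

definition subquotient :: "('r, 'm) module \<Rightarrow> 'm set \<Rightarrow> 'm set \<Rightarrow> ('r, 'm set) module"
  where "subquotient M Z B =
    \<lparr>carrier = (\<lambda>u. B +>\<^bsub>M\<^esub> u) ` Z, mult = undefined, one = undefined,
     zero = B, add = set_add M,
     smult = (\<lambda>a C. \<Union>u \<in> C. B +>\<^bsub>M\<^esub> (a \<odot>\<^bsub>M\<^esub> u))\<rparr>"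

text \<open>An \<open>S/I\<close>-module viewed as an \<open>S\<close>-module via the quotient map.\<close>

definition quot_restrict ::
    "('s, 'x) ring_scheme \<Rightarrow> 's set \<Rightarrow> ('s set, 'm) module \<Rightarrow> ('s, 'm) module"
  where "quot_restrict S I M =
    \<lparr>carrier = carrier M, mult = mult M, one = one M, zero = zero M, add = add M,
     smult = (\<lambda>s u. (I +>\<^bsub>S\<^esub> s) \<odot>\<^bsub>M\<^esub> u)\<rparr>"

definition free_mod :: "('r, 'x) ring_scheme \<Rightarrow> 'b set \<Rightarrow> ('r, 'b \<Rightarrow> 'r) module"
  where "free_mod R B =
    \<lparr>carrier = {c. (\<forall>b. c b \<in> carrier R) \<and> finite {b. c b \<noteq> \<zero>\<^bsub>R\<^esub>} \<and> {b. c b \<noteq> \<zero>\<^bsub>R\<^esub>} \<subseteq> B},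
     mult = undefined, one = undefined,
     zero = (\<lambda>b. \<zero>\<^bsub>R\<^esub>), add = (\<lambda>c d b. c b \<oplus>\<^bsub>R\<^esub> d b), smult = (\<lambda>a c b. a \<otimes>\<^bsub>R\<^esub> c b)\<rparr>"

text \<open>The linear map out of a free module that takes the basis element \<open>b\<close> to \<open>\<phi> b\<close>.\<close>

definition lin_ext ::
    "('r, 'x) ring_scheme \<Rightarrow> ('r, 'm) module \<Rightarrow> ('b \<Rightarrow> 'm) \<Rightarrow> ('b \<Rightarrow> 'r) \<Rightarrow> 'm"
  where "lin_ext R M \<phi> c = (\<Oplus>\<^bsub>M\<^esub> b \<in> {b. c b \<noteq> \<zero>\<^bsub>R\<^esub>}. c b \<odot>\<^bsub>M\<^esub> \<phi> b)"


section \<open>The standard free resolution\<close>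

text \<open>
  \<open>Ext\<close> is computed from the functorial free resolution
  \<open>\<dots> \<rightarrow> F\<^sub>2 \<rightarrow> F\<^sub>1 \<rightarrow> F\<^sub>0 \<rightarrow> M \<rightarrow> 0\<close> in which \<open>F\<^sub>0\<close> is free on the underlying set of \<open>M\<close>, and
  \<open>F\<^sub>n\<^sub>+\<^sub>1\<close> is free on the underlying set of the kernel of the preceding map.  For all \<open>F\<^sub>n\<close> to have
  the same type, their bases are taken from one datatype: \<open>Gen u\<close> is the basis element given by
  \<open>u \<in> M\<close>, and \<open>Syz A\<close> the one given by the finitely supported coefficient function whose
  restriction to its support has graph \<open>A\<close>; \<open>syz\<close> is injective on such functions, and \<open>syz_elem\<close>
  is its inverse.
\<close>

datatype ('m, 'r) gen = Gen (gen_elem: 'm) | Syz "(('m, 'r) gen \<times> 'r) fset"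

definition syz :: "('r, 'x) ring_scheme \<Rightarrow> (('m, 'r) gen \<Rightarrow> 'r) \<Rightarrow> ('m, 'r) gen"
  where "syz R c = Syz (Abs_fset {(b, c b) | b. c b \<noteq> \<zero>\<^bsub>R\<^esub>})"

definition syz_elem :: "('r, 'x) ring_scheme \<Rightarrow> ('m, 'r) gen \<Rightarrow> (('m, 'r) gen \<Rightarrow> 'r)"
  where "syz_elem R = inv_into {c. finite {b. c b \<noteq> \<zero>\<^bsub>R\<^esub>}} (syz R)"

fun res_basis :: "('r, 'x) ring_scheme \<Rightarrow> ('r, 'm) module \<Rightarrow> nat \<Rightarrow> ('m, 'r) gen set"
  where
    "res_basis R M 0 = Gen ` carrier M"
  | "res_basis R M (Suc 0) =
      syz R ` {c \<in> carrier (free_mod R (res_basis R M 0)). lin_ext R M gen_elem c = \<zero>\<^bsub>M\<^esub>}"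
  | "res_basis R M (Suc (Suc n)) =
      syz R ` {c \<in> carrier (free_mod R (res_basis R M (Suc n))).
        lin_ext R (free_mod R (res_basis R M n)) (syz_elem R) c
          = \<zero>\<^bsub>free_mod R (res_basis R M n)\<^esub>}"

definition res_mod ::
    "('r, 'x) ring_scheme \<Rightarrow> ('r, 'm) module \<Rightarrow> nat \<Rightarrow> ('r, ('m, 'r) gen \<Rightarrow> 'r) module"
  where "res_mod R M n = free_mod R (res_basis R M n)"

text \<open>The augmentation \<open>F\<^sub>0 \<rightarrow> M\<close>, and the differential \<open>F\<^sub>n\<^sub>+\<^sub>1 \<rightarrow> F\<^sub>n\<close>.\<close>

definition res_aug :: "('r, 'x) ring_scheme \<Rightarrow> ('r, 'm) module \<Rightarrow> (('m, 'r) gen \<Rightarrow> 'r) \<Rightarrow> 'm"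
  where "res_aug R M = lin_ext R M gen_elem"

definition res_diff ::
    "('r, 'x) ring_scheme \<Rightarrow> ('r, 'm) module \<Rightarrow> nat
      \<Rightarrow> (('m, 'r) gen \<Rightarrow> 'r) \<Rightarrow> (('m, 'r) gen \<Rightarrow> 'r)"
  where "res_diff R M n = lin_ext R (res_mod R M n) (syz_elem R)"


section \<open>Ext\<close>

definition Ext_cochain ::
    "('r, 'x) ring_scheme \<Rightarrow> ('r, 'm) module \<Rightarrow> ('r, 'n) module \<Rightarrow> nat
      \<Rightarrow> ('r, (('m, 'r) gen \<Rightarrow> 'r) \<Rightarrow> 'n) module"
  where "Ext_cochain R M N i = Hom_mod R (res_mod R M i) N"

definition Ext_codiff ::
    "('r, 'x) ring_scheme \<Rightarrow> ('r, 'm) module \<Rightarrow> nat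
      \<Rightarrow> ((('m, 'r) gen \<Rightarrow> 'r) \<Rightarrow> 'n) \<Rightarrow> ((('m, 'r) gen \<Rightarrow> 'r) \<Rightarrow> 'n)"
  where "Ext_codiff R M i f = (\<lambda>c \<in> carrier (res_mod R M (Suc i)). f (res_diff R M i c))"

definition Ext_cocycles ::
    "('r, 'x) ring_scheme \<Rightarrow> ('r, 'm) module \<Rightarrow> ('r, 'n) module \<Rightarrow> nat
      \<Rightarrow> ((('m, 'r) gen \<Rightarrow> 'r) \<Rightarrow> 'n) set"
  where "Ext_cocycles R M N i =
    {f \<in> carrier (Ext_cochain R M N i). Ext_codiff R M i f = \<zero>\<^bsub>Ext_cochain R M N (Suc i)\<^esub>}"

fun Ext_coboundaries ::
    "('r, 'x) ring_scheme \<Rightarrow> ('r, 'm) module \<Rightarrow> ('r, 'n) module \<Rightarrow> nat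
      \<Rightarrow> ((('m, 'r) gen \<Rightarrow> 'r) \<Rightarrow> 'n) set"
  where
    "Ext_coboundaries R M N 0 = {\<zero>\<^bsub>Ext_cochain R M N 0\<^esub>}"
  | "Ext_coboundaries R M N (Suc i) = Ext_codiff R M i ` carrier (Ext_cochain R M N i)"

definition Ext ::
    "('r, 'x) ring_scheme \<Rightarrow> nat \<Rightarrow> ('r, 'm) module \<Rightarrow> ('r, 'n) module
      \<Rightarrow> ('r, ((('m, 'r) gen \<Rightarrow> 'r) \<Rightarrow> 'n) set) module"
  where "Ext R i M N =
    subquotient (Ext_cochain R M N i) (Ext_cocycles R M N i) (Ext_coboundaries R M N i)"

end

theory Submission
  imports Defs
begin

text \<open>
  Since \<open>x\<close> and \<open>y\<close> kill \<open>N\<close> and \<open>R = S / (x)\<close> has the periodic resolution with maps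
  \<open>x, y, x, \<dots>\<close>, every \<open>Ext\<^sub>S\<^sup>i(R, N)\<close> is \<open>N\<close>; the result thus says that the edge map of the
  change of rings spectral sequence is bijective.  This can be seen without the spectral sequence.  Let \<open>F\<close> be a free resolution
  of \<open>M\<close> over \<open>S\<close>, and lift the multiplications \<open>x, y, x, \<dots>\<close> on \<open>F\<^sub>0\<close> to maps \<open>\<epsilon>\<^sub>j : F\<^sub>0 \<rightarrow> F\<^sub>j\<close>
  with \<open>\<epsilon>\<^sub>0 = id\<close>, \<open>d \<epsilon>\<^sub>1 = x \<epsilon>\<^sub>0\<close>, \<open>d \<epsilon>\<^sub>2 = y \<epsilon>\<^sub>1\<close>, and so on.  The edge map sends the class of a cocycle \<open>f\<close> on
  \<open>F\<^sub>i\<close> to \<open>f \<circ> \<epsilon>\<^sub>i\<close>, which factors through \<open>M\<close>.  The cone of \<open>\<epsilon>\<close> is a free resolution over \<open>S\<close> of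
  the first syzygy \<open>K\<close> of \<open>M\<close> over \<open>R\<close>, so injectivity in degree \<open>i\<close> for \<open>M\<close> reduces to \<open>Ext\<^sub>R\<^sup>1(M, N) = 0\<close>
  and injectivity in degree \<open>i - 1\<close> for \<open>K\<close>, and surjectivity for \<open>M\<close> reduces to injectivity for \<open>K\<close>.
  Iterating the cone yields a free resolution of \<open>M\<close> over \<open>R\<close>, given modulo \<open>x\<close>, and comparing it with
  the standard one shows that the hypothesis on \<open>Ext\<^sub>R\<close> is the one needed.
\<close>

section \<open>Linear maps and free modules\<close>

text \<open>The induction passes from \<open>M\<close> to its first syzygy \<open>K\<close> over
  \<open>R\<close>, so its statement must apply to \<open>K\<close> again. In 0 -> K -> F_0 / x F_0
  -> M -> 0, the periodic complex on F_0 resolves the middle term and F resolves \<open>M\<close>;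
  the cone of a chain map over the surjection, shifted by one, therefore resolves \<open>K\<close>.
  Each cone puts signs into the sequence x, y, x, ... and adds copies of F_0 to the free modules.
  Hence the induction is over arbitrary resolutions and arbitrary sequences s in which each term
  generates the annihilator of the one before; only s 0 = x is kept. \<open>N\<close> never changes,
  and since every s j kills it, linear maps to \<open>N\<close> do not see multiples of s j.

  Ext over \<open>R\<close> in degree p + 1 is Ext^1 of the p-th syzygy. Injectivity in degree i
  needs this for p < i. Surjectivity is injectivity in the same degree for \<open>K\<close>, and so
  needs p \<le> i. This is the origin of the range i < n.

  To compare resolutions over two rings, everything is kept over \<open>S\<close>: the standard
  resolution over \<open>R\<close> is lifted to free \<open>S\<close>-modules, where it is a complex
  only modulo x.\<close>

definition lin ::
    "('r, 'x) ring_scheme \<Rightarrow> ('r, 'm) module \<Rightarrow> ('r, 'n) module \<Rightarrow> ('m \<Rightarrow> 'n) \<Rightarrow> bool"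
  where "lin R A B f \<longleftrightarrow> f \<in> carrier A \<rightarrow> carrier B
    \<and> (\<forall>u \<in> carrier A. \<forall>v \<in> carrier A. f (u \<oplus>\<^bsub>A\<^esub> v) = f u \<oplus>\<^bsub>B\<^esub> f v)
    \<and> (\<forall>a \<in> carrier R. \<forall>u \<in> carrier A. f (a \<odot>\<^bsub>A\<^esub> u) = a \<odot>\<^bsub>B\<^esub> f u)"

lemma linI:
  assumes "\<And>u. u \<in> carrier A \<Longrightarrow> f u \<in> carrier B"
    and "\<And>u v. u \<in> carrier A \<Longrightarrow> v \<in> carrier A \<Longrightarrow> f (u \<oplus>\<^bsub>A\<^esub> v) = f u \<oplus>\<^bsub>B\<^esub> f v"
    and "\<And>a u. a \<in> carrier R \<Longrightarrow> u \<in> carrier A \<Longrightarrow> f (a \<odot>\<^bsub>A\<^esub> u) = a \<odot>\<^bsub>B\<^esub> f u"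
  shows "lin R A B f"
  using assms by (auto simp: lin_def)

lemma lin_closed: "lin R A B f \<Longrightarrow> u \<in> carrier A \<Longrightarrow> f u \<in> carrier B"
  by (auto simp: lin_def)

lemma lin_add:
  "lin R A B f \<Longrightarrow> u \<in> carrier A \<Longrightarrow> v \<in> carrier A \<Longrightarrow> f (u \<oplus>\<^bsub>A\<^esub> v) = f u \<oplus>\<^bsub>B\<^esub> f v"
  by (auto simp: lin_def)

lemma lin_smult:
  "lin R A B f \<Longrightarrow> a \<in> carrier R \<Longrightarrow> u \<in> carrier A \<Longrightarrow> f (a \<odot>\<^bsub>A\<^esub> u) = a \<odot>\<^bsub>B\<^esub> f u"
  by (auto simp: lin_def)

lemma lin_cong:
  "lin R A B f \<Longrightarrow> (\<And>u. u \<in> carrier A \<Longrightarrow> g u = f u) \<Longrightarrow> module R A \<Longrightarrow> lin R A B g"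
  by (rule linI) (auto simp: lin_def module.smult_closed abelian_monoid.a_closed
      module.axioms abelian_group.axioms(1))

lemma lin_zero:
  assumes "module R A" "module R B" "lin R A B f"
  shows "f \<zero>\<^bsub>A\<^esub> = \<zero>\<^bsub>B\<^esub>"
proof -
  interpret A: module R A by fact
  interpret B: module R B by fact
  have "f (\<zero>\<^bsub>R\<^esub> \<odot>\<^bsub>A\<^esub> \<zero>\<^bsub>A\<^esub>) = \<zero>\<^bsub>R\<^esub> \<odot>\<^bsub>B\<^esub> f \<zero>\<^bsub>A\<^esub>"
    by (rule lin_smult[OF assms(3)]) auto
  then show ?thesis
    using lin_closed[OF assms(3) A.M.zero_closed] by simp
qed

lemma lin_neg:
  assumes "module R A" "module R B" "lin R A B f" "u \<in> carrier A"
  shows "f (\<ominus>\<^bsub>A\<^esub> u) = \<ominus>\<^bsub>B\<^esub> f u"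
proof -
  interpret A: module R A by fact
  interpret B: module R B by fact
  have "f (\<ominus>\<^bsub>A\<^esub> u) \<oplus>\<^bsub>B\<^esub> f u = \<zero>\<^bsub>B\<^esub>"
    using assms by (simp add: lin_add[OF assms(3), symmetric] A.M.l_neg lin_zero)
  then show ?thesis
    using assms by (simp add: B.M.minus_equality lin_closed)
qed

lemma lin_comp:
  assumes "lin R A B f" "lin R B C g"
  shows "lin R A C (\<lambda>u. g (f u))"
  using assms by (intro linI) (auto simp: lin_def Pi_def)

lemma lin_id: "lin R A A (\<lambda>u. u)"
  by (rule linI) auto

lemma lin_plus:
  assumes "module R B" "lin R A B f" "lin R A B g"
  shows "lin R A B (\<lambda>u. f u \<oplus>\<^bsub>B\<^esub> g u)"
proof -
  interpret B: module R B by fact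
  show ?thesis
    by (rule linI) (use assms in \<open>auto simp: lin_closed lin_add lin_smult B.smult_r_distr B.M.a_ac\<close>)
qed

lemma lin_scale:
  assumes "module R B" "lin R A B f" "a \<in> carrier R"
  shows "lin R A B (\<lambda>u. a \<odot>\<^bsub>B\<^esub> f u)"
proof -
  interpret B: module R B by fact
  show ?thesis
    by (rule linI) (use assms in \<open>auto simp: lin_closed lin_add lin_smult B.smult_r_distr
      B.smult_assoc1[symmetric] B.R.m_comm\<close>)
qed

lemma lin_minus:
  assumes "module R B" "lin R A B f" "lin R A B g"
  shows "lin R A B (\<lambda>u. f u \<ominus>\<^bsub>B\<^esub> g u)"
proof -
  interpret B: module R B by fact
  show ?thesis
    by (rule linI) (use assms in \<open>auto simp: lin_closed lin_add lin_smult B.smult_r_distr B.M.a_ac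
      a_minus_def B.M.minus_add B.smult_r_minus\<close>)
qed

lemma lin_const_zero:
  assumes "module R B"
  shows "lin R A B (\<lambda>u. \<zero>\<^bsub>B\<^esub>)"
proof -
  interpret B: module R B by fact
  show ?thesis by (rule linI) auto
qed

section \<open>Free modules and lifting of maps out of them\<close>

definition basis_vec :: "('r, 'x) ring_scheme \<Rightarrow> 'b \<Rightarrow> 'b \<Rightarrow> 'r"
  where "basis_vec R b = (\<lambda>b'. if b' = b then \<one>\<^bsub>R\<^esub> else \<zero>\<^bsub>R\<^esub>)"

lemma free_mod_simps [simp]:
  "\<zero>\<^bsub>free_mod R B\<^esub> = (\<lambda>b. \<zero>\<^bsub>R\<^esub>)"
  "c \<oplus>\<^bsub>free_mod R B\<^esub> d = (\<lambda>b. c b \<oplus>\<^bsub>R\<^esub> d b)"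
  "a \<odot>\<^bsub>free_mod R B\<^esub> c = (\<lambda>b. a \<otimes>\<^bsub>R\<^esub> c b)"
  by (simp_all add: free_mod_def)

lemma free_mod_carrier:
  "c \<in> carrier (free_mod R B) \<longleftrightarrow> (\<forall>b. c b \<in> carrier R) \<and> finite {b. c b \<noteq> \<zero>\<^bsub>R\<^esub>}
    \<and> {b. c b \<noteq> \<zero>\<^bsub>R\<^esub>} \<subseteq> B"
  by (simp add: free_mod_def)

context cring begin

lemma free_add_closed:
  assumes "c \<in> carrier (free_mod R B)" "d \<in> carrier (free_mod R B)"
  shows "(\<lambda>b. c b \<oplus> d b) \<in> carrier (free_mod R B)"
proof -
  have "{b. c b \<oplus> d b \<noteq> \<zero>} \<subseteq> {b. c b \<noteq> \<zero>} \<union> {b. d b \<noteq> \<zero>}" by auto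
  with assms show ?thesis
    unfolding free_mod_carrier by (auto intro: finite_subset)
qed

lemma free_smult_closed:
  assumes "a \<in> carrier R" "c \<in> carrier (free_mod R B)"
  shows "(\<lambda>b. a \<otimes> c b) \<in> carrier (free_mod R B)"
proof -
  have "{b. a \<otimes> c b \<noteq> \<zero>} \<subseteq> {b. c b \<noteq> \<zero>}" using assms by auto
  with assms show ?thesis
    unfolding free_mod_carrier by (auto intro: finite_subset)
qed

lemma free_mod_abelian_group: "abelian_group (free_mod R B)"
proof (rule abelian_groupI)
  fix c assume c: "c \<in> carrier (free_mod R B)"
  then have "(\<lambda>b. \<ominus> c b) \<in> carrier (free_mod R B)"
    by (auto simp: free_mod_carrier elim!: rev_finite_subset)
  moreover have "(\<lambda>b. \<ominus> c b \<oplus> c b) = (\<lambda>b. \<zero>)"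
    using c by (auto simp: free_mod_carrier l_neg)
  ultimately show "\<exists>d \<in> carrier (free_mod R B). d \<oplus>\<^bsub>free_mod R B\<^esub> c = \<zero>\<^bsub>free_mod R B\<^esub>"
    by (auto intro!: bexI[of _ "\<lambda>b. \<ominus> c b"])
qed (auto simp: free_add_closed, auto simp: free_mod_carrier a_ac)

lemma free_mod_module: "module R (free_mod R B)"
proof (rule moduleI)
  show "abelian_group (free_mod R B)" by (rule free_mod_abelian_group)
qed (auto simp: free_smult_closed is_cring, auto simp: free_mod_carrier l_distr r_distr m_assoc)

lemma basis_vec_closed: "b \<in> B \<Longrightarrow> basis_vec R b \<in> carrier (free_mod R B)"
  by (auto simp: free_mod_carrier basis_vec_def elim!: rev_finite_subset[of "{b}"])

lemma free_induct [consumes 1, case_names zero basis add]: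
  assumes "c \<in> carrier (free_mod R B)"
    and zero: "P (\<lambda>b. \<zero>)"
    and basis: "\<And>a b. a \<in> carrier R \<Longrightarrow> b \<in> B \<Longrightarrow> P (a \<odot>\<^bsub>free_mod R B\<^esub> basis_vec R b)"
    and add: "\<And>u v. u \<in> carrier (free_mod R B) \<Longrightarrow> v \<in> carrier (free_mod R B) \<Longrightarrow> P u \<Longrightarrow> P v
      \<Longrightarrow> P (u \<oplus>\<^bsub>free_mod R B\<^esub> v)"
  shows "P c"
proof -
  have "finite T \<Longrightarrow> c \<in> carrier (free_mod R B) \<Longrightarrow> {b. c b \<noteq> \<zero>} = T \<Longrightarrow> P c" for T c
  proof (induction T arbitrary: c rule: finite_induct)
    case empty
    then have "c = (\<lambda>b. \<zero>)" by auto
    then show ?case using zero by simp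
  next
    case (insert b T)
    let ?u = "c (b := \<zero>)"
    have b: "b \<in> B" "c b \<in> carrier R"
      using insert.prems by (auto simp: free_mod_carrier)
    have supp: "{b'. ?u b' \<noteq> \<zero>} = T" using insert by auto
    have u: "?u \<in> carrier (free_mod R B)"
      unfolding free_mod_carrier supp using insert.hyps insert.prems by (auto simp: free_mod_carrier)
    have v: "c b \<odot>\<^bsub>free_mod R B\<^esub> basis_vec R b \<in> carrier (free_mod R B)"
      using b by (simp add: free_smult_closed basis_vec_closed)
    have "c = ?u \<oplus>\<^bsub>free_mod R B\<^esub> (c b \<odot>\<^bsub>free_mod R B\<^esub> basis_vec R b)"
      using insert.prems(1) by (auto simp: basis_vec_def free_mod_carrier fun_eq_iff)
    then show ?case
      using add[OF u v insert.IH[OF u supp] basis[OF b(2,1)]] by simp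
  qed
  then show ?thesis using assms(1) by (auto simp: free_mod_carrier)
qed

end

text \<open>\<open>lin_ext\<close> sums over the support of its argument, which changes with the
  argument. Additivity compares three such sums, so they must first be brought to a common finite
  index set.\<close>

lemma lin_ext_superset:
  assumes "module R M" "finite T" "{b. c b \<noteq> \<zero>\<^bsub>R\<^esub>} \<subseteq> T" "\<phi> \<in> T \<rightarrow> carrier M"
    "\<And>b. c b \<in> carrier R"
  shows "lin_ext R M \<phi> c = (\<Oplus>\<^bsub>M\<^esub> b \<in> T. c b \<odot>\<^bsub>M\<^esub> \<phi> b)"
proof -
  interpret module R M by fact
  show ?thesis unfolding lin_ext_def
    by (rule M.add.finprod_mono_neutral_cong_left) (use assms in \<open>auto simp: Pi_def\<close>)
qed

lemma lin_lin_ext: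
  assumes M: "module R M" and \<phi>: "\<And>b. b \<in> B \<Longrightarrow> \<phi> b \<in> carrier M"
  shows "lin R (free_mod R B) M (lin_ext R M \<phi>)"
proof -
  interpret module R M by fact
  have cl: "lin_ext R M \<phi> c \<in> carrier M" if "c \<in> carrier (free_mod R B)" for c
    unfolding lin_ext_def
    by (rule M.finsum_closed) (use that \<phi> in \<open>auto simp: free_mod_carrier\<close>)
  show ?thesis
  proof (rule linI[OF cl])
    fix u v assume uv: "u \<in> carrier (free_mod R B)" "v \<in> carrier (free_mod R B)"
    let ?T = "{b. u b \<noteq> \<zero>\<^bsub>R\<^esub>} \<union> {b. v b \<noteq> \<zero>\<^bsub>R\<^esub>}"
    have T: "finite ?T" "\<phi> \<in> ?T \<rightarrow> carrier M" using uv \<phi> by (auto simp: free_mod_carrier)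
    have c: "\<And>b. u b \<in> carrier R" "\<And>b. v b \<in> carrier R" using uv by (auto simp: free_mod_carrier)
    have "lin_ext R M \<phi> (\<lambda>b. u b \<oplus>\<^bsub>R\<^esub> v b) = (\<Oplus>\<^bsub>M\<^esub> b \<in> ?T. (u b \<oplus>\<^bsub>R\<^esub> v b) \<odot>\<^bsub>M\<^esub> \<phi> b)"
      by (rule lin_ext_superset[OF M T(1) _ T(2)]) (use c in auto)
    also have "\<dots> = (\<Oplus>\<^bsub>M\<^esub> b \<in> ?T. u b \<odot>\<^bsub>M\<^esub> \<phi> b \<oplus>\<^bsub>M\<^esub> v b \<odot>\<^bsub>M\<^esub> \<phi> b)"
      by (rule M.finsum_cong') (use c T in \<open>auto simp: smult_l_distr Pi_def\<close>)
    also have "\<dots> = (\<Oplus>\<^bsub>M\<^esub> b \<in> ?T. u b \<odot>\<^bsub>M\<^esub> \<phi> b) \<oplus>\<^bsub>M\<^esub> (\<Oplus>\<^bsub>M\<^esub> b \<in> ?T. v b \<odot>\<^bsub>M\<^esub> \<phi> b)"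
      by (rule M.finsum_addf) (use c T in \<open>auto simp: Pi_def\<close>)
    also have "(\<Oplus>\<^bsub>M\<^esub> b \<in> ?T. u b \<odot>\<^bsub>M\<^esub> \<phi> b) = lin_ext R M \<phi> u"
      by (rule lin_ext_superset[OF M T(1) _ T(2), symmetric]) (use c in auto)
    also have "(\<Oplus>\<^bsub>M\<^esub> b \<in> ?T. v b \<odot>\<^bsub>M\<^esub> \<phi> b) = lin_ext R M \<phi> v"
      by (rule lin_ext_superset[OF M T(1) _ T(2), symmetric]) (use c in auto)
    finally show "lin_ext R M \<phi> (u \<oplus>\<^bsub>free_mod R B\<^esub> v) = lin_ext R M \<phi> u \<oplus>\<^bsub>M\<^esub> lin_ext R M \<phi> v"
      by simp
  next
    fix a u assume a: "a \<in> carrier R" and u: "u \<in> carrier (free_mod R B)"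
    let ?T = "{b. u b \<noteq> \<zero>\<^bsub>R\<^esub>}"
    have T: "finite ?T" "\<phi> \<in> ?T \<rightarrow> carrier M" using u \<phi> by (auto simp: free_mod_carrier)
    have c: "\<And>b. u b \<in> carrier R" using u by (auto simp: free_mod_carrier)
    have "lin_ext R M \<phi> (\<lambda>b. a \<otimes>\<^bsub>R\<^esub> u b) = (\<Oplus>\<^bsub>M\<^esub> b \<in> ?T. (a \<otimes>\<^bsub>R\<^esub> u b) \<odot>\<^bsub>M\<^esub> \<phi> b)"
      by (rule lin_ext_superset[OF M T(1) _ T(2)]) (use a c in auto)
    also have "\<dots> = (\<Oplus>\<^bsub>M\<^esub> b \<in> ?T. a \<odot>\<^bsub>M\<^esub> (u b \<odot>\<^bsub>M\<^esub> \<phi> b))"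
      by (rule M.finsum_cong') (use a c T in \<open>auto simp: smult_assoc1 Pi_def\<close>)
    also have "\<dots> = a \<odot>\<^bsub>M\<^esub> (\<Oplus>\<^bsub>M\<^esub> b \<in> ?T. u b \<odot>\<^bsub>M\<^esub> \<phi> b)"
      by (rule finsum_smult_ldistr[symmetric]) (use a c T in \<open>auto simp: Pi_def\<close>)
    finally show "lin_ext R M \<phi> (a \<odot>\<^bsub>free_mod R B\<^esub> u) = a \<odot>\<^bsub>M\<^esub> lin_ext R M \<phi> u"
      by (simp add: lin_ext_def)
  qed
qed

lemma lin_ext_basis_vec:
  assumes M: "module R M" and \<phi>: "\<phi> b \<in> carrier M"
  shows "lin_ext R M \<phi> (basis_vec R b) = \<phi> b"
proof -
  interpret module R M by fact
  have "lin_ext R M \<phi> (basis_vec R b) = (\<Oplus>\<^bsub>M\<^esub> b' \<in> {b}. basis_vec R b b' \<odot>\<^bsub>M\<^esub> \<phi> b')"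
    by (rule lin_ext_superset[OF M]) (use \<phi> in \<open>auto simp: basis_vec_def\<close>)
  then show ?thesis using \<phi> by (simp add: basis_vec_def)
qed

lemma lin_eq_on_basis:
  assumes M: "module R M" and "lin R (free_mod R B) M f" "lin R (free_mod R B) M g"
    and "\<And>b. b \<in> B \<Longrightarrow> f (basis_vec R b) = g (basis_vec R b)" and c: "c \<in> carrier (free_mod R B)"
  shows "f c = g c"
proof -
  interpret module R M by fact
  show ?thesis using c
  proof (induction rule: R.free_induct)
    case zero
    then show ?case
      using lin_zero[OF R.free_mod_module M assms(2)] lin_zero[OF R.free_mod_module M assms(3)] by simp
  next
    case (basis a b)
    then show ?case
      using lin_smult[OF assms(2)] lin_smult[OF assms(3)] R.basis_vec_closed[of b B] assms(4) by metis
  next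
    case (add u v)
    then show ?case using lin_add[OF assms(2)] lin_add[OF assms(3)] by metis
  qed
qed

text \<open>Taking \<open>t = \<zero>\<close> gives projectivity of free modules; general \<open>t\<close> gives lifting modulo \<open>t\<close>.\<close>

lemma free_lift:
  assumes A: "module R A" and C: "module R C" and \<psi>: "lin R A C \<psi>"
    and \<phi>: "lin R (free_mod R B) C \<phi>" and t: "t \<in> carrier R"
    and ex: "\<And>c. c \<in> carrier (free_mod R B) \<Longrightarrow>
      \<exists>u \<in> carrier A. \<exists>w \<in> carrier C. \<phi> c = \<psi> u \<oplus>\<^bsub>C\<^esub> t \<odot>\<^bsub>C\<^esub> w"
  shows "\<exists>\<epsilon>. lin R (free_mod R B) A \<epsilon> \<and>
    (\<forall>c \<in> carrier (free_mod R B). \<exists>w \<in> carrier C. \<phi> c = \<psi> (\<epsilon> c) \<oplus>\<^bsub>C\<^esub> t \<odot>\<^bsub>C\<^esub> w)"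
proof -
  interpret A: module R A by fact
  interpret C: module R C by fact
  have "\<forall>b \<in> B. \<exists>u. u \<in> carrier A \<and> (\<exists>w \<in> carrier C. \<phi> (basis_vec R b) = \<psi> u \<oplus>\<^bsub>C\<^esub> t \<odot>\<^bsub>C\<^esub> w)"
    using ex[OF A.R.basis_vec_closed] by blast
  then obtain e where e: "\<And>b. b \<in> B \<Longrightarrow> e b \<in> carrier A"
    "\<And>b. b \<in> B \<Longrightarrow> \<exists>w \<in> carrier C. \<phi> (basis_vec R b) = \<psi> (e b) \<oplus>\<^bsub>C\<^esub> t \<odot>\<^bsub>C\<^esub> w"
    by metis
  let ?e = "lin_ext R A e"
  have le: "lin R (free_mod R B) A ?e" by (rule lin_lin_ext[OF A e(1)])
  have "\<exists>w \<in> carrier C. \<phi> c = \<psi> (?e c) \<oplus>\<^bsub>C\<^esub> t \<odot>\<^bsub>C\<^esub> w" if "c \<in> carrier (free_mod R B)" for c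
    using that
  proof (induction rule: A.R.free_induct)
    case zero
    have "\<phi> (\<lambda>b. \<zero>\<^bsub>R\<^esub>) = \<zero>\<^bsub>C\<^esub>" "\<psi> (?e (\<lambda>b. \<zero>\<^bsub>R\<^esub>)) = \<zero>\<^bsub>C\<^esub>"
      using lin_zero[OF A.R.free_mod_module C \<phi>] lin_zero[OF A.R.free_mod_module A le]
        lin_zero[OF A C \<psi>] by auto
    then show ?case using t by (intro bexI[of _ "\<zero>\<^bsub>C\<^esub>"]) auto
  next
    case (basis a b)
    obtain w where w: "w \<in> carrier C" "\<phi> (basis_vec R b) = \<psi> (e b) \<oplus>\<^bsub>C\<^esub> t \<odot>\<^bsub>C\<^esub> w" using e(2)[OF basis(2)] by auto
    have b: "basis_vec R b \<in> carrier (free_mod R B)" by (rule A.R.basis_vec_closed[OF basis(2)])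
    have "\<phi> (a \<odot>\<^bsub>free_mod R B\<^esub> basis_vec R b) = a \<odot>\<^bsub>C\<^esub> (\<psi> (e b) \<oplus>\<^bsub>C\<^esub> t \<odot>\<^bsub>C\<^esub> w)"
      using lin_smult[OF \<phi> basis(1) b] w by simp
    also have "\<dots> = \<psi> (a \<odot>\<^bsub>A\<^esub> e b) \<oplus>\<^bsub>C\<^esub> t \<odot>\<^bsub>C\<^esub> (a \<odot>\<^bsub>C\<^esub> w)"
      using basis w e(1) t lin_closed[OF \<psi>] lin_smult[OF \<psi>]
      by (simp add: C.smult_r_distr C.smult_assoc1[symmetric] A.R.m_comm)
    also have "a \<odot>\<^bsub>A\<^esub> e b = ?e (a \<odot>\<^bsub>free_mod R B\<^esub> basis_vec R b)"
      using lin_smult[OF le basis(1) b] lin_ext_basis_vec[OF A, of e b] e(1)[OF basis(2)] by simp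
    finally show ?case using w basis by (intro bexI[of _ "a \<odot>\<^bsub>C\<^esub> w"]) auto
  next
    case (add u v)
    then obtain w1 w2 where w: "w1 \<in> carrier C" "\<phi> u = \<psi> (?e u) \<oplus>\<^bsub>C\<^esub> t \<odot>\<^bsub>C\<^esub> w1"
      "w2 \<in> carrier C" "\<phi> v = \<psi> (?e v) \<oplus>\<^bsub>C\<^esub> t \<odot>\<^bsub>C\<^esub> w2" by auto
    have "\<phi> (u \<oplus>\<^bsub>free_mod R B\<^esub> v) = (\<psi> (?e u) \<oplus>\<^bsub>C\<^esub> \<psi> (?e v)) \<oplus>\<^bsub>C\<^esub> t \<odot>\<^bsub>C\<^esub> (w1 \<oplus>\<^bsub>C\<^esub> w2)"
      using w add(1,2) t lin_add[OF \<phi> add(1,2)] lin_closed[OF \<psi>] lin_closed[OF le]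
      by (simp add: C.smult_r_distr C.M.a_ac)
    also have "\<psi> (?e u) \<oplus>\<^bsub>C\<^esub> \<psi> (?e v) = \<psi> (?e (u \<oplus>\<^bsub>free_mod R B\<^esub> v))"
      using lin_add[OF le add(1,2)] lin_add[OF \<psi>] lin_closed[OF le] add(1,2) by simp
    finally show ?case using w by (intro bexI[of _ "w1 \<oplus>\<^bsub>C\<^esub> w2"]) auto
  qed
  then show ?thesis using le by blast
qed

lemma free_lift_exact:
  assumes A: "module R A" and C: "module R C" and \<psi>: "lin R A C \<psi>"
    and \<phi>: "lin R (free_mod R B) C \<phi>"
    and ex: "\<And>c. c \<in> carrier (free_mod R B) \<Longrightarrow> \<exists>u \<in> carrier A. \<phi> c = \<psi> u"
  shows "\<exists>\<epsilon>. lin R (free_mod R B) A \<epsilon> \<and> (\<forall>c \<in> carrier (free_mod R B). \<phi> c = \<psi> (\<epsilon> c))"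
proof -
  interpret A: module R A by fact
  interpret C: module R C by fact
  have z: "\<psi> u \<oplus>\<^bsub>C\<^esub> \<zero>\<^bsub>R\<^esub> \<odot>\<^bsub>C\<^esub> w = \<psi> u" if "u \<in> carrier A" "w \<in> carrier C" for u w
    using that lin_closed[OF \<psi>] by simp
  have "\<exists>\<epsilon>. lin R (free_mod R B) A \<epsilon> \<and>
    (\<forall>c \<in> carrier (free_mod R B). \<exists>w \<in> carrier C. \<phi> c = \<psi> (\<epsilon> c) \<oplus>\<^bsub>C\<^esub> \<zero>\<^bsub>R\<^esub> \<odot>\<^bsub>C\<^esub> w)"
  proof (rule free_lift[OF A C \<psi> \<phi> A.R.zero_closed])
    fix c assume "c \<in> carrier (free_mod R B)"
    then obtain u where "u \<in> carrier A" "\<phi> c = \<psi> u" using ex by blast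
    then show "\<exists>u \<in> carrier A. \<exists>w \<in> carrier C. \<phi> c = \<psi> u \<oplus>\<^bsub>C\<^esub> \<zero>\<^bsub>R\<^esub> \<odot>\<^bsub>C\<^esub> w"
      using z C.M.zero_closed by metis
  qed
  then show ?thesis using z lin_closed by metis
qed

text \<open>From here on the operations of free modules stay folded, so that the general module laws
  apply to them; arguments by coordinates unfold them explicitly.\<close>

declare free_mod_simps [simp del]

lemma (in module) eq_plus_minus:
  assumes "u \<in> carrier M" "v \<in> carrier M"
  shows "u = v \<oplus>\<^bsub>M\<^esub> (u \<ominus>\<^bsub>M\<^esub> v)"
  using assms by (simp add: a_minus_def M.a_lcomm M.r_neg)

lemma (in module) neg_zero [simp]: "\<ominus>\<^bsub>M\<^esub> \<zero>\<^bsub>M\<^esub> = \<zero>\<^bsub>M\<^esub>"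
  using M.r_neg[OF M.zero_closed] by simp

section \<open>Lifts of the multiplications\<close>

text \<open>
  Iterating the mapping cone below adds free modules again and again.  The maps \<open>inl\<close> and \<open>inr\<close> turn
  a disjoint union of two bases into a set of the same type, so that this can be done by recursion.
\<close>

locale ann_chain_module = cring S for S :: "('a, 'z) ring_scheme" (structure) +
  fixes inl inr :: "'b \<Rightarrow> 'b" and N :: "('a, 'n) module"
  assumes inj_inl: "inj inl" and inj_inr: "inj inr" and inl_inr: "inl b \<noteq> inr b'"
    and N: "module S N"
begin

interpretation N: module S N by (rule N)
interpretation F: module S "free_mod S B" for B :: "'b set" by (rule free_mod_module)

abbreviation Fr :: "'b set \<Rightarrow> ('b \<Rightarrow> 'a) set"
  where "Fr B \<equiv> carrier (free_mod S B)"

section \<open>Direct sums of two free modules inside one type\<close>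

definition sum_basis :: "'b set \<Rightarrow> 'b set \<Rightarrow> 'b set"
  where "sum_basis B C = inl ` B \<union> inr ` C"

definition proj1 :: "('b \<Rightarrow> 'a) \<Rightarrow> 'b \<Rightarrow> 'a"
  where "proj1 c = (\<lambda>b. c (inl b))"

definition proj2 :: "('b \<Rightarrow> 'a) \<Rightarrow> 'b \<Rightarrow> 'a"
  where "proj2 c = (\<lambda>b. c (inr b))"

definition pair :: "('b \<Rightarrow> 'a) \<Rightarrow> ('b \<Rightarrow> 'a) \<Rightarrow> 'b \<Rightarrow> 'a"
  where "pair u v = (\<lambda>b. if b \<in> range inl then u (inv_into UNIV inl b)
    else if b \<in> range inr then v (inv_into UNIV inr b) else \<zero>)"

lemma pair_inl [simp]: "pair u v (inl b) = u b"
  by (simp add: pair_def inj_inl)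

lemma pair_inr [simp]: "pair u v (inr b) = v b"
proof -
  have "inr b \<notin> range inl" using inl_inr[symmetric] by blast
  then show ?thesis by (simp add: pair_def inj_inr)
qed

lemma proj1_pair [simp]: "proj1 (pair u v) = u"
  by (simp add: proj1_def)

lemma proj2_pair [simp]: "proj2 (pair u v) = v"
  by (simp add: proj2_def)

lemma proj1_closed [simp]:
  assumes c: "c \<in> Fr (sum_basis B C)"
  shows "proj1 c \<in> Fr B"
proof -
  have "finite (inl -` {b. c b \<noteq> \<zero>})"
    using c by (intro finite_vimageI inj_inl) (simp add: free_mod_carrier)
  moreover have "b \<in> B" if "inl b \<in> sum_basis B C" for b
    using that inl_inr by (auto simp: sum_basis_def inj_eq[OF inj_inl])
  ultimately show ?thesis using c by (auto simp: free_mod_carrier proj1_def vimage_def)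
qed

lemma proj2_closed [simp]:
  assumes c: "c \<in> Fr (sum_basis B C)"
  shows "proj2 c \<in> Fr C"
proof -
  have "finite (inr -` {b. c b \<noteq> \<zero>})"
    using c by (intro finite_vimageI inj_inr) (simp add: free_mod_carrier)
  moreover have "b \<in> C" if "inr b \<in> sum_basis B C" for b
    using that inl_inr[symmetric] by (auto simp: sum_basis_def inj_eq[OF inj_inr])
  ultimately show ?thesis using c by (auto simp: free_mod_carrier proj2_def vimage_def)
qed

lemma pair_closed [simp]:
  assumes "u \<in> Fr B" "v \<in> Fr C"
  shows "pair u v \<in> Fr (sum_basis B C)"
proof -
  have "{b. pair u v b \<noteq> \<zero>} = inl ` {b. u b \<noteq> \<zero>} \<union> inr ` {b. v b \<noteq> \<zero>}" (is "?L = ?R")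
  proof
    show "?L \<subseteq> ?R"
    proof
      fix b assume b: "b \<in> ?L"
      then consider b' where "b = inl b'" | b' where "b = inr b'"
        by (auto simp: pair_def split: if_splits)
      then show "b \<in> ?R" using b by cases auto
    qed
  qed auto
  moreover have "pair u v b \<in> carrier S" for b using assms by (auto simp: pair_def free_mod_carrier)
  ultimately show ?thesis using assms by (auto simp: free_mod_carrier sum_basis_def)
qed

lemma pair_proj [simp]: "c \<in> Fr (sum_basis B C) \<Longrightarrow> pair (proj1 c) (proj2 c) = c"
proof
  fix b assume c: "c \<in> Fr (sum_basis B C)"
  consider b' where "b = inl b'" | b' where "b = inr b'" | "b \<notin> range inl" "b \<notin> range inr" by blast
  then show "pair (proj1 c) (proj2 c) b = c b"
  proof cases
    \<comment> \<open>Off both ranges \<open>pair\<close> is zero by default, and \<open>c\<close>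
      is zero because its support lies in \<open>sum_basis B C\<close>.\<close>
    case 3
    then have "c b = \<zero>" using c by (auto simp: free_mod_carrier sum_basis_def)
    then show ?thesis using 3 by (simp add: pair_def)
  qed (simp_all add: proj1_def proj2_def)
qed

lemma lin_proj1: "lin S (free_mod S (sum_basis B C)) (free_mod S B) proj1"
  by (rule linI) (auto simp: free_mod_simps, simp_all add: proj1_def)

lemma lin_proj2: "lin S (free_mod S (sum_basis B C)) (free_mod S C) proj2"
  by (rule linI) (auto simp: free_mod_simps, simp_all add: proj2_def)

lemma lin_pair:
  assumes "lin S A (free_mod S B) f" "lin S A (free_mod S C) g"
  shows "lin S A (free_mod S (sum_basis B C)) (\<lambda>u. pair (f u) (g u))"
proof (rule linI)
  fix u assume "u \<in> carrier A"
  then show "pair (f u) (g u) \<in> Fr (sum_basis B C)" using assms by (simp add: lin_closed)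
qed (use assms in \<open>auto simp: lin_add lin_smult free_mod_simps pair_def fun_eq_iff\<close>)

text \<open>This is exactness of the complex with \<open>S\<close> in each degree and the
  multiplications s j as differentials, which thus resolves S / (s 0). It is stated for a general
  sequence because the cone construction changes signs.\<close>

definition ann_chain :: "(nat \<Rightarrow> 'a) \<Rightarrow> bool"
  where "ann_chain s \<longleftrightarrow> (\<forall>j. s j \<in> carrier S \<and> annihilator S (s j) = PIdl (s (Suc j)))"

definition kills_N :: "(nat \<Rightarrow> 'a) \<Rightarrow> bool"
  where "kills_N s \<longleftrightarrow> (\<forall>j. \<forall>v \<in> carrier N. s j \<odot>\<^bsub>N\<^esub> v = \<zero>\<^bsub>N\<^esub>)"

lemma ann_chain_closed [simp]: "ann_chain s \<Longrightarrow> s j \<in> carrier S"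
  by (simp add: ann_chain_def)

lemma ann_chain_mult: "ann_chain s \<Longrightarrow> s (Suc j) \<otimes> s j = \<zero>"
  using cgenideal_self[of "s (Suc j)"] by (auto simp: ann_chain_def annihilator_def set_eq_iff)

lemma ann_chain_mult': "ann_chain s \<Longrightarrow> s j \<otimes> s (Suc j) = \<zero>"
  using ann_chain_mult[of s j] by (simp add: m_comm)

lemma ann_chain_smult: "ann_chain s \<Longrightarrow> c \<in> Fr B \<Longrightarrow> s (Suc j) \<odot>\<^bsub>free_mod S B\<^esub> (s j \<odot>\<^bsub>free_mod S B\<^esub> c) = \<zero>\<^bsub>free_mod S B\<^esub>"
  by (simp add: F.smult_assoc1[symmetric] ann_chain_mult)

lemma ann_chain_smult': "ann_chain s \<Longrightarrow> c \<in> Fr B \<Longrightarrow> s j \<odot>\<^bsub>free_mod S B\<^esub> (s (Suc j) \<odot>\<^bsub>free_mod S B\<^esub> c) = \<zero>\<^bsub>free_mod S B\<^esub>"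
  by (simp add: F.smult_assoc1[symmetric] ann_chain_mult')

lemma ann_chain_kernel:
  assumes s: "ann_chain s" and c: "c \<in> Fr B" and z: "s j \<odot>\<^bsub>free_mod S B\<^esub> c = \<zero>\<^bsub>free_mod S B\<^esub>"
  shows "\<exists>q \<in> Fr B. c = s (Suc j) \<odot>\<^bsub>free_mod S B\<^esub> q"
proof -
  \<comment> \<open>The last conjunct keeps the support of the chosen coordinates inside that of
    \<open>c\<close>, hence finite.\<close>
  have "\<exists>q. q \<in> carrier S \<and> c b = s (Suc j) \<otimes> q \<and> (c b = \<zero> \<longrightarrow> q = \<zero>)" for b
  proof (cases "c b = \<zero>")
    case True
    then show ?thesis using s by (auto intro!: exI[of _ \<zero>])
  next
    case False
    have cb: "c b \<in> carrier S" using c by (simp add: free_mod_carrier)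
    have "s j \<otimes> c b = \<zero>" using z by (simp add: free_mod_simps fun_eq_iff)
    then have "c b \<in> annihilator S (s j)" using cb s by (simp add: annihilator_def m_comm)
    then have "c b \<in> PIdl (s (Suc j))" using s by (simp add: ann_chain_def)
    then obtain q where "q \<in> carrier S" "c b = q \<otimes> s (Suc j)" by (auto simp: cgenideal_def)
    then show ?thesis using False s by (auto simp: m_comm)
  qed
  then obtain q where q: "\<And>b. q b \<in> carrier S" "\<And>b. c b = s (Suc j) \<otimes> q b" "\<And>b. c b = \<zero> \<Longrightarrow> q b = \<zero>"
    by metis
  have "{b. q b \<noteq> \<zero>} \<subseteq> {b. c b \<noteq> \<zero>}" using q(3) by auto
  then have "q \<in> Fr B" using c q(1) by (auto simp: free_mod_carrier intro: finite_subset)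
  then show ?thesis using q(2) by (auto simp: free_mod_simps)
qed

text \<open>The difference of \<open>u\<close> and \<open>v\<close> is killed by s j, so it is a
  multiple of s (Suc j), and linear maps to \<open>N\<close> send such multiples to zero. This makes
  s j cancellable inside a map to \<open>N\<close>.\<close>

lemma ann_chain_cancel:
  assumes s: "ann_chain s" "kills_N s" and g: "lin S (free_mod S B) N g" and u: "u \<in> Fr B" "v \<in> Fr B"
    and eq: "s j \<odot>\<^bsub>free_mod S B\<^esub> u = s j \<odot>\<^bsub>free_mod S B\<^esub> v"
  shows "g u = g v"
proof -
  have "s j \<odot>\<^bsub>free_mod S B\<^esub> (u \<ominus>\<^bsub>free_mod S B\<^esub> v) = \<zero>\<^bsub>free_mod S B\<^esub>"
    using s u eq by (simp add: a_minus_def F.smult_r_distr F.smult_r_minus F.M.r_neg)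
  then obtain q where q: "q \<in> Fr B" "u \<ominus>\<^bsub>free_mod S B\<^esub> v = s (Suc j) \<odot>\<^bsub>free_mod S B\<^esub> q"
    using ann_chain_kernel[OF s(1) F.M.minus_closed[OF u]] by blast
  then have "u = v \<oplus>\<^bsub>free_mod S B\<^esub> s (Suc j) \<odot>\<^bsub>free_mod S B\<^esub> q"
    using F.eq_plus_minus[OF u] by simp
  then have "g u = g v \<oplus>\<^bsub>N\<^esub> s (Suc j) \<odot>\<^bsub>N\<^esub> g q"
    using u q s by (simp add: lin_add[OF g] lin_smult[OF g])
  then show ?thesis using s u q lin_closed[OF g] by (simp add: kills_N_def)
qed

text \<open>A free resolution of the cokernel of \<open>d 0\<close>, which is killed by \<open>s 0\<close>.\<close>

definition resol ::
    "(nat \<Rightarrow> 'a) \<Rightarrow> (nat \<Rightarrow> 'b set) \<Rightarrow> (nat \<Rightarrow> ('b \<Rightarrow> 'a) \<Rightarrow> ('b \<Rightarrow> 'a)) \<Rightarrow> bool"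
  where "resol s B d \<longleftrightarrow> ann_chain s \<and> (\<forall>j. lin S (free_mod S (B (Suc j))) (free_mod S (B j)) (d j))
    \<and> (\<forall>j. \<forall>c \<in> Fr (B (Suc (Suc j))). d j (d (Suc j) c) = \<zero>\<^bsub>free_mod S (B j)\<^esub>)
    \<and> (\<forall>j. \<forall>c \<in> Fr (B (Suc j)). d j c = \<zero>\<^bsub>free_mod S (B j)\<^esub> \<longrightarrow> (\<exists>c' \<in> Fr (B (Suc (Suc j))). c = d (Suc j) c'))
    \<and> (\<forall>c \<in> Fr (B 0). \<exists>c' \<in> Fr (B (Suc 0)). d 0 c' = s 0 \<odot>\<^bsub>free_mod S (B 0)\<^esub> c)"

lemma resolD:
  assumes "resol s B d"
  shows "ann_chain s" "lin S (free_mod S (B (Suc j))) (free_mod S (B j)) (d j)"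
    "c \<in> Fr (B (Suc (Suc j))) \<Longrightarrow> d j (d (Suc j) c) = \<zero>\<^bsub>free_mod S (B j)\<^esub>"
    "c \<in> Fr (B (Suc j)) \<Longrightarrow> d j c = \<zero>\<^bsub>free_mod S (B j)\<^esub> \<Longrightarrow> \<exists>c' \<in> Fr (B (Suc (Suc j))). c = d (Suc j) c'"
    "c \<in> Fr (B 0) \<Longrightarrow> \<exists>c' \<in> Fr (B (Suc 0)). d 0 c' = s 0 \<odot>\<^bsub>free_mod S (B 0)\<^esub> c"
  using assms by (auto simp: resol_def)

lemma resol_exact_diff:
  assumes r: "resol s B d" and u: "u \<in> Fr (B (Suc j))" "v \<in> Fr (B (Suc j))" and eq: "d j u = d j v"
  shows "\<exists>w \<in> Fr (B (Suc (Suc j))). u = v \<oplus>\<^bsub>free_mod S (B (Suc j))\<^esub> d (Suc j) w"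
proof -
  note d = resolD(2)[OF r, of j]
  have "d j (u \<ominus>\<^bsub>free_mod S (B (Suc j))\<^esub> v) = \<zero>\<^bsub>free_mod S (B j)\<^esub>"
    using u eq lin_closed[OF d] lin_neg[OF F.module_axioms F.module_axioms d]
    by (simp add: a_minus_def lin_add[OF d] F.M.r_neg)
  then obtain w where "w \<in> Fr (B (Suc (Suc j)))" "u \<ominus>\<^bsub>free_mod S (B (Suc j))\<^esub> v = d (Suc j) w"
    using resolD(4)[OF r F.M.minus_closed[OF u]] by blast
  then show ?thesis using F.eq_plus_minus[OF u] by auto
qed

definition mult_lifts where
  "mult_lifts s B d \<epsilon> \<longleftrightarrow> (\<forall>j. lin S (free_mod S (B 0)) (free_mod S (B j)) (\<epsilon> j))
    \<and> (\<forall>c \<in> Fr (B 0). \<epsilon> 0 c = c)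
    \<and> (\<forall>j. \<forall>c \<in> Fr (B 0). d j (\<epsilon> (Suc j) c) = s j \<odot>\<^bsub>free_mod S (B j)\<^esub> \<epsilon> j c)"

lemma mult_liftsD:
  assumes "mult_lifts s B d \<epsilon>"
  shows "lin S (free_mod S (B 0)) (free_mod S (B j)) (\<epsilon> j)"
    "c \<in> Fr (B 0) \<Longrightarrow> \<epsilon> 0 c = c"
    "c \<in> Fr (B 0) \<Longrightarrow> d j (\<epsilon> (Suc j) c) = s j \<odot>\<^bsub>free_mod S (B j)\<^esub> \<epsilon> j c"
  using assms by (auto simp: mult_lifts_def)

text \<open>One choice is fixed, so that the cone becomes a function of the resolution alone and can
  be iterated with \<open>^^\<close>.\<close>

definition lift_seq where "lift_seq s B d = (SOME \<epsilon>. mult_lifts s B d \<epsilon>)"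

lemma mult_lifts_lift_seq:
  assumes r: "resol s B d"
  shows "mult_lifts s B d (lift_seq s B d)"
proof -
  \<comment> \<open>The invariant of the dependent choice includes that the next lifting problem is
    solvable. In degree 0 this holds because s 0 kills the cokernel of \<open>d 0\<close>. Later it
    follows from exactness, as the element to be lifted is a cycle by s (Suc j) s j = 0.\<close>
  let ?P = "\<lambda>j f. lin S (free_mod S (B 0)) (free_mod S (B j)) f \<and> (j = 0 \<longrightarrow> f = (\<lambda>c. c)) \<and>
    (\<forall>c \<in> Fr (B 0). \<exists>u \<in> Fr (B (Suc j)). s j \<odot>\<^bsub>free_mod S (B j)\<^esub> f c = d j u)"
  let ?Q = "\<lambda>j f g. \<forall>c \<in> Fr (B 0). s j \<odot>\<^bsub>free_mod S (B j)\<^esub> f c = d j (g c)"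
  have "\<exists>\<epsilon>. \<forall>j. ?P j (\<epsilon> j) \<and> ?Q j (\<epsilon> j) (\<epsilon> (Suc j))"
  proof (rule dependent_nat_choice)
    show "\<exists>f. ?P 0 f" using resolD(5)[OF r] by (intro exI[of _ "\<lambda>c. c"]) (auto simp: lin_id, metis)
  next
    fix f j assume f: "?P j f"
    note s = resolD(1)[OF r]
    have "\<exists>g. lin S (free_mod S (B 0)) (free_mod S (B (Suc j))) g \<and>
      (\<forall>c \<in> Fr (B 0). s j \<odot>\<^bsub>free_mod S (B j)\<^esub> f c = d j (g c))"
      by (rule free_lift_exact[OF F.module_axioms F.module_axioms resolD(2)[OF r]
            lin_scale[OF F.module_axioms]]) (use f s in auto)
    then obtain g where g: "lin S (free_mod S (B 0)) (free_mod S (B (Suc j))) g"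
      "\<And>c. c \<in> Fr (B 0) \<Longrightarrow> s j \<odot>\<^bsub>free_mod S (B j)\<^esub> f c = d j (g c)" by auto
    have "\<exists>u \<in> Fr (B (Suc (Suc j))). s (Suc j) \<odot>\<^bsub>free_mod S (B (Suc j))\<^esub> g c = d (Suc j) u"
      if c: "c \<in> Fr (B 0)" for c
    proof (rule resolD(4)[OF r])
      have fc: "f c \<in> Fr (B j)" "g c \<in> Fr (B (Suc j))" using lin_closed[OF conjunct1[OF f] c] lin_closed[OF g(1) c] .
      then show "s (Suc j) \<odot>\<^bsub>free_mod S (B (Suc j))\<^esub> g c \<in> Fr (B (Suc j))" using s by simp
      show "d j (s (Suc j) \<odot>\<^bsub>free_mod S (B (Suc j))\<^esub> g c) = \<zero>\<^bsub>free_mod S (B j)\<^esub>"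
        using fc s c by (simp add: lin_smult[OF resolD(2)[OF r]] g(2)[symmetric] ann_chain_smult)
    qed
    then show "\<exists>g. ?P (Suc j) g \<and> ?Q j f g" using g by auto
  qed
  then obtain \<epsilon> where \<epsilon>: "\<forall>j. ?P j (\<epsilon> j) \<and> ?Q j (\<epsilon> j) (\<epsilon> (Suc j))" by (rule exE)
  have "mult_lifts s B d \<epsilon>" unfolding mult_lifts_def
  proof (intro conjI allI ballI)
    fix j
    show "lin S (free_mod S (B 0)) (free_mod S (B j)) (\<epsilon> j)" using \<epsilon> by simp
  next
    fix c
    show "\<epsilon> 0 c = c" using spec[OF \<epsilon>, of 0] by simp
  next
    fix j c assume "c \<in> Fr (B 0)"
    then show "d j (\<epsilon> (Suc j) c) = s j \<odot>\<^bsub>free_mod S (B j)\<^esub> \<epsilon> j c"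
      using spec[OF \<epsilon>, of j] by simp
  qed
  then show ?thesis unfolding lift_seq_def by (rule someI[of "mult_lifts s B d"])
qed

text \<open>So \<open>f \<circ> \<epsilon> j\<close> descends to the cokernel of \<open>d 0\<close> for every cocycle \<open>f\<close> on \<open>Fr (B j)\<close>.\<close>

lemma mult_lifts_boundary:
  assumes r: "resol s B d" and h: "mult_lifts s B d \<epsilon>" and v: "v \<in> Fr (B (Suc 0))"
  shows "\<exists>q \<in> Fr (B j). \<exists>q' \<in> Fr (B (Suc j)).
    \<epsilon> j (d 0 v) = (case j of 0 \<Rightarrow> \<zero> | Suc i \<Rightarrow> s i) \<odot>\<^bsub>free_mod S (B j)\<^esub> q \<oplus>\<^bsub>free_mod S (B j)\<^esub> d j q'"
proof (induction j)
  case 0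
  have "d 0 v \<in> Fr (B 0)" by (rule lin_closed[OF resolD(2)[OF r] v])
  \<comment> \<open>As \<epsilon> 0 is the identity, d 0 v is itself the boundary term; the scalar
    in front of \<open>q\<close> is given the value zero in degree 0.\<close>
  then show ?case using v mult_liftsD(2)[OF h] by (intro bexI[of _ "\<zero>\<^bsub>free_mod S (B 0)\<^esub>"] bexI[of _ v]) auto
next
  case (Suc j)
  note s = resolD(1)[OF r] and d = resolD(2)[OF r]
  obtain q q' where q: "q \<in> Fr (B j)" "q' \<in> Fr (B (Suc j))"
    "\<epsilon> j (d 0 v) = (case j of 0 \<Rightarrow> \<zero> | Suc i \<Rightarrow> s i) \<odot>\<^bsub>free_mod S (B j)\<^esub> q \<oplus>\<^bsub>free_mod S (B j)\<^esub> d j q'"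
    using Suc by blast
  have w: "d 0 v \<in> Fr (B 0)" by (rule lin_closed[OF d v])
  \<comment> \<open>Multiplication by s j kills the first summand, since its scalar is s (j - 1) or
    zero. Hence \<epsilon> (Suc j) (d 0 v) and s j q' have the same image under \<open>d j\<close>,
    and the q' of this degree serves as the \<open>q\<close> of the next.\<close>
  have "s j \<odot>\<^bsub>free_mod S (B j)\<^esub> ((case j of 0 \<Rightarrow> \<zero> | Suc i \<Rightarrow> s i) \<odot>\<^bsub>free_mod S (B j)\<^esub> q) = \<zero>\<^bsub>free_mod S (B j)\<^esub>"
    using s q by (cases j) (auto simp: ann_chain_smult)
  then have "d j (\<epsilon> (Suc j) (d 0 v)) = d j (s j \<odot>\<^bsub>free_mod S (B (Suc j))\<^esub> q')"
    using mult_liftsD(3)[OF h w, of j] q s lin_closed[OF d]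
    by (cases j) (auto simp: F.smult_r_distr lin_smult[OF d])
  moreover have "\<epsilon> (Suc j) (d 0 v) \<in> Fr (B (Suc j))" by (rule lin_closed[OF mult_liftsD(1)[OF h] w])
  ultimately obtain q'' where "q'' \<in> Fr (B (Suc (Suc j)))"
    "\<epsilon> (Suc j) (d 0 v) = s j \<odot>\<^bsub>free_mod S (B (Suc j))\<^esub> q' \<oplus>\<^bsub>free_mod S (B (Suc j))\<^esub> d (Suc j) q''"
    using resol_exact_diff[OF r, of "\<epsilon> (Suc j) (d 0 v)" j "s j \<odot>\<^bsub>free_mod S (B (Suc j))\<^esub> q'"] q s by auto
  then show ?case using q by auto
qed

lemma cocycle_mult_lifts_boundary:
  assumes r: "resol s B d" and h: "mult_lifts s B d \<epsilon>" and k: "kills_N s" and v: "v \<in> Fr (B (Suc 0))"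
    and f: "lin S (free_mod S (B j)) N f" "\<And>c. c \<in> Fr (B (Suc j)) \<Longrightarrow> f (d j c) = \<zero>\<^bsub>N\<^esub>"
  shows "f (\<epsilon> j (d 0 v)) = \<zero>\<^bsub>N\<^esub>"
proof -
  note s = resolD(1)[OF r] and d = resolD(2)[OF r]
  let ?r = "case j of 0 \<Rightarrow> \<zero> | Suc i \<Rightarrow> s i"
  obtain q q' where q: "q \<in> Fr (B j)" "q' \<in> Fr (B (Suc j))"
    "\<epsilon> j (d 0 v) = ?r \<odot>\<^bsub>free_mod S (B j)\<^esub> q \<oplus>\<^bsub>free_mod S (B j)\<^esub> d j q'"
    using mult_lifts_boundary[OF r h v] by blast
  have "?r \<in> carrier S" using s by (cases j) auto
  moreover have "?r \<odot>\<^bsub>N\<^esub> f q = \<zero>\<^bsub>N\<^esub>"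
    using k lin_closed[OF f(1) q(1)] by (cases j) (auto simp: kills_N_def)
  ultimately show ?thesis using q f(2) lin_closed[OF d]
    by (simp add: lin_add[OF f(1)] lin_smult[OF f(1)])
qed

section \<open>The cone of the lifted multiplications\<close>

text \<open>
  The lifts \<open>\<epsilon> j\<close> form a map from the periodic resolution of \<open>Fr (B 0) / s 0\<close> into the given
  resolution.  Its cone, with the two copies of \<open>Fr (B 0)\<close> in lowest degree cancelled, resolves the
  kernel of \<open>Fr (B 0) / s 0 \<rightarrow> Fr (B 0) / im (d 0)\<close>, which is a first syzygy over \<open>S / (s 0)\<close>.
  The signs in \<open>cone_scal\<close> make \<open>cone_mult_lifts_proj2\<close> hold without signs.
\<close>

definition cone_scal :: "(nat \<Rightarrow> 'a) \<Rightarrow> nat \<Rightarrow> 'a"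
  where "cone_scal s j = (case j of 0 \<Rightarrow> s 0 | Suc k \<Rightarrow> \<ominus> s (Suc k))"

definition cone_basis :: "(nat \<Rightarrow> 'b set) \<Rightarrow> nat \<Rightarrow> 'b set"
  where "cone_basis B j = (case j of 0 \<Rightarrow> B (Suc 0) | Suc k \<Rightarrow> sum_basis (B (Suc (Suc k))) (B 0))"

definition cone_diff where
  "cone_diff s B d \<epsilon> j c = (case j of
      0 \<Rightarrow> d (Suc 0) (proj1 c) \<oplus>\<^bsub>free_mod S (B (Suc 0))\<^esub> \<epsilon> (Suc 0) (proj2 c)
    | Suc k \<Rightarrow> pair (d (Suc (Suc k)) (proj1 c) \<oplus>\<^bsub>free_mod S (B (Suc (Suc k)))\<^esub> \<epsilon> (Suc (Suc k)) (proj2 c))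
        (\<ominus> s (Suc k) \<odot>\<^bsub>free_mod S (B 0)\<^esub> proj2 c))"

lemma cone_simps [simp]:
  "cone_scal s 0 = s 0" "cone_scal s (Suc k) = \<ominus> s (Suc k)"
  "cone_basis B 0 = B (Suc 0)" "cone_basis B (Suc k) = sum_basis (B (Suc (Suc k))) (B 0)"
  by (simp_all add: cone_scal_def cone_basis_def)

lemma cone_diff_simps:
  "cone_diff s B d \<epsilon> 0 c = d (Suc 0) (proj1 c) \<oplus>\<^bsub>free_mod S (B (Suc 0))\<^esub> \<epsilon> (Suc 0) (proj2 c)"
  "cone_diff s B d \<epsilon> (Suc k) c =
    pair (d (Suc (Suc k)) (proj1 c) \<oplus>\<^bsub>free_mod S (B (Suc (Suc k)))\<^esub> \<epsilon> (Suc (Suc k)) (proj2 c))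
      (\<ominus> s (Suc k) \<odot>\<^bsub>free_mod S (B 0)\<^esub> proj2 c)"
  by (simp_all add: cone_diff_def)

lemma kills_N_cone: "ann_chain s \<Longrightarrow> kills_N s \<Longrightarrow> kills_N (cone_scal s)"
  by (auto simp: kills_N_def cone_scal_def N.smult_l_minus split: nat.split)

lemma annihilator_minus: "a \<in> carrier S \<Longrightarrow> annihilator S (\<ominus> a) = annihilator S a"
  by (auto simp: annihilator_def r_minus)

lemma cgenideal_minus: "a \<in> carrier S \<Longrightarrow> PIdl (\<ominus> a) = PIdl a"
  unfolding cgenideal_def
  by (auto, metis a_inv_closed l_minus r_minus, metis a_inv_closed l_minus minus_minus r_minus)

lemma ann_chain_cone: "ann_chain s \<Longrightarrow> ann_chain (cone_scal s)"
  by (auto simp: ann_chain_def cone_scal_def annihilator_minus cgenideal_minus split: nat.split)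

context
  fixes s B d \<epsilon>
  assumes r: "resol s B d" and h: "mult_lifts s B d \<epsilon>"
begin

lemma d_lin: "lin S (free_mod S (B (Suc j))) (free_mod S (B j)) (d j)"
  by (rule resolD(2)[OF r])

lemma \<epsilon>_lin: "lin S (free_mod S (B 0)) (free_mod S (B j)) (\<epsilon> j)"
  by (rule mult_liftsD(1)[OF h])

lemma s_good: "ann_chain s"
  by (rule resolD(1)[OF r])

lemma d_closed [simp]: "c \<in> Fr (B (Suc j)) \<Longrightarrow> d j c \<in> Fr (B j)"
  by (rule lin_closed[OF d_lin])

lemma \<epsilon>_closed [simp]: "c \<in> Fr (B 0) \<Longrightarrow> \<epsilon> j c \<in> Fr (B j)"
  by (rule lin_closed[OF \<epsilon>_lin])

lemma s_closed [simp]: "s j \<in> carrier S"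
  by (rule ann_chain_closed[OF s_good])

lemma d_zero [simp]: "d j \<zero>\<^bsub>free_mod S (B (Suc j))\<^esub> = \<zero>\<^bsub>free_mod S (B j)\<^esub>"
  by (rule lin_zero[OF F.module_axioms F.module_axioms d_lin])

text \<open>This determines the cokernel of the lowest differential of the cone: it is the image of
  \<open>d 0\<close> in Fr (B 0) / s 0, the first syzygy over S / (s 0). Later arguments relate the
  cone to work modulo s 0 through this equivalence.\<close>

lemma cone_kernel:
  assumes w: "w \<in> Fr (B (Suc 0))"
  shows "(\<exists>v \<in> Fr (cone_basis B (Suc 0)). w = cone_diff s B d \<epsilon> 0 v) \<longleftrightarrow>
    (\<exists>c \<in> Fr (B 0). d 0 w = s 0 \<odot>\<^bsub>free_mod S (B 0)\<^esub> c)"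
proof
  assume "\<exists>v \<in> Fr (cone_basis B (Suc 0)). w = cone_diff s B d \<epsilon> 0 v"
  then obtain v where v: "v \<in> Fr (sum_basis (B (Suc (Suc 0))) (B 0))"
    "w = d (Suc 0) (proj1 v) \<oplus>\<^bsub>free_mod S (B (Suc 0))\<^esub> \<epsilon> (Suc 0) (proj2 v)"
    by (auto simp: cone_diff_simps)
  note c = proj1_closed[OF v(1)] proj2_closed[OF v(1)]
  have "d 0 w = s 0 \<odot>\<^bsub>free_mod S (B 0)\<^esub> proj2 v"
    using c v(2) by (simp add: lin_add[OF d_lin] resolD(3)[OF r] mult_liftsD(2,3)[OF h])
  then show "\<exists>c \<in> Fr (B 0). d 0 w = s 0 \<odot>\<^bsub>free_mod S (B 0)\<^esub> c" using c by blast
next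
  assume "\<exists>c \<in> Fr (B 0). d 0 w = s 0 \<odot>\<^bsub>free_mod S (B 0)\<^esub> c"
  then obtain c where c: "c \<in> Fr (B 0)" "d 0 w = s 0 \<odot>\<^bsub>free_mod S (B 0)\<^esub> c" by blast
  then have "d 0 w = d 0 (\<epsilon> (Suc 0) c)" by (simp add: mult_liftsD(2,3)[OF h])
  then obtain u where u: "u \<in> Fr (B (Suc (Suc 0)))"
    "w = \<epsilon> (Suc 0) c \<oplus>\<^bsub>free_mod S (B (Suc 0))\<^esub> d (Suc 0) u"
    using resol_exact_diff[OF r w \<epsilon>_closed[OF c(1)]] by blast
  have "w = cone_diff s B d \<epsilon> 0 (pair u c)" using u c by (simp add: cone_diff_simps F.M.a_comm)
  then show "\<exists>v \<in> Fr (cone_basis B (Suc 0)). w = cone_diff s B d \<epsilon> 0 v" using u c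
    by (intro bexI[of _ "pair u c"]) auto
qed

lemma cone_diff_lin:
  "lin S (free_mod S (cone_basis B (Suc j))) (free_mod S (cone_basis B j)) (cone_diff s B d \<epsilon> j)"
proof -
  have 1: "lin S (free_mod S (sum_basis (B (Suc (Suc k))) (B 0))) (free_mod S (B (Suc k)))
    (\<lambda>c. d (Suc k) (proj1 c) \<oplus>\<^bsub>free_mod S (B (Suc k))\<^esub> \<epsilon> (Suc k) (proj2 c))" for k
    by (intro lin_plus F.module_axioms lin_comp[OF lin_proj1 d_lin] lin_comp[OF lin_proj2 \<epsilon>_lin])
  show ?thesis
  proof (cases j)
    case 0
    then show ?thesis using 1[of 0] by (simp add: cone_diff_simps[abs_def])
  next
    case (Suc k)
    have "lin S (free_mod S (sum_basis (B (Suc (Suc (Suc k)))) (B 0))) (free_mod S (sum_basis (B (Suc (Suc k))) (B 0)))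
       (\<lambda>c. pair (d (Suc (Suc k)) (proj1 c) \<oplus>\<^bsub>free_mod S (B (Suc (Suc k)))\<^esub> \<epsilon> (Suc (Suc k)) (proj2 c))
      (\<ominus> s (Suc k) \<odot>\<^bsub>free_mod S (B 0)\<^esub> proj2 c))"
      by (intro lin_pair 1 lin_scale F.module_axioms lin_proj2) simp
    then show ?thesis using Suc by (simp add: cone_diff_simps[abs_def])
  qed
qed

text \<open>The lift contributes s (Suc k) \<epsilon> (Suc k) p, and the sign of the scalar in the
  second component makes the other term its negative. The formula is the whole square in degree 0
  and its first component in higher degrees.\<close>

lemma cone_square_aux:
  assumes u: "u \<in> Fr (B (Suc (Suc (Suc k))))" and p: "p \<in> Fr (B 0)"
  shows "d (Suc k) (d (Suc (Suc k)) u \<oplus>\<^bsub>free_mod S (B (Suc (Suc k)))\<^esub> \<epsilon> (Suc (Suc k)) p)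
    \<oplus>\<^bsub>free_mod S (B (Suc k))\<^esub> \<epsilon> (Suc k) (\<ominus> s (Suc k) \<odot>\<^bsub>free_mod S (B 0)\<^esub> p) = \<zero>\<^bsub>free_mod S (B (Suc k))\<^esub>"
  using u p by (simp add: lin_add[OF d_lin] lin_smult[OF \<epsilon>_lin] resolD(3)[OF r] mult_liftsD(3)[OF h]
      lin_neg[OF F.module_axioms F.module_axioms \<epsilon>_lin] F.smult_l_minus F.M.r_neg)

lemma cone_square:
  assumes c: "c \<in> Fr (cone_basis B (Suc (Suc j)))"
  shows "cone_diff s B d \<epsilon> j (cone_diff s B d \<epsilon> (Suc j) c) = \<zero>\<^bsub>free_mod S (cone_basis B j)\<^esub>"
proof -
  have c': "proj1 c \<in> Fr (B (Suc (Suc (Suc j))))" "proj2 c \<in> Fr (B 0)" using c by auto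
  show ?thesis
  proof (cases j)
    case 0
    then show ?thesis using cone_square_aux[OF c'] by (simp add: cone_diff_simps)
  next
    case (Suc k)
    have "\<ominus> s (Suc k) \<odot>\<^bsub>free_mod S (B 0)\<^esub> (\<ominus> s (Suc (Suc k)) \<odot>\<^bsub>free_mod S (B 0)\<^esub> proj2 c) = \<zero>\<^bsub>free_mod S (B 0)\<^esub>"
      using c' s_good by (simp add: F.smult_l_minus F.smult_r_minus ann_chain_smult')
    then show ?thesis using cone_square_aux[OF c'] Suc
      by (simp add: cone_diff_simps) (auto simp: pair_def free_mod_simps)
  qed
qed

text \<open>The second component is matched first: p = s (Suc k) q by exactness of the periodic
  complex, and the boundary of the pair (0, - q) has second component \<open>p\<close>. What remains
  in the first component is a cycle, hence a boundary, of the given resolution.\<close>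

lemma cone_exact_aux:
  assumes u: "u \<in> Fr (B (Suc (Suc k)))" and p: "p \<in> Fr (B 0)"
    and z: "d (Suc k) u \<oplus>\<^bsub>free_mod S (B (Suc k))\<^esub> \<epsilon> (Suc k) p = \<zero>\<^bsub>free_mod S (B (Suc k))\<^esub>"
    and sp: "s k \<odot>\<^bsub>free_mod S (B 0)\<^esub> p = \<zero>\<^bsub>free_mod S (B 0)\<^esub>"
  shows "\<exists>c \<in> Fr (sum_basis (B (Suc (Suc (Suc k)))) (B 0)). pair u p = cone_diff s B d \<epsilon> (Suc k) c"
proof -
  obtain q where q: "q \<in> Fr (B 0)" "p = s (Suc k) \<odot>\<^bsub>free_mod S (B 0)\<^esub> q"
    using ann_chain_kernel[OF s_good p sp] by blast
  have "d (Suc k) u = \<ominus>\<^bsub>free_mod S (B (Suc k))\<^esub> \<epsilon> (Suc k) p"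
    using z u p by (metis F.M.minus_equality F.M.minus_minus d_closed \<epsilon>_closed)
  also have "\<dots> = d (Suc k) (\<epsilon> (Suc (Suc k)) (\<ominus>\<^bsub>free_mod S (B 0)\<^esub> q))"
    using q by (simp add: mult_liftsD(3)[OF h] lin_smult[OF \<epsilon>_lin]
        lin_neg[OF F.module_axioms F.module_axioms \<epsilon>_lin] lin_neg[OF F.module_axioms F.module_axioms d_lin])
  finally obtain w where w: "w \<in> Fr (B (Suc (Suc (Suc k))))"
    "u = \<epsilon> (Suc (Suc k)) (\<ominus>\<^bsub>free_mod S (B 0)\<^esub> q) \<oplus>\<^bsub>free_mod S (B (Suc (Suc k)))\<^esub> d (Suc (Suc k)) w"
    using resol_exact_diff[OF r u] q by (metis \<epsilon>_closed F.M.a_inv_closed)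
  have "pair u p = cone_diff s B d \<epsilon> (Suc k) (pair w (\<ominus>\<^bsub>free_mod S (B 0)\<^esub> q))"
    using w q by (simp add: cone_diff_simps F.M.a_comm F.smult_l_minus F.smult_r_minus)
  then show ?thesis using w(1) q(1) by (metis pair_closed F.M.a_inv_closed)
qed

lemma cone_exact:
  assumes c: "c \<in> Fr (cone_basis B (Suc j))"
    and z: "cone_diff s B d \<epsilon> j c = \<zero>\<^bsub>free_mod S (cone_basis B j)\<^esub>"
  shows "\<exists>c' \<in> Fr (cone_basis B (Suc (Suc j))). c = cone_diff s B d \<epsilon> (Suc j) c'"
proof -
  have c': "proj1 c \<in> Fr (B (Suc (Suc j)))" "proj2 c \<in> Fr (B 0)" using c by auto
  have 1: "d (Suc j) (proj1 c) \<oplus>\<^bsub>free_mod S (B (Suc j))\<^esub> \<epsilon> (Suc j) (proj2 c) = \<zero>\<^bsub>free_mod S (B (Suc j))\<^esub>"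
  proof (cases j)
    case 0
    then show ?thesis using z by (simp add: cone_diff_simps)
  next
    case (Suc k)
    then have "proj1 (cone_diff s B d \<epsilon> j c) = proj1 \<zero>\<^bsub>free_mod S (cone_basis B j)\<^esub>" using z by simp
    then show ?thesis using Suc by (simp add: cone_diff_simps) (simp add: proj1_def free_mod_simps)
  qed
  \<comment> \<open>In degree 0 the differential of the cone has no second component to compare.
    There the equation comes from applying \<open>d 0\<close> to the first one, as d 0 (\<epsilon> 1
    p) = s 0 p.\<close>
  have 2: "s j \<odot>\<^bsub>free_mod S (B 0)\<^esub> proj2 c = \<zero>\<^bsub>free_mod S (B 0)\<^esub>"
  proof (cases j)
    case 0
    have "d 0 (d (Suc 0) (proj1 c) \<oplus>\<^bsub>free_mod S (B (Suc 0))\<^esub> \<epsilon> (Suc 0) (proj2 c)) = \<zero>\<^bsub>free_mod S (B 0)\<^esub>"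
      using 1 0 by simp
    then show ?thesis using c' 0
      by (simp add: lin_add[OF d_lin] resolD(3)[OF r] mult_liftsD(2,3)[OF h])
  next
    case (Suc k)
    then have "proj2 (cone_diff s B d \<epsilon> j c) = proj2 \<zero>\<^bsub>free_mod S (cone_basis B j)\<^esub>" using z by simp
    then have "\<ominus> s j \<odot>\<^bsub>free_mod S (B 0)\<^esub> proj2 c = \<zero>\<^bsub>free_mod S (B 0)\<^esub>"
      using Suc by (simp add: cone_diff_simps) (simp add: proj2_def free_mod_simps)
    then show ?thesis using c' by (simp add: F.smult_l_minus)
  qed
  show ?thesis using cone_exact_aux[OF c' 1 2] c by simp
qed

lemma resol_cone: "resol (cone_scal s) (cone_basis B) (cone_diff s B d \<epsilon>)"
  unfolding resol_def
proof (intro conjI allI ballI impI)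
  show "ann_chain (cone_scal s)" by (rule ann_chain_cone[OF s_good])
next
  fix w assume w: "w \<in> Fr (cone_basis B 0)"
  \<comment> \<open>The syzygy is again killed by s 0, because d 0 (s 0 w) = s 0 (d 0 w) lies in s 0
    Fr (B 0).\<close>
  then have "\<exists>c \<in> Fr (B 0). d 0 (s 0 \<odot>\<^bsub>free_mod S (B (Suc 0))\<^esub> w) = s 0 \<odot>\<^bsub>free_mod S (B 0)\<^esub> c"
    by (intro bexI[of _ "d 0 w"]) (auto simp: lin_smult[OF d_lin])
  then show "\<exists>c' \<in> Fr (cone_basis B (Suc 0)).
      cone_diff s B d \<epsilon> 0 c' = cone_scal s 0 \<odot>\<^bsub>free_mod S (cone_basis B 0)\<^esub> w"
    using cone_kernel[of "s 0 \<odot>\<^bsub>free_mod S (B (Suc 0))\<^esub> w"] w by auto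
qed (rule cone_diff_lin cone_square cone_exact; assumption)+

text \<open>Comparing second components in the defining equations of the lifts \<epsilon>' gives the
  claim multiplied by a scalar of the chain, and \<open>ann_chain_cancel\<close> removes the scalar.
  So a cochain \<open>g \<circ> proj2\<close>, supported on the added copies of Fr (B 0), has as its
  edge the restriction of \<open>g\<close> to the syzygy.\<close>

lemma cone_mult_lifts_proj2:
  assumes h': "mult_lifts (cone_scal s) (cone_basis B) (cone_diff s B d \<epsilon>) \<epsilon>'" and k: "kills_N s"
    and g: "lin S (free_mod S (B 0)) N g" and w: "w \<in> Fr (B (Suc 0))"
  shows "g (proj2 (\<epsilon>' (Suc j) w)) = g (d 0 w)"
proof (induction j)
  have e: "\<epsilon>' (Suc j) w \<in> Fr (sum_basis (B (Suc (Suc j))) (B 0))" for j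
    using lin_closed[OF mult_liftsD(1)[OF h', of "Suc j"]] w by simp
  note e = e proj1_closed[OF e] proj2_closed[OF e]
  {
    case 0
    have "d 0 (cone_diff s B d \<epsilon> 0 (\<epsilon>' (Suc 0) w)) = d 0 (s 0 \<odot>\<^bsub>free_mod S (B (Suc 0))\<^esub> w)"
      using mult_liftsD(2,3)[OF h'] w by simp
    then have "s 0 \<odot>\<^bsub>free_mod S (B 0)\<^esub> proj2 (\<epsilon>' (Suc 0) w) = s 0 \<odot>\<^bsub>free_mod S (B 0)\<^esub> d 0 w"
      using e w by (simp add: cone_diff_simps lin_add[OF d_lin] lin_smult[OF d_lin] resolD(3)[OF r]
        mult_liftsD(2,3)[OF h])
    then show ?case using ann_chain_cancel[OF s_good k g] e w by simp
  next
    case (Suc j)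
    have "proj2 (cone_diff s B d \<epsilon> (Suc j) (\<epsilon>' (Suc (Suc j)) w)) =
        proj2 (\<ominus> s (Suc j) \<odot>\<^bsub>free_mod S (sum_basis (B (Suc (Suc j))) (B 0))\<^esub> \<epsilon>' (Suc j) w)"
      using mult_liftsD(3)[OF h', of w "Suc j"] w by simp
    then have "cone_scal s (Suc j) \<odot>\<^bsub>free_mod S (B 0)\<^esub> proj2 (\<epsilon>' (Suc (Suc j)) w) =
        cone_scal s (Suc j) \<odot>\<^bsub>free_mod S (B 0)\<^esub> proj2 (\<epsilon>' (Suc j) w)"
      using e by (simp add: cone_diff_simps lin_smult[OF lin_proj2])
    then show ?case
      using ann_chain_cancel[OF ann_chain_cone[OF s_good] kills_N_cone[OF s_good k] g] e Suc by metis
  }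
qed

end

section \<open>Injectivity and surjectivity by induction over cones\<close>

definition cone_step where
  "cone_step T = (case T of (s, B, d) \<Rightarrow> (cone_scal s, cone_basis B, cone_diff s B d (lift_seq s B d)))"

lemma cone_step_eq:
  "cone_step (s, B, d) = (cone_scal s, cone_basis B, cone_diff s B d (lift_seq s B d))"
  by (simp add: cone_step_def)

text \<open>This says \<open>Ext\<^sup>1(K, N) = 0\<close> over \<open>S / (s 0)\<close> for the cokernel \<open>K\<close> of \<open>d 0\<close>.\<close>

definition ext_vanish where
  "ext_vanish T \<longleftrightarrow> (case T of (s, B, d) \<Rightarrow>
    \<forall>f. lin S (free_mod S (B (Suc 0))) N f
      \<and> (\<forall>c \<in> Fr (B (Suc 0)). (\<exists>u \<in> Fr (B 0). d 0 c = s 0 \<odot>\<^bsub>free_mod S (B 0)\<^esub> u) \<longrightarrow> f c = \<zero>\<^bsub>N\<^esub>)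
    \<longrightarrow> (\<exists>g. lin S (free_mod S (B 0)) N g \<and> (\<forall>c \<in> Fr (B (Suc 0)). f c = g (d 0 c))))"

lemma ext_vanishD:
  assumes "ext_vanish (s, B, d)" "lin S (free_mod S (B (Suc 0))) N f"
    "\<And>c u. c \<in> Fr (B (Suc 0)) \<Longrightarrow> u \<in> Fr (B 0) \<Longrightarrow> d 0 c = s 0 \<odot>\<^bsub>free_mod S (B 0)\<^esub> u \<Longrightarrow> f c = \<zero>\<^bsub>N\<^esub>"
  shows "\<exists>g. lin S (free_mod S (B 0)) N g \<and> (\<forall>c \<in> Fr (B (Suc 0)). f c = g (d 0 c))"
  using assms unfolding ext_vanish_def by blast

lemma cone_step_ext_vanish:
  assumes "\<forall>p \<le> Suc k. ext_vanish ((cone_step ^^ p) (s, B, d))"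
  shows "\<forall>p \<le> k. ext_vanish ((cone_step ^^ p) (cone_scal s, cone_basis B, cone_diff s B d (lift_seq s B d)))"
proof (intro allI impI)
  fix p assume "p \<le> k"
  then have "ext_vanish ((cone_step ^^ Suc p) (s, B, d))" using assms by blast
  then show "ext_vanish ((cone_step ^^ p) (cone_scal s, cone_basis B, cone_diff s B d (lift_seq s B d)))"
    by (simp only: funpow_Suc_right o_def cone_step_eq)
qed

text \<open>This is injectivity of the edge map in degree k + 1. As \<open>f\<close> vanishes on the
  lifts, f \<circ> proj1 is a cocycle on the cone, one degree lower. Its edge is a map on the
  syzygy, which by \<open>ext_vanish\<close> extends to a map \<open>g\<close> on Fr (B 0). By
  \<open>cone_mult_lifts_proj2\<close>, subtracting g \<circ> proj2 makes the edge zero, so the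
  induction hypothesis applies to the cone.\<close>

lemma coboundary_if_zero_on_lifts:
  assumes "resol s B d" and "kills_N s" and "\<forall>p \<le> k. ext_vanish ((cone_step ^^ p) (s, B, d))"
    and "lin S (free_mod S (B (Suc k))) N f"
    and "\<And>c. c \<in> Fr (B (Suc (Suc k))) \<Longrightarrow> f (d (Suc k) c) = \<zero>\<^bsub>N\<^esub>"
    and "\<And>c. c \<in> Fr (B 0) \<Longrightarrow> f (lift_seq s B d (Suc k) c) = \<zero>\<^bsub>N\<^esub>"
  shows "\<exists>h. lin S (free_mod S (B k)) N h \<and> (\<forall>c \<in> Fr (B (Suc k)). f c = h (d k c))"
  using assms
proof (induction k arbitrary: s B d f)
  case 0
  note r = \<open>resol s B d\<close> and f = 0(4)
  note h = mult_lifts_lift_seq[OF r]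
  \<comment> \<open>Degree 1 needs no cone: an element that \<open>d 0\<close> sends into s 0 Fr (B
    0) is a lift \<epsilon> 1 u plus a boundary, and \<open>f\<close> vanishes on both.\<close>
  have "ext_vanish (s, B, d)" using 0(3) by simp
  then show ?case
  proof (rule ext_vanishD[of s B d, OF _ f])
    fix c u assume c: "c \<in> Fr (B (Suc 0))" and u: "u \<in> Fr (B 0)" and "d 0 c = s 0 \<odot>\<^bsub>free_mod S (B 0)\<^esub> u"
    then have "d 0 c = d 0 (lift_seq s B d (Suc 0) u)" by (simp add: mult_liftsD(2,3)[OF h])
    moreover note e = lin_closed[OF mult_liftsD(1)[OF h] u]
    ultimately obtain v where v: "v \<in> Fr (B (Suc (Suc 0)))"
      "c = lift_seq s B d (Suc 0) u \<oplus>\<^bsub>free_mod S (B (Suc 0))\<^esub> d (Suc 0) v"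
      using resol_exact_diff[OF r c e] by blast
    show "f c = \<zero>\<^bsub>N\<^esub>"
      using v u e 0(5,6) lin_closed[OF resolD(2)[OF r] v(1)] by (simp add: lin_add[OF f])
  qed
next
  case (Suc k)
  note r = Suc.prems(1) and ks = Suc.prems(2) and f = Suc.prems(4)
  note h = mult_lifts_lift_seq[OF r] and s = resolD(1)[OF r]
  let ?s = "cone_scal s" and ?B = "cone_basis B" and ?d = "cone_diff s B d (lift_seq s B d)"
  let ?e = "lift_seq ?s ?B ?d"
  note r' = resol_cone[OF r h]
  note h' = mult_lifts_lift_seq[OF r'] and ks' = kills_N_cone[OF s ks]
  have f1: "lin S (free_mod S (?B (Suc k))) N (\<lambda>c. f (proj1 c))"
    using lin_comp[OF lin_proj1 f] by simp
  have f1_cocycle: "f (proj1 (?d (Suc k) c)) = \<zero>\<^bsub>N\<^esub>" if "c \<in> Fr (?B (Suc (Suc k)))" for c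
  proof -
    have c: "proj1 c \<in> Fr (B (Suc (Suc (Suc k))))" "proj2 c \<in> Fr (B 0)" using that by auto
    then show ?thesis
      using Suc.prems(5,6) lin_closed[OF resolD(2)[OF r] c(1)] lin_closed[OF mult_liftsD(1)[OF h] c(2)]
      by (simp add: cone_diff_simps lin_add[OF f])
  qed
  have a: "lin S (free_mod S (B (Suc 0))) N (\<lambda>w. f (proj1 (?e (Suc k) w)))"
    using lin_comp[OF mult_liftsD(1)[OF h'] f1] by simp
  \<comment> \<open>The elements of Fr (B 1) that \<open>d 0\<close> sends into s 0 Fr (B 0) are the
    lowest boundaries of the cone by \<open>cone_kernel\<close>, and the edge of a cocycle vanishes
    on boundaries. This is the condition that \<open>ext_vanish\<close> puts on the map to be
    extended.\<close>
  have "ext_vanish (s, B, d)" using Suc.prems(3) by (metis funpow_0 zero_le)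
  then have "\<exists>g. lin S (free_mod S (B 0)) N g \<and> (\<forall>c \<in> Fr (B (Suc 0)). f (proj1 (?e (Suc k) c)) = g (d 0 c))"
  proof (rule ext_vanishD[of s B d, OF _ a])
    fix c u assume c: "c \<in> Fr (B (Suc 0))" and u: "u \<in> Fr (B 0)" "d 0 c = s 0 \<odot>\<^bsub>free_mod S (B 0)\<^esub> u"
    then obtain v where "v \<in> Fr (?B (Suc 0))" "c = ?d 0 v" using cone_kernel[OF r h c] by blast
    then show "f (proj1 (?e (Suc k) c)) = \<zero>\<^bsub>N\<^esub>"
      using cocycle_mult_lifts_boundary[OF r' h' ks' _ f1 f1_cocycle] by blast
  qed
  then obtain g where g: "lin S (free_mod S (B 0)) N g"
    "\<And>c. c \<in> Fr (B (Suc 0)) \<Longrightarrow> f (proj1 (?e (Suc k) c)) = g (d 0 c)" by blast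
  let ?f = "\<lambda>c. f (proj1 c) \<ominus>\<^bsub>N\<^esub> g (proj2 c)"
  have "\<exists>h. lin S (free_mod S (?B k)) N h \<and> (\<forall>c \<in> Fr (?B (Suc k)). ?f c = h (?d k c))"
  proof (rule Suc.IH[OF r' ks' cone_step_ext_vanish[OF Suc.prems(3)]])
    show "lin S (free_mod S (?B (Suc k))) N ?f"
      by (rule lin_minus[OF N.module_axioms f1]) (use lin_comp[OF lin_proj2 g(1)] in simp)
  next
    fix c assume c: "c \<in> Fr (?B (Suc (Suc k)))"
    have "g (proj2 (?d (Suc k) c)) = \<zero>\<^bsub>N\<^esub>"
    proof -
      have "proj2 c \<in> Fr (B 0)" using c by simp
      then show ?thesis using s ks lin_closed[OF g(1)]
        by (simp add: cone_diff_simps lin_smult[OF g(1)] N.smult_l_minus kills_N_def)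
    qed
    then show "?f (?d (Suc k) c) = \<zero>\<^bsub>N\<^esub>" using f1_cocycle[OF c] by (simp add: a_minus_def)
  next
    fix w assume w: "w \<in> Fr (?B 0)"
    then have "g (proj2 (?e (Suc k) w)) = g (d 0 w)" using cone_mult_lifts_proj2[OF r h h' ks g(1)] by simp
    moreover have "g (d 0 w) \<in> carrier N" using w lin_closed[OF g(1) lin_closed[OF resolD(2)[OF r]]] by simp
    ultimately show "?f (?e (Suc k) w) = \<zero>\<^bsub>N\<^esub>" using g(2) w by (simp add: N.M.r_neg a_minus_def)
  qed
  then obtain h1 where h1: "lin S (free_mod S (?B k)) N h1" "\<And>c. c \<in> Fr (?B (Suc k)) \<Longrightarrow> ?f c = h1 (?d k c)"
    by blast
  \<comment> \<open>On the first summand g \<circ> proj2 is zero, so restricting \<open>h1\<close>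
    to that summand gives the map wanted for \<open>f\<close>. The case split is due to degree 0 of
    the cone, which is Fr (B 1) without a second summand.\<close>
  have f_eq: "f u = h1 (?d k (pair u \<zero>\<^bsub>free_mod S (B 0)\<^esub>))" if u: "u \<in> Fr (B (Suc (Suc k)))" for u
    using h1(2)[of "pair u \<zero>\<^bsub>free_mod S (B 0)\<^esub>"] u lin_zero[OF F.module_axioms N.module_axioms g(1)]
      lin_closed[OF f u] N.neg_zero by (simp add: a_minus_def)
  show ?case
  proof (cases k)
    case 0
    then show ?thesis using h1(1) f_eq lin_closed[OF resolD(2)[OF r]]
        lin_zero[OF F.module_axioms F.module_axioms mult_liftsD(1)[OF h]]
      by (intro exI[of _ h1]) (simp add: cone_diff_simps)
  next
    case (Suc i)
    have "lin S (free_mod S (B (Suc k))) N (\<lambda>v. h1 (pair v \<zero>\<^bsub>free_mod S (B 0)\<^esub>))"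
      by (rule lin_comp[OF lin_pair[OF lin_id lin_const_zero[OF F.module_axioms]]]) (use h1(1) Suc in simp)
    then show ?thesis using Suc f_eq lin_closed[OF resolD(2)[OF r]] s
        lin_zero[OF F.module_axioms F.module_axioms mult_liftsD(1)[OF h]]
      by (intro exI[of _ "\<lambda>v. h1 (pair v \<zero>\<^bsub>free_mod S (B 0)\<^esub>)"]) (simp add: cone_diff_simps)
  qed
qed

text \<open>Consider the cocycle \<phi> \<circ> proj2 on the cone. Its edge is \<phi> \<circ> d 0 =
  0, so by injectivity for the cone it is h1 \<circ> ?d k for some \<open>h1\<close>. The
  restriction of \<open>h1\<close> to the first summand is the cocycle wanted: evaluating on pairs
  (u, 0) shows that it kills boundaries, and on pairs (0, p) that it takes the value \<phi> p on the
  lift of p.\<close>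

lemma ex_cocycle_on_lifts:
  assumes r: "resol s B d" and ks: "kills_N s" and v: "\<forall>p \<le> Suc k. ext_vanish ((cone_step ^^ p) (s, B, d))"
    and \<phi>: "lin S (free_mod S (B 0)) N \<phi>" "\<And>c. c \<in> Fr (B (Suc 0)) \<Longrightarrow> \<phi> (d 0 c) = \<zero>\<^bsub>N\<^esub>"
  shows "\<exists>f. lin S (free_mod S (B (Suc k))) N f
    \<and> (\<forall>c \<in> Fr (B (Suc (Suc k))). f (d (Suc k) c) = \<zero>\<^bsub>N\<^esub>)
    \<and> (\<forall>c \<in> Fr (B 0). f (lift_seq s B d (Suc k) c) = \<phi> c)"
proof -
  note h = mult_lifts_lift_seq[OF r] and s = resolD(1)[OF r]
  let ?s = "cone_scal s" and ?B = "cone_basis B" and ?d = "cone_diff s B d (lift_seq s B d)"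
  let ?e = "lift_seq ?s ?B ?d" and ?z = "\<zero>\<^bsub>free_mod S (B 0)\<^esub>"
  note r' = resol_cone[OF r h]
  note h' = mult_lifts_lift_seq[OF r'] and ks' = kills_N_cone[OF s ks]
  note dcl = lin_closed[OF resolD(2)[OF r]] and ecl = lin_closed[OF mult_liftsD(1)[OF h]]
  note e0 = lin_zero[OF F.module_axioms F.module_axioms mult_liftsD(1)[OF h]]
    and d0 = lin_zero[OF F.module_axioms F.module_axioms resolD(2)[OF r]]
    and \<phi>0 = lin_zero[OF F.module_axioms N.module_axioms \<phi>(1)]
  have "\<exists>h. lin S (free_mod S (?B k)) N h \<and> (\<forall>c \<in> Fr (?B (Suc k)). \<phi> (proj2 c) = h (?d k c))"
  proof (rule coboundary_if_zero_on_lifts[OF r' ks' cone_step_ext_vanish[OF v]])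
    show "lin S (free_mod S (?B (Suc k))) N (\<lambda>c. \<phi> (proj2 c))" using lin_comp[OF lin_proj2 \<phi>(1)] by simp
  next
    fix c assume c: "c \<in> Fr (?B (Suc (Suc k)))"
    have "proj2 c \<in> Fr (B 0)" using c by simp
    then show "\<phi> (proj2 (?d (Suc k) c)) = \<zero>\<^bsub>N\<^esub>" using s ks lin_closed[OF \<phi>(1)]
      by (simp add: cone_diff_simps lin_smult[OF \<phi>(1)] N.smult_l_minus kills_N_def)
  next
    fix w assume w: "w \<in> Fr (?B 0)"
    then show "\<phi> (proj2 (?e (Suc k) w)) = \<zero>\<^bsub>N\<^esub>" using cone_mult_lifts_proj2[OF r h h' ks \<phi>(1)] \<phi>(2) by simp
  qed
  then obtain h1 where h1: "lin S (free_mod S (?B k)) N h1" "\<And>c. c \<in> Fr (?B (Suc k)) \<Longrightarrow> h1 (?d k c) = \<phi> (proj2 c)"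
    by metis
  have 1: "h1 (?d k (pair u ?z)) = \<zero>\<^bsub>N\<^esub>" if "u \<in> Fr (B (Suc (Suc k)))" for u
    using h1(2)[of "pair u ?z"] that \<phi>0 by simp
  have 2: "h1 (?d k (pair \<zero>\<^bsub>free_mod S (B (Suc (Suc k)))\<^esub> p)) = \<phi> p" if "p \<in> Fr (B 0)" for p
    using h1(2)[of "pair \<zero>\<^bsub>free_mod S (B (Suc (Suc k)))\<^esub> p"] that by simp
  show ?thesis
  proof (cases k)
    case 0
    then show ?thesis using h1(1) 1 2 dcl ecl e0 d0
      by (intro exI[of _ h1]) (simp add: cone_diff_simps)
  next
    case (Suc i)
    let ?f = "\<lambda>v. h1 (pair v ?z)"
    have h1': "lin S (free_mod S (sum_basis (B (Suc k)) (B 0))) N h1" using h1(1) Suc by simp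
    have f: "lin S (free_mod S (B (Suc k))) N ?f"
      by (rule lin_comp[OF lin_pair[OF lin_id lin_const_zero[OF F.module_axioms]] h1'])
    have "?f (lift_seq s B d (Suc k) p) = \<phi> p" if p: "p \<in> Fr (B 0)" for p
    proof -
      let ?u = "pair (lift_seq s B d (Suc k) p) ?z" and ?v = "pair \<zero>\<^bsub>free_mod S (B (Suc k))\<^esub> p"
      have uv: "?u \<in> Fr (sum_basis (B (Suc k)) (B 0))" "?v \<in> Fr (sum_basis (B (Suc k)) (B 0))"
        using p ecl by auto
      \<comment> \<open>The second component of this boundary is a multiple of s k, so it
        contributes nothing to a value in \<open>N\<close>.\<close>
      have "?d k (pair \<zero>\<^bsub>free_mod S (B (Suc (Suc k)))\<^esub> p) =
          pair (lift_seq s B d (Suc k) p) (\<ominus> s k \<odot>\<^bsub>free_mod S (B 0)\<^esub> p)"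
        using Suc p ecl d0 by (simp add: cone_diff_simps)
      also have "\<dots> = ?u \<oplus>\<^bsub>free_mod S (sum_basis (B (Suc k)) (B 0))\<^esub> (\<ominus> s k \<odot>\<^bsub>free_mod S (sum_basis (B (Suc k)) (B 0))\<^esub> ?v)"
        using p ecl[OF p, of "Suc k"] s by (auto simp: fun_eq_iff free_mod_simps pair_def free_mod_carrier)
      finally have "\<phi> p = h1 ?u \<oplus>\<^bsub>N\<^esub> \<ominus> s k \<odot>\<^bsub>N\<^esub> h1 ?v"
        using 2[OF p] uv s by (simp add: lin_add[OF h1'] lin_smult[OF h1'])
      then show ?thesis using s ks lin_closed[OF h1'] uv by (simp add: N.smult_l_minus kills_N_def)
    qed
    moreover have "?f (d (Suc k) c) = \<zero>\<^bsub>N\<^esub>" if "c \<in> Fr (B (Suc (Suc k)))" for c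
      using 1[OF that] Suc that e0 dcl s by (simp add: cone_diff_simps)
    ultimately show ?thesis using f by blast
  qed
qed

end

section \<open>Comparison of resolutions modulo an element\<close>

text \<open>Reduction modulo t is expressed by congruences rather than by quotient modules, so that
  the maps compared remain maps between free modules over one ring and can be chosen on
  bases.\<close>

definition cong_mod :: "'r \<Rightarrow> ('r, 'm, 'z) module_scheme \<Rightarrow> 'm \<Rightarrow> 'm \<Rightarrow> bool"
  where "cong_mod t A u v \<longleftrightarrow> (\<exists>w \<in> carrier A. u = v \<oplus>\<^bsub>A\<^esub> t \<odot>\<^bsub>A\<^esub> w)"

context module begin

lemma cong_mod_refl: "t \<in> carrier R \<Longrightarrow> u \<in> carrier M \<Longrightarrow> cong_mod t M u u"
  unfolding cong_mod_def by (rule bexI[of _ "\<zero>\<^bsub>M\<^esub>"]) auto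

lemma cong_mod_sym:
  assumes t: "t \<in> carrier R" and v: "v \<in> carrier M" and "cong_mod t M u v"
  shows "cong_mod t M v u"
proof -
  obtain w where w: "w \<in> carrier M" "u = v \<oplus>\<^bsub>M\<^esub> t \<odot>\<^bsub>M\<^esub> w" using assms by (auto simp: cong_mod_def)
  then have "v = u \<oplus>\<^bsub>M\<^esub> t \<odot>\<^bsub>M\<^esub> (\<ominus>\<^bsub>M\<^esub> w)" using t v by (simp add: smult_r_minus M.a_assoc M.r_neg)
  then show ?thesis using w unfolding cong_mod_def by (intro bexI[of _ "\<ominus>\<^bsub>M\<^esub> w"]) auto
qed

lemma cong_mod_trans:
  assumes t: "t \<in> carrier R" and x: "x \<in> carrier M" and "cong_mod t M u v" "cong_mod t M v x"
  shows "cong_mod t M u x"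
proof -
  obtain w w' where w: "w \<in> carrier M" "w' \<in> carrier M" "u = x \<oplus>\<^bsub>M\<^esub> t \<odot>\<^bsub>M\<^esub> w' \<oplus>\<^bsub>M\<^esub> t \<odot>\<^bsub>M\<^esub> w"
    using assms by (auto simp: cong_mod_def)
  then have "u = x \<oplus>\<^bsub>M\<^esub> t \<odot>\<^bsub>M\<^esub> (w' \<oplus>\<^bsub>M\<^esub> w)" using t x by (simp add: smult_r_distr M.a_assoc)
  then show ?thesis using w unfolding cong_mod_def by (intro bexI[of _ "w' \<oplus>\<^bsub>M\<^esub> w"]) auto
qed

lemma cong_mod_add:
  assumes t: "t \<in> carrier R" and x: "v \<in> carrier M" "v' \<in> carrier M"
    and "cong_mod t M u v" "cong_mod t M u' v'"
  shows "cong_mod t M (u \<oplus>\<^bsub>M\<^esub> u') (v \<oplus>\<^bsub>M\<^esub> v')"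
proof -
  obtain w w' where w: "w \<in> carrier M" "w' \<in> carrier M" "u = v \<oplus>\<^bsub>M\<^esub> t \<odot>\<^bsub>M\<^esub> w" "u' = v' \<oplus>\<^bsub>M\<^esub> t \<odot>\<^bsub>M\<^esub> w'"
    using assms by (auto simp: cong_mod_def)
  then have "u \<oplus>\<^bsub>M\<^esub> u' = (v \<oplus>\<^bsub>M\<^esub> v') \<oplus>\<^bsub>M\<^esub> t \<odot>\<^bsub>M\<^esub> (w \<oplus>\<^bsub>M\<^esub> w')" using t x by (simp add: smult_r_distr M.a_ac)
  then show ?thesis using w unfolding cong_mod_def by (intro bexI[of _ "w \<oplus>\<^bsub>M\<^esub> w'"]) auto
qed

lemma cong_mod_diff:
  assumes t: "t \<in> carrier R" and x: "u \<in> carrier M" "v \<in> carrier M" "v' \<in> carrier M"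
  shows "cong_mod t M u (v \<oplus>\<^bsub>M\<^esub> v') \<longleftrightarrow> cong_mod t M (u \<ominus>\<^bsub>M\<^esub> v) v'"
proof -
  have "u = v \<oplus>\<^bsub>M\<^esub> v' \<oplus>\<^bsub>M\<^esub> y \<longleftrightarrow> u \<ominus>\<^bsub>M\<^esub> v = v' \<oplus>\<^bsub>M\<^esub> y" if y: "y \<in> carrier M" for y
  proof
    assume "u = v \<oplus>\<^bsub>M\<^esub> v' \<oplus>\<^bsub>M\<^esub> y"
    then have "u = (v' \<oplus>\<^bsub>M\<^esub> y) \<oplus>\<^bsub>M\<^esub> v" using x y by (simp add: M.a_ac)
    then show "u \<ominus>\<^bsub>M\<^esub> v = v' \<oplus>\<^bsub>M\<^esub> y" using x y by (simp add: a_minus_def M.a_assoc M.r_neg)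
  next
    assume "u \<ominus>\<^bsub>M\<^esub> v = v' \<oplus>\<^bsub>M\<^esub> y"
    then have "v \<oplus>\<^bsub>M\<^esub> (u \<ominus>\<^bsub>M\<^esub> v) = v \<oplus>\<^bsub>M\<^esub> (v' \<oplus>\<^bsub>M\<^esub> y)" by simp
    then show "u = v \<oplus>\<^bsub>M\<^esub> v' \<oplus>\<^bsub>M\<^esub> y" using x y by (simp add: M.a_assoc eq_plus_minus[symmetric])
  qed
  then show ?thesis using t by (auto simp: cong_mod_def)
qed

end

lemma lin_cong_mod:
  assumes "module R A" "lin R A C f" "t \<in> carrier R" "v \<in> carrier A" "cong_mod t A u v"
  shows "cong_mod t C (f u) (f v)"
proof -
  interpret A: module R A by fact
  obtain w where "w \<in> carrier A" "u = v \<oplus>\<^bsub>A\<^esub> t \<odot>\<^bsub>A\<^esub> w" using assms by (auto simp: cong_mod_def)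
  then show ?thesis using assms unfolding cong_mod_def
    by (intro bexI[of _ "f w"]) (auto simp: lin_add lin_smult lin_closed)
qed

lemma cong_mod_killed:
  assumes "module R C" "v \<in> carrier C" "cong_mod t C u v" "\<And>w. w \<in> carrier C \<Longrightarrow> t \<odot>\<^bsub>C\<^esub> w = \<zero>\<^bsub>C\<^esub>"
  shows "u = v"
proof -
  interpret C: module R C by fact
  show ?thesis using assms by (auto simp: cong_mod_def)
qed

text \<open>The offset \<chi> serves two uses: with \<chi> = 0 the lemma extends chain maps by one
  degree, and with \<chi> the identity plus the preceding homotopy term it extends
  homotopies.\<close>

lemma free_lift_cong_mod:
  assumes A: "module R A" and C: "module R C" and \<psi>: "lin R A C \<psi>"
    and \<phi>: "lin R (free_mod R B) C \<phi>" and \<chi>: "lin R (free_mod R B) C \<chi>" and t: "t \<in> carrier R"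
    and ex: "\<And>c. c \<in> carrier (free_mod R B) \<Longrightarrow> \<exists>u \<in> carrier A. cong_mod t C (\<phi> c) (\<chi> c \<oplus>\<^bsub>C\<^esub> \<psi> u)"
  shows "\<exists>\<epsilon>. lin R (free_mod R B) A \<epsilon> \<and>
    (\<forall>c \<in> carrier (free_mod R B). cong_mod t C (\<phi> c) (\<chi> c \<oplus>\<^bsub>C\<^esub> \<psi> (\<epsilon> c)))"
proof -
  interpret A: module R A by fact
  interpret C: module R C by fact
  have eq: "cong_mod t C (\<phi> c) (\<chi> c \<oplus>\<^bsub>C\<^esub> \<psi> u) \<longleftrightarrow> (\<exists>w \<in> carrier C. \<phi> c \<ominus>\<^bsub>C\<^esub> \<chi> c = \<psi> u \<oplus>\<^bsub>C\<^esub> t \<odot>\<^bsub>C\<^esub> w)"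
    if "c \<in> carrier (free_mod R B)" "u \<in> carrier A" for c u
    using C.cong_mod_diff[OF t lin_closed[OF \<phi> that(1)] lin_closed[OF \<chi> that(1)] lin_closed[OF \<psi> that(2)]]
    by (simp add: cong_mod_def)
  have "\<exists>\<epsilon>. lin R (free_mod R B) A \<epsilon> \<and>
    (\<forall>c \<in> carrier (free_mod R B). \<exists>w \<in> carrier C. \<phi> c \<ominus>\<^bsub>C\<^esub> \<chi> c = \<psi> (\<epsilon> c) \<oplus>\<^bsub>C\<^esub> t \<odot>\<^bsub>C\<^esub> w)"
    by (rule free_lift[OF A C \<psi> lin_minus[OF C \<phi> \<chi>] t]) (use ex eq in blast)
  then show ?thesis using eq lin_closed by metis
qed

text \<open>
  The reduction modulo \<open>t\<close> of such data is a resolution, over \<open>R / (t)\<close>, of the module \<open>M\<close>, which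
  is killed by \<open>t\<close>.
\<close>

definition resol_mod where
  "resol_mod R t M B d a \<longleftrightarrow>
    (\<forall>j. lin R (free_mod R (B (Suc j))) (free_mod R (B j)) (d j))
    \<and> lin R (free_mod R (B 0)) M a
    \<and> (\<forall>m \<in> carrier M. \<exists>c \<in> carrier (free_mod R (B 0)). m = a c)
    \<and> (\<forall>c \<in> carrier (free_mod R (B (Suc 0))). a (d 0 c) = \<zero>\<^bsub>M\<^esub>)
    \<and> (\<forall>c \<in> carrier (free_mod R (B 0)). a c = \<zero>\<^bsub>M\<^esub> \<longrightarrow>
        (\<exists>u \<in> carrier (free_mod R (B (Suc 0))). cong_mod t (free_mod R (B 0)) c (d 0 u)))
    \<and> (\<forall>j. \<forall>c \<in> carrier (free_mod R (B (Suc (Suc j)))).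
        cong_mod t (free_mod R (B j)) (d j (d (Suc j) c)) \<zero>\<^bsub>free_mod R (B j)\<^esub>)
    \<and> (\<forall>j. \<forall>c \<in> carrier (free_mod R (B (Suc j))).
        cong_mod t (free_mod R (B j)) (d j c) \<zero>\<^bsub>free_mod R (B j)\<^esub> \<longrightarrow>
        (\<exists>u \<in> carrier (free_mod R (B (Suc (Suc j)))). cong_mod t (free_mod R (B (Suc j))) c (d (Suc j) u)))"

lemma resol_modD:
  assumes "resol_mod R t M B d a"
  shows "lin R (free_mod R (B (Suc j))) (free_mod R (B j)) (d j)"
    "lin R (free_mod R (B 0)) M a"
    "m \<in> carrier M \<Longrightarrow> \<exists>c \<in> carrier (free_mod R (B 0)). m = a c"
    "c1 \<in> carrier (free_mod R (B (Suc 0))) \<Longrightarrow> a (d 0 c1) = \<zero>\<^bsub>M\<^esub>"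
    "c0 \<in> carrier (free_mod R (B 0)) \<Longrightarrow> a c0 = \<zero>\<^bsub>M\<^esub> \<Longrightarrow>
      \<exists>u \<in> carrier (free_mod R (B (Suc 0))). cong_mod t (free_mod R (B 0)) c0 (d 0 u)"
    "c2 \<in> carrier (free_mod R (B (Suc (Suc j)))) \<Longrightarrow>
      cong_mod t (free_mod R (B j)) (d j (d (Suc j) c2)) \<zero>\<^bsub>free_mod R (B j)\<^esub>"
    "c \<in> carrier (free_mod R (B (Suc j))) \<Longrightarrow>
      cong_mod t (free_mod R (B j)) (d j c) \<zero>\<^bsub>free_mod R (B j)\<^esub> \<Longrightarrow>
      \<exists>u \<in> carrier (free_mod R (B (Suc (Suc j)))). cong_mod t (free_mod R (B (Suc j))) c (d (Suc j) u)"
  using assms by (auto simp: resol_mod_def)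

section \<open>Chain maps and homotopies between resolutions modulo t\<close>

context cring begin

lemma resol_mod_exact_diff:
  assumes t: "t \<in> carrier R" and r: "resol_mod R t M B d a"
    and c: "c \<in> carrier (free_mod R (B (Suc j)))" and v: "v \<in> carrier (free_mod R (B (Suc j)))"
    and eq: "cong_mod t (free_mod R (B j)) (d j c) (d j v)"
  shows "\<exists>u \<in> carrier (free_mod R (B (Suc (Suc j)))).
    cong_mod t (free_mod R (B (Suc j))) c (v \<oplus>\<^bsub>free_mod R (B (Suc j))\<^esub> d (Suc j) u)"
proof -
  interpret F: module R "free_mod R X" for X by (rule free_mod_module)
  note d = resol_modD(1)[OF r]
  have "d j (c \<ominus>\<^bsub>free_mod R (B (Suc j))\<^esub> v) = d j c \<ominus>\<^bsub>free_mod R (B j)\<^esub> d j v"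
    using c v lin_neg[OF F.module_axioms F.module_axioms d] by (simp add: a_minus_def lin_add[OF d])
  moreover have "cong_mod t (free_mod R (B j)) (d j c \<ominus>\<^bsub>free_mod R (B j)\<^esub> d j v) \<zero>\<^bsub>free_mod R (B j)\<^esub>"
    using F.cong_mod_diff[OF t lin_closed[OF d c] lin_closed[OF d v] F.M.zero_closed] eq
      lin_closed[OF d v] by simp
  ultimately obtain u where u: "u \<in> carrier (free_mod R (B (Suc (Suc j))))"
    "cong_mod t (free_mod R (B (Suc j))) (c \<ominus>\<^bsub>free_mod R (B (Suc j))\<^esub> v) (d (Suc j) u)"
    using resol_modD(7)[OF r F.M.minus_closed[OF c v]] by auto
  then show ?thesis using F.cong_mod_diff[OF t c v lin_closed[OF d u(1)]] by blast
qed

lemma resol_mod_exact_diff_aug: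
  assumes t: "t \<in> carrier R" and r: "resol_mod R t M B d a" and M: "module R M"
    and c: "c \<in> carrier (free_mod R (B 0))" and v: "v \<in> carrier (free_mod R (B 0))"
    and eq: "a c = a v"
  shows "\<exists>u \<in> carrier (free_mod R (B (Suc 0))).
    cong_mod t (free_mod R (B 0)) c (v \<oplus>\<^bsub>free_mod R (B 0)\<^esub> d 0 u)"
proof -
  interpret F: module R "free_mod R X" for X by (rule free_mod_module)
  interpret M: module R M by (rule M)
  note d = resol_modD(1)[OF r] and a = resol_modD(2)[OF r]
  have "a (c \<ominus>\<^bsub>free_mod R (B 0)\<^esub> v) = \<zero>\<^bsub>M\<^esub>"
    using c v eq lin_neg[OF F.module_axioms M a] lin_closed[OF a]
    by (simp add: a_minus_def lin_add[OF a] M.M.r_neg)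
  then obtain u where u: "u \<in> carrier (free_mod R (B (Suc 0)))"
    "cong_mod t (free_mod R (B 0)) (c \<ominus>\<^bsub>free_mod R (B 0)\<^esub> v) (d 0 u)"
    using resol_modD(5)[OF r F.M.minus_closed[OF c v]] by auto
  then show ?thesis using F.cong_mod_diff[OF t c v lin_closed[OF d u(1)]] by blast
qed

lemma comparison_lift:
  assumes t: "t \<in> carrier R"
    and r: "resol_mod R t M B d a" and r': "resol_mod R t M B' d' a'"
    and \<alpha>: "lin R (free_mod R (B j)) (free_mod R (B' j)) \<alpha>"
    and \<alpha>': "lin R (free_mod R (B (Suc j))) (free_mod R (B' (Suc j))) \<alpha>'"
    and comm: "\<And>c. c \<in> carrier (free_mod R (B (Suc j))) \<Longrightarrow> cong_mod t (free_mod R (B' j)) (d' j (\<alpha>' c)) (\<alpha> (d j c))"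
  shows "\<exists>\<alpha>''. lin R (free_mod R (B (Suc (Suc j)))) (free_mod R (B' (Suc (Suc j)))) \<alpha>''
    \<and> (\<forall>c \<in> carrier (free_mod R (B (Suc (Suc j)))). cong_mod t (free_mod R (B' (Suc j))) (d' (Suc j) (\<alpha>'' c)) (\<alpha>' (d (Suc j) c)))"
proof -
  interpret F: module R "free_mod R X" for X by (rule free_mod_module)
  note d = resol_modD(1)[OF r] and d' = resol_modD(1)[OF r']
  have l: "lin R (free_mod R (B (Suc (Suc j)))) (free_mod R (B' (Suc j))) (\<lambda>c. \<alpha>' (d (Suc j) c))"
    by (rule lin_comp[OF d \<alpha>'])
  have "\<exists>u \<in> carrier (free_mod R (B' (Suc (Suc j)))). cong_mod t (free_mod R (B' (Suc j))) (\<alpha>' (d (Suc j) c)) (d' (Suc j) u)"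
    if c: "c \<in> carrier (free_mod R (B (Suc (Suc j))))" for c
  proof (rule resol_modD(7)[OF r' lin_closed[OF l c]])
    note dc = lin_closed[OF d c]
    have "cong_mod t (free_mod R (B' j)) (\<alpha> (d j (d (Suc j) c))) (\<alpha> \<zero>\<^bsub>free_mod R (B j)\<^esub>)"
      by (rule lin_cong_mod[OF F.module_axioms \<alpha> t _ resol_modD(6)[OF r c]]) simp
    then show "cong_mod t (free_mod R (B' j)) (d' j (\<alpha>' (d (Suc j) c))) \<zero>\<^bsub>free_mod R (B' j)\<^esub>"
      using F.cong_mod_trans[OF t _ comm[OF dc]] lin_zero[OF F.module_axioms F.module_axioms \<alpha>]
      by simp
  qed
  then have "\<exists>\<alpha>''. lin R (free_mod R (B (Suc (Suc j)))) (free_mod R (B' (Suc (Suc j)))) \<alpha>'' \<and>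
    (\<forall>c \<in> carrier (free_mod R (B (Suc (Suc j)))). cong_mod t (free_mod R (B' (Suc j))) (\<alpha>' (d (Suc j) c))
      (\<zero>\<^bsub>free_mod R (B' (Suc j))\<^esub> \<oplus>\<^bsub>free_mod R (B' (Suc j))\<^esub> d' (Suc j) (\<alpha>'' c)))"
    using lin_closed[OF d']
    by (intro free_lift_cong_mod[OF F.module_axioms F.module_axioms d' l lin_const_zero[OF F.module_axioms] t]) auto
  then obtain \<alpha>'' where 1: "lin R (free_mod R (B (Suc (Suc j)))) (free_mod R (B' (Suc (Suc j)))) \<alpha>''"
    "\<And>c. c \<in> carrier (free_mod R (B (Suc (Suc j)))) \<Longrightarrow> cong_mod t (free_mod R (B' (Suc j))) (\<alpha>' (d (Suc j) c))
      (\<zero>\<^bsub>free_mod R (B' (Suc j))\<^esub> \<oplus>\<^bsub>free_mod R (B' (Suc j))\<^esub> d' (Suc j) (\<alpha>'' c))" by blast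
  then have "cong_mod t (free_mod R (B' (Suc j))) (d' (Suc j) (\<alpha>'' c)) (\<alpha>' (d (Suc j) c))"
    if c: "c \<in> carrier (free_mod R (B (Suc (Suc j))))" for c
    using 1(2)[OF c] lin_closed[OF d' lin_closed[OF 1(1) c]] F.cong_mod_sym[OF t] by simp
  with 1(1) show ?thesis by blast
qed

lemma comparison_base:
  assumes t: "t \<in> carrier R" and M: "module R M"
    and r: "resol_mod R t M B d a" and r': "resol_mod R t M B' d' a'"
  shows "\<exists>\<alpha> \<alpha>'. lin R (free_mod R (B 0)) (free_mod R (B' 0)) \<alpha>
    \<and> (\<forall>c \<in> carrier (free_mod R (B 0)). a' (\<alpha> c) = a c)
    \<and> lin R (free_mod R (B (Suc 0))) (free_mod R (B' (Suc 0))) \<alpha>'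
    \<and> (\<forall>c \<in> carrier (free_mod R (B (Suc 0))). cong_mod t (free_mod R (B' 0)) (d' 0 (\<alpha>' c)) (\<alpha> (d 0 c)))"
proof -
  interpret F: module R "free_mod R X" for X by (rule free_mod_module)
  note d = resol_modD(1)[OF r] and d' = resol_modD(1)[OF r']
  obtain \<alpha> where \<alpha>: "lin R (free_mod R (B 0)) (free_mod R (B' 0)) \<alpha>"
    "\<And>c. c \<in> carrier (free_mod R (B 0)) \<Longrightarrow> a c = a' (\<alpha> c)"
    using free_lift_exact[OF F.module_axioms M resol_modD(2)[OF r'] resol_modD(2)[OF r]]
      resol_modD(3)[OF r'] lin_closed[OF resol_modD(2)[OF r]] by metis
  have l: "lin R (free_mod R (B (Suc 0))) (free_mod R (B' 0)) (\<lambda>c. \<alpha> (d 0 c))"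
    by (rule lin_comp[OF d \<alpha>(1)])
  have "\<exists>u \<in> carrier (free_mod R (B' (Suc 0))). cong_mod t (free_mod R (B' 0)) (\<alpha> (d 0 c)) (d' 0 u)"
    if c: "c \<in> carrier (free_mod R (B (Suc 0)))" for c
    by (rule resol_modD(5)[OF r' lin_closed[OF l c]])
      (simp add: \<alpha>(2)[OF lin_closed[OF d c], symmetric] resol_modD(4)[OF r c])
  then have "\<exists>\<alpha>'. lin R (free_mod R (B (Suc 0))) (free_mod R (B' (Suc 0))) \<alpha>' \<and>
    (\<forall>c \<in> carrier (free_mod R (B (Suc 0))). cong_mod t (free_mod R (B' 0)) (\<alpha> (d 0 c))
      (\<zero>\<^bsub>free_mod R (B' 0)\<^esub> \<oplus>\<^bsub>free_mod R (B' 0)\<^esub> d' 0 (\<alpha>' c)))"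
    using lin_closed[OF d']
    by (intro free_lift_cong_mod[OF F.module_axioms F.module_axioms d' l lin_const_zero[OF F.module_axioms] t]) auto
  then obtain \<alpha>' where 1: "lin R (free_mod R (B (Suc 0))) (free_mod R (B' (Suc 0))) \<alpha>'"
    "\<And>c. c \<in> carrier (free_mod R (B (Suc 0))) \<Longrightarrow> cong_mod t (free_mod R (B' 0)) (\<alpha> (d 0 c))
      (\<zero>\<^bsub>free_mod R (B' 0)\<^esub> \<oplus>\<^bsub>free_mod R (B' 0)\<^esub> d' 0 (\<alpha>' c))" by blast
  then have "cong_mod t (free_mod R (B' 0)) (d' 0 (\<alpha>' c)) (\<alpha> (d 0 c))"
    if c: "c \<in> carrier (free_mod R (B (Suc 0)))" for c
    using 1(2)[OF c] lin_closed[OF d' lin_closed[OF 1(1) c]] F.cong_mod_sym[OF t] by simp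
  with 1(1) \<alpha> show ?thesis by metis
qed

text \<open>One step of a homotopy from the identity to an endomorphism of the resolution. Here
  \<open>k\<close> stands for the previous homotopy followed after the differential, and is zero in
  degree 0. The conclusion has the form of the hypothesis \<open>ex\<close> one degree up, so the
  next component of the homotopy is chosen only in the next step.\<close>

lemma comparison_homotopy:
  assumes t: "t \<in> carrier R" and r: "resol_mod R t M B d a"
    and f: "lin R (free_mod R (B j)) (free_mod R (B j)) f"
    and f': "lin R (free_mod R (B (Suc j))) (free_mod R (B (Suc j))) f'"
    and comm: "\<And>c. c \<in> carrier (free_mod R (B (Suc j))) \<Longrightarrow> cong_mod t (free_mod R (B j)) (d j (f' c)) (f (d j c))"
    and k: "lin R (free_mod R (B j)) (free_mod R (B j)) k"
    and kd: "\<And>c. c \<in> carrier (free_mod R (B (Suc j))) \<Longrightarrow> cong_mod t (free_mod R (B j)) (k (d j c)) \<zero>\<^bsub>free_mod R (B j)\<^esub>"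
    and ex: "\<And>c. c \<in> carrier (free_mod R (B j)) \<Longrightarrow> \<exists>u \<in> carrier (free_mod R (B (Suc j))).
      cong_mod t (free_mod R (B j)) (f c) ((c \<oplus>\<^bsub>free_mod R (B j)\<^esub> k c) \<oplus>\<^bsub>free_mod R (B j)\<^esub> d j u)"
  shows "\<exists>h. lin R (free_mod R (B j)) (free_mod R (B (Suc j))) h
    \<and> (\<forall>c \<in> carrier (free_mod R (B (Suc j))). \<exists>u \<in> carrier (free_mod R (B (Suc (Suc j)))).
      cong_mod t (free_mod R (B (Suc j))) (f' c)
        ((c \<oplus>\<^bsub>free_mod R (B (Suc j))\<^esub> h (d j c)) \<oplus>\<^bsub>free_mod R (B (Suc j))\<^esub> d (Suc j) u))"
proof -
  interpret F: module R "free_mod R X" for X by (rule free_mod_module)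
  note d = resol_modD(1)[OF r] and tr = F.cong_mod_trans[OF t]
  obtain h where h: "lin R (free_mod R (B j)) (free_mod R (B (Suc j))) h"
    "\<And>c. c \<in> carrier (free_mod R (B j)) \<Longrightarrow>
      cong_mod t (free_mod R (B j)) (f c) ((c \<oplus>\<^bsub>free_mod R (B j)\<^esub> k c) \<oplus>\<^bsub>free_mod R (B j)\<^esub> d j (h c))"
    using free_lift_cong_mod[OF F.module_axioms F.module_axioms d f lin_plus[OF F.module_axioms lin_id k] t ex]
    by blast
  have "\<exists>u \<in> carrier (free_mod R (B (Suc (Suc j)))). cong_mod t (free_mod R (B (Suc j))) (f' c)
      ((c \<oplus>\<^bsub>free_mod R (B (Suc j))\<^esub> h (d j c)) \<oplus>\<^bsub>free_mod R (B (Suc j))\<^esub> d (Suc j) u)"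
    if c: "c \<in> carrier (free_mod R (B (Suc j)))" for c
  proof (rule resol_mod_exact_diff[OF t r lin_closed[OF f' c]])
    note dc = lin_closed[OF d c]
    note hc = lin_closed[OF h(1) dc] and kc = lin_closed[OF k dc]
    note dhc = lin_closed[OF d hc]
    show "c \<oplus>\<^bsub>free_mod R (B (Suc j))\<^esub> h (d j c) \<in> carrier (free_mod R (B (Suc j)))" using c hc by simp
    have "cong_mod t (free_mod R (B j))
      ((d j c \<oplus>\<^bsub>free_mod R (B j)\<^esub> k (d j c)) \<oplus>\<^bsub>free_mod R (B j)\<^esub> d j (h (d j c)))
      ((d j c \<oplus>\<^bsub>free_mod R (B j)\<^esub> \<zero>\<^bsub>free_mod R (B j)\<^esub>) \<oplus>\<^bsub>free_mod R (B j)\<^esub> d j (h (d j c)))"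
      by (intro F.cong_mod_add[OF t] F.cong_mod_refl[OF t] kd c dc dhc F.M.add.m_closed F.M.zero_closed)
    then have "cong_mod t (free_mod R (B j)) (f (d j c)) (d j c \<oplus>\<^bsub>free_mod R (B j)\<^esub> d j (h (d j c)))"
      using tr[OF _ h(2)[OF dc]] dc dhc by simp
    then have "cong_mod t (free_mod R (B j)) (d j (f' c)) (d j c \<oplus>\<^bsub>free_mod R (B j)\<^esub> d j (h (d j c)))"
      using tr[OF _ comm[OF c]] dc dhc by simp
    then show "cong_mod t (free_mod R (B j)) (d j (f' c)) (d j (c \<oplus>\<^bsub>free_mod R (B (Suc j))\<^esub> h (d j c)))"
      using lin_add[OF d c hc] by simp
  qed
  with h(1) show ?thesis by blast
qed

lemma comparison_comp:
  assumes t: "t \<in> carrier R"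
    and d': "lin R (free_mod R C') (free_mod R C) d'"
    and \<alpha>: "lin R (free_mod R B) (free_mod R C) \<alpha>"
    and \<alpha>': "lin R (free_mod R B') (free_mod R C') \<alpha>'"
    and \<beta>: "lin R (free_mod R C) (free_mod R B) \<beta>"
    and d: "lin R (free_mod R B') (free_mod R B) d"
    and 1: "\<And>c. c \<in> carrier (free_mod R B') \<Longrightarrow> cong_mod t (free_mod R C) (d' (\<alpha>' c)) (\<alpha> (d c))"
    and 2: "\<And>c. c \<in> carrier (free_mod R C') \<Longrightarrow> cong_mod t (free_mod R B) (d (\<beta>' c)) (\<beta> (d' c))"
    and c: "c \<in> carrier (free_mod R B')"
  shows "cong_mod t (free_mod R B) (d (\<beta>' (\<alpha>' c))) (\<beta> (\<alpha> (d c)))"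
proof -
  interpret F: module R "free_mod R X" for X by (rule free_mod_module)
  have "cong_mod t (free_mod R B) (\<beta> (d' (\<alpha>' c))) (\<beta> (\<alpha> (d c)))"
    by (rule lin_cong_mod[OF F.module_axioms \<beta> t lin_closed[OF \<alpha> lin_closed[OF d c]] 1[OF c]])
  then show ?thesis
    using F.cong_mod_trans[OF t lin_closed[OF \<beta> lin_closed[OF \<alpha> lin_closed[OF d c]]] 2[OF lin_closed[OF \<alpha>' c]]]
    by simp
qed

text \<open>Two adjacent degrees are carried together, since the next lift needs the square below
  it. The upper component of the homotopy is left as an existential \<open>u\<close>: a cocycle
  vanishes on d (Suc j) u, whatever \<open>u\<close> is.\<close>

lemma comparison:
  assumes t: "t \<in> carrier R" and M: "module R M"
    and r: "resol_mod R t M B d a" and r': "resol_mod R t M B' d' a'"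
  shows "\<exists>\<alpha> \<alpha>' \<beta> \<beta>' h. lin R (free_mod R (B j)) (free_mod R (B' j)) \<alpha>
    \<and> lin R (free_mod R (B (Suc j))) (free_mod R (B' (Suc j))) \<alpha>'
    \<and> lin R (free_mod R (B' j)) (free_mod R (B j)) \<beta>
    \<and> lin R (free_mod R (B' (Suc j))) (free_mod R (B (Suc j))) \<beta>'
    \<and> (\<forall>c \<in> carrier (free_mod R (B (Suc j))). cong_mod t (free_mod R (B' j)) (d' j (\<alpha>' c)) (\<alpha> (d j c)))
    \<and> (\<forall>c \<in> carrier (free_mod R (B' (Suc j))). cong_mod t (free_mod R (B j)) (d j (\<beta>' c)) (\<beta> (d' j c)))
    \<and> lin R (free_mod R (B j)) (free_mod R (B (Suc j))) h
    \<and> (\<forall>c \<in> carrier (free_mod R (B (Suc j))). \<exists>u \<in> carrier (free_mod R (B (Suc (Suc j)))).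
      cong_mod t (free_mod R (B (Suc j))) (\<beta>' (\<alpha>' c))
        ((c \<oplus>\<^bsub>free_mod R (B (Suc j))\<^esub> h (d j c)) \<oplus>\<^bsub>free_mod R (B (Suc j))\<^esub> d (Suc j) u))"
proof (induction j)
  interpret F: module R "free_mod R X" for X by (rule free_mod_module)
  note d = resol_modD(1)[OF r] and d' = resol_modD(1)[OF r']
  {
    case 0
    obtain \<alpha> \<alpha>' where \<alpha>: "lin R (free_mod R (B 0)) (free_mod R (B' 0)) \<alpha>"
      "\<And>c. c \<in> carrier (free_mod R (B 0)) \<Longrightarrow> a' (\<alpha> c) = a c"
      "lin R (free_mod R (B (Suc 0))) (free_mod R (B' (Suc 0))) \<alpha>'"
      "\<And>c. c \<in> carrier (free_mod R (B (Suc 0))) \<Longrightarrow> cong_mod t (free_mod R (B' 0)) (d' 0 (\<alpha>' c)) (\<alpha> (d 0 c))"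
      using comparison_base[OF t M r r'] by blast
    obtain \<beta> \<beta>' where \<beta>: "lin R (free_mod R (B' 0)) (free_mod R (B 0)) \<beta>"
      "\<And>c. c \<in> carrier (free_mod R (B' 0)) \<Longrightarrow> a (\<beta> c) = a' c"
      "lin R (free_mod R (B' (Suc 0))) (free_mod R (B (Suc 0))) \<beta>'"
      "\<And>c. c \<in> carrier (free_mod R (B' (Suc 0))) \<Longrightarrow> cong_mod t (free_mod R (B 0)) (d 0 (\<beta>' c)) (\<beta> (d' 0 c))"
      using comparison_base[OF t M r' r] by blast
    have ex: "\<exists>u \<in> carrier (free_mod R (B (Suc 0))). cong_mod t (free_mod R (B 0)) (\<beta> (\<alpha> c))
        ((c \<oplus>\<^bsub>free_mod R (B 0)\<^esub> \<zero>\<^bsub>free_mod R (B 0)\<^esub>) \<oplus>\<^bsub>free_mod R (B 0)\<^esub> d 0 u)"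
      if c: "c \<in> carrier (free_mod R (B 0))" for c
    proof -
      note ac = lin_closed[OF \<alpha>(1) c]
      have "a (\<beta> (\<alpha> c)) = a c" using \<alpha>(2)[OF c] \<beta>(2)[OF ac] by simp
      then show ?thesis
        using resol_mod_exact_diff_aug[OF t r M lin_closed[OF \<beta>(1) ac] c] c by simp
    qed
    have "\<exists>h. lin R (free_mod R (B 0)) (free_mod R (B (Suc 0))) h
      \<and> (\<forall>c \<in> carrier (free_mod R (B (Suc 0))). \<exists>u \<in> carrier (free_mod R (B (Suc (Suc 0)))).
        cong_mod t (free_mod R (B (Suc 0))) (\<beta>' (\<alpha>' c))
          ((c \<oplus>\<^bsub>free_mod R (B (Suc 0))\<^esub> h (d 0 c)) \<oplus>\<^bsub>free_mod R (B (Suc 0))\<^esub> d (Suc 0) u))"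
      by (rule comparison_homotopy[of t M B d a 0 "\<lambda>c. \<beta> (\<alpha> c)" "\<lambda>c. \<beta>' (\<alpha>' c)" "\<lambda>_. \<zero>\<^bsub>free_mod R (B 0)\<^esub>",
          OF t r lin_comp[OF \<alpha>(1) \<beta>(1)] lin_comp[OF \<alpha>(3) \<beta>(3)]
          comparison_comp[of t "B' (Suc 0)" "B' 0" "d' 0" "B 0" \<alpha> "B (Suc 0)" \<alpha>' \<beta> "d 0" \<beta>',
            OF t d' \<alpha>(1,3) \<beta>(1) d \<alpha>(4) \<beta>(4)] lin_const_zero[OF F.module_axioms]
          F.cong_mod_refl[OF t F.M.zero_closed] ex]; assumption)
    then show ?case using \<alpha>(1,3,4) \<beta>(1,3,4)
      by (elim exE conjE, intro exI[of _ \<alpha>] exI[of _ \<alpha>'] exI[of _ \<beta>] exI[of _ \<beta>'] exI conjI ballI)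
        (assumption | drule bspec)+
  next
    case (Suc j)
    then obtain \<alpha> \<alpha>' \<beta> \<beta>' h where 1: "lin R (free_mod R (B j)) (free_mod R (B' j)) \<alpha>"
      "lin R (free_mod R (B (Suc j))) (free_mod R (B' (Suc j))) \<alpha>'"
      "lin R (free_mod R (B' j)) (free_mod R (B j)) \<beta>"
      "lin R (free_mod R (B' (Suc j))) (free_mod R (B (Suc j))) \<beta>'"
      "\<And>c. c \<in> carrier (free_mod R (B (Suc j))) \<Longrightarrow> cong_mod t (free_mod R (B' j)) (d' j (\<alpha>' c)) (\<alpha> (d j c))"
      "\<And>c. c \<in> carrier (free_mod R (B' (Suc j))) \<Longrightarrow> cong_mod t (free_mod R (B j)) (d j (\<beta>' c)) (\<beta> (d' j c))"
      "lin R (free_mod R (B j)) (free_mod R (B (Suc j))) h"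
      "\<And>c. c \<in> carrier (free_mod R (B (Suc j))) \<Longrightarrow> \<exists>u \<in> carrier (free_mod R (B (Suc (Suc j)))).
        cong_mod t (free_mod R (B (Suc j))) (\<beta>' (\<alpha>' c))
          ((c \<oplus>\<^bsub>free_mod R (B (Suc j))\<^esub> h (d j c)) \<oplus>\<^bsub>free_mod R (B (Suc j))\<^esub> d (Suc j) u)"
      by blast
    obtain \<alpha>'' where \<alpha>: "lin R (free_mod R (B (Suc (Suc j)))) (free_mod R (B' (Suc (Suc j)))) \<alpha>''"
      "\<And>c. c \<in> carrier (free_mod R (B (Suc (Suc j)))) \<Longrightarrow> cong_mod t (free_mod R (B' (Suc j))) (d' (Suc j) (\<alpha>'' c)) (\<alpha>' (d (Suc j) c))"
      using comparison_lift[OF t r r' 1(1,2,5)] by blast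
    obtain \<beta>'' where \<beta>: "lin R (free_mod R (B' (Suc (Suc j)))) (free_mod R (B (Suc (Suc j)))) \<beta>''"
      "\<And>c. c \<in> carrier (free_mod R (B' (Suc (Suc j)))) \<Longrightarrow> cong_mod t (free_mod R (B (Suc j))) (d (Suc j) (\<beta>'' c)) (\<beta>' (d' (Suc j) c))"
      using comparison_lift[OF t r' r 1(3,4,6)] by blast
    have kd: "cong_mod t (free_mod R (B (Suc j))) (h (d j (d (Suc j) c))) \<zero>\<^bsub>free_mod R (B (Suc j))\<^esub>"
      if c: "c \<in> carrier (free_mod R (B (Suc (Suc j))))" for c
      using lin_cong_mod[OF F.module_axioms 1(7) t F.M.zero_closed resol_modD(6)[OF r c]]
        lin_zero[OF F.module_axioms F.module_axioms 1(7)] by simp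
    have "\<exists>h. lin R (free_mod R (B (Suc j))) (free_mod R (B (Suc (Suc j)))) h
      \<and> (\<forall>c \<in> carrier (free_mod R (B (Suc (Suc j)))). \<exists>u \<in> carrier (free_mod R (B (Suc (Suc (Suc j))))).
        cong_mod t (free_mod R (B (Suc (Suc j)))) (\<beta>'' (\<alpha>'' c))
          ((c \<oplus>\<^bsub>free_mod R (B (Suc (Suc j)))\<^esub> h (d (Suc j) c)) \<oplus>\<^bsub>free_mod R (B (Suc (Suc j)))\<^esub> d (Suc (Suc j)) u))"
      by (rule comparison_homotopy[of t M B d a "Suc j" "\<lambda>c. \<beta>' (\<alpha>' c)" "\<lambda>c. \<beta>'' (\<alpha>'' c)" "\<lambda>c. h (d j c)",
          OF t r lin_comp[OF 1(2,4)] lin_comp[OF \<alpha>(1) \<beta>(1)]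
          comparison_comp[of t "B' (Suc (Suc j))" "B' (Suc j)" "d' (Suc j)" "B (Suc j)" \<alpha>' "B (Suc (Suc j))" \<alpha>'' \<beta>' "d (Suc j)" \<beta>'',
            OF t d' 1(2) \<alpha>(1) 1(4) d \<alpha>(2) \<beta>(2)] lin_comp[OF d 1(7)]
          kd 1(8)]; assumption)
    then show ?case using 1(2,4) \<alpha> \<beta>
      by (elim exE conjE, intro exI[of _ \<alpha>'] exI[of _ \<alpha>''] exI[of _ \<beta>'] exI[of _ \<beta>''] exI conjI ballI)
        (assumption | drule bspec)+
  }
qed

text \<open>Congruent elements have equal images in \<open>N\<close>, as t kills \<open>N\<close>.
  The cocycle \<open>f\<close> is moved by \<beta>' to the other resolution, where f \<circ>
  \<beta>' = g' \<circ> d' j. Pulling back by \<alpha>' and using the homotopy gives f c + f (h (d j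
  c)) = g' (\<alpha> (d j c)), which exhibits \<open>f\<close> as a map composed with
  \<open>d j\<close>.\<close>

lemma comparison_vanishing:
  assumes t: "t \<in> carrier R" and M: "module R M" and N: "module R N"
    and tN: "\<And>v. v \<in> carrier N \<Longrightarrow> t \<odot>\<^bsub>N\<^esub> v = \<zero>\<^bsub>N\<^esub>"
    and r: "resol_mod R t M B d a" and r': "resol_mod R t M B' d' a'"
    and ext_vanish: "\<And>f'. lin R (free_mod R (B' (Suc j))) N f' \<Longrightarrow>
      (\<And>c. c \<in> carrier (free_mod R (B' (Suc (Suc j)))) \<Longrightarrow> f' (d' (Suc j) c) = \<zero>\<^bsub>N\<^esub>) \<Longrightarrow>
      \<exists>g'. lin R (free_mod R (B' j)) N g' \<and> (\<forall>c \<in> carrier (free_mod R (B' (Suc j))). f' c = g' (d' j c))"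
    and f: "lin R (free_mod R (B (Suc j))) N f"
    and fd: "\<And>c. c \<in> carrier (free_mod R (B (Suc (Suc j)))) \<Longrightarrow> f (d (Suc j) c) = \<zero>\<^bsub>N\<^esub>"
  shows "\<exists>g. lin R (free_mod R (B j)) N g \<and> (\<forall>c \<in> carrier (free_mod R (B (Suc j))). f c = g (d j c))"
proof -
  interpret F: module R "free_mod R X" for X by (rule free_mod_module)
  interpret N: module R N by (rule N)
  note d = resol_modD(1)[OF r] and d' = resol_modD(1)[OF r']
  have cong: "g u = g v" if "lin R (free_mod R C) N g" "v \<in> carrier (free_mod R C)" "cong_mod t (free_mod R C) u v"
    for g u v C
    using cong_mod_killed[OF N lin_closed[OF that(1,2)] lin_cong_mod[OF free_mod_module that(1) t that(2,3)]] tN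
    by blast
  obtain \<alpha> \<alpha>' \<beta> \<beta>' h where 1: "lin R (free_mod R (B j)) (free_mod R (B' j)) \<alpha>"
    "lin R (free_mod R (B (Suc j))) (free_mod R (B' (Suc j))) \<alpha>'"
    "lin R (free_mod R (B' j)) (free_mod R (B j)) \<beta>"
    "lin R (free_mod R (B' (Suc j))) (free_mod R (B (Suc j))) \<beta>'"
    "\<And>c. c \<in> carrier (free_mod R (B (Suc j))) \<Longrightarrow> cong_mod t (free_mod R (B' j)) (d' j (\<alpha>' c)) (\<alpha> (d j c))"
    "\<And>c. c \<in> carrier (free_mod R (B' (Suc j))) \<Longrightarrow> cong_mod t (free_mod R (B j)) (d j (\<beta>' c)) (\<beta> (d' j c))"
    "lin R (free_mod R (B j)) (free_mod R (B (Suc j))) h"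
    "\<And>c. c \<in> carrier (free_mod R (B (Suc j))) \<Longrightarrow> \<exists>u \<in> carrier (free_mod R (B (Suc (Suc j)))).
      cong_mod t (free_mod R (B (Suc j))) (\<beta>' (\<alpha>' c))
        ((c \<oplus>\<^bsub>free_mod R (B (Suc j))\<^esub> h (d j c)) \<oplus>\<^bsub>free_mod R (B (Suc j))\<^esub> d (Suc j) u)"
    using comparison[OF t M r r', of j] by blast
  \<comment> \<open>No chain map in degree j + 2 is at hand. Instead, \<beta>' (d' (Suc j) c) is a
    cycle modulo t, hence by exactness congruent to a boundary, and \<open>f\<close> kills
    boundaries.\<close>
  have "f (\<beta>' (d' (Suc j) c)) = \<zero>\<^bsub>N\<^esub>" if c: "c \<in> carrier (free_mod R (B' (Suc (Suc j))))" for c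
  proof -
    note dc = lin_closed[OF d' c]
    have "cong_mod t (free_mod R (B j)) (\<beta> (d' j (d' (Suc j) c))) \<zero>\<^bsub>free_mod R (B j)\<^esub>"
      using lin_cong_mod[OF F.module_axioms 1(3) t F.M.zero_closed resol_modD(6)[OF r' c]]
        lin_zero[OF F.module_axioms F.module_axioms 1(3)] by simp
    then have "cong_mod t (free_mod R (B j)) (d j (\<beta>' (d' (Suc j) c))) \<zero>\<^bsub>free_mod R (B j)\<^esub>"
      using F.cong_mod_trans[OF t _ 1(6)[OF dc]] by simp
    then obtain u where u: "u \<in> carrier (free_mod R (B (Suc (Suc j))))"
      "cong_mod t (free_mod R (B (Suc j))) (\<beta>' (d' (Suc j) c)) (d (Suc j) u)"
      using resol_modD(7)[OF r lin_closed[OF 1(4) dc]] by blast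
    then show ?thesis using cong[OF f lin_closed[OF d u(1)] u(2)] fd[OF u(1)] by simp
  qed
  then obtain g' where g': "lin R (free_mod R (B' j)) N g'"
    "\<And>c. c \<in> carrier (free_mod R (B' (Suc j))) \<Longrightarrow> f (\<beta>' c) = g' (d' j c)"
    using ext_vanish[OF lin_comp[OF 1(4) f]] by blast
  let ?g = "\<lambda>c. g' (\<alpha> c) \<ominus>\<^bsub>N\<^esub> f (h c)"
  have "f c = ?g (d j c)" if c: "c \<in> carrier (free_mod R (B (Suc j)))" for c
  proof -
    note dc = lin_closed[OF d c] and ac = lin_closed[OF 1(2) c]
    note adc = lin_closed[OF 1(1) dc] and hdc = lin_closed[OF 1(7) dc]
    obtain u where u: "u \<in> carrier (free_mod R (B (Suc (Suc j))))"
      "cong_mod t (free_mod R (B (Suc j))) (\<beta>' (\<alpha>' c))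
        ((c \<oplus>\<^bsub>free_mod R (B (Suc j))\<^esub> h (d j c)) \<oplus>\<^bsub>free_mod R (B (Suc j))\<^esub> d (Suc j) u)"
      using 1(8)[OF c] by blast
    have "f (\<beta>' (\<alpha>' c)) = f c \<oplus>\<^bsub>N\<^esub> f (h (d j c))"
      using cong[OF f _ u(2)] c hdc lin_closed[OF d u(1)] fd[OF u(1)] lin_closed[OF f]
      by (simp add: lin_add[OF f])
    moreover have "f (\<beta>' (\<alpha>' c)) = g' (\<alpha> (d j c))"
      using g'(2)[OF ac] cong[OF g'(1) adc 1(5)[OF c]] by simp
    ultimately show ?thesis using lin_closed[OF f c] lin_closed[OF f hdc]
      by (simp add: a_minus_def N.M.a_assoc N.M.r_neg)
  qed
  moreover have "lin R (free_mod R (B j)) N ?g"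
    by (rule lin_minus[OF N lin_comp[OF 1(1) g'(1)] lin_comp[OF 1(7) f]])
  ultimately show ?thesis by blast
qed

end

section \<open>The standard resolution\<close>

lemma syz_elem_syz:
  fixes c :: "('m, 'r) gen \<Rightarrow> 'r"
  assumes c: "finite {b. c b \<noteq> \<zero>\<^bsub>R\<^esub>}"
  shows "syz_elem R (syz R c) = c"
proof -
  have "inj_on (syz R) {c :: ('m, 'r) gen \<Rightarrow> 'r. finite {b. c b \<noteq> \<zero>\<^bsub>R\<^esub>}}"
  proof (rule inj_onI)
    fix c d :: "('m, 'r) gen \<Rightarrow> 'r"
    assume fin: "c \<in> {c. finite {b. c b \<noteq> \<zero>\<^bsub>R\<^esub>}}" "d \<in> {c. finite {b. c b \<noteq> \<zero>\<^bsub>R\<^esub>}}"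
      and eq: "syz R c = syz R d"
    have "finite {(b, c b) | b. c b \<noteq> \<zero>\<^bsub>R\<^esub>}" "finite {(b, d b) | b. d b \<noteq> \<zero>\<^bsub>R\<^esub>}"
      using fin by simp_all
    then have g: "{(b, c b) | b. c b \<noteq> \<zero>\<^bsub>R\<^esub>} = {(b, d b) | b. d b \<noteq> \<zero>\<^bsub>R\<^esub>}"
      using eq by (simp add: syz_def Abs_fset_inject)
    show "c = d"
    proof
      fix b
      have "(b, v) \<in> {(b, c b) | b. c b \<noteq> \<zero>\<^bsub>R\<^esub>} \<longleftrightarrow> (b, v) \<in> {(b, d b) | b. d b \<noteq> \<zero>\<^bsub>R\<^esub>}" for v
        using g by simp
      then show "c b = d b" by simp metis
    qed
  qed
  then show ?thesis unfolding syz_elem_def using c by (intro inv_into_f_f) auto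
qed

lemma res_basis_simps:
  "res_basis R M (Suc 0) = syz R ` {c \<in> carrier (free_mod R (res_basis R M 0)). res_aug R M c = \<zero>\<^bsub>M\<^esub>}"
  "res_basis R M (Suc (Suc n)) = syz R ` {c \<in> carrier (free_mod R (res_basis R M (Suc n))).
    res_diff R M n c = \<zero>\<^bsub>free_mod R (res_basis R M n)\<^esub>}"
  by (simp_all add: res_mod_def res_aug_def res_diff_def)

declare res_basis.simps(2,3) [simp del]

lemma res_basis_syz:
  assumes "b \<in> res_basis R M (Suc n)"
  obtains c where "c \<in> carrier (free_mod R (res_basis R M n))" "b = syz R c" "syz_elem R b = c"
  using assms by (cases n) (auto simp: res_basis_simps syz_elem_syz free_mod_carrier)

context
  fixes R :: "('r, 'x) ring_scheme" and M :: "('r, 'm) module"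
  assumes M: "module R M"
begin

interpretation module R M by (rule M)
interpretation F: module R "free_mod R B" for B by (rule R.free_mod_module)

lemma lin_res_aug: "lin R (free_mod R (res_basis R M 0)) M (res_aug R M)"
  unfolding res_aug_def by (rule lin_lin_ext[OF M]) auto

lemma lin_res_diff:
  "lin R (free_mod R (res_basis R M (Suc n))) (free_mod R (res_basis R M n)) (res_diff R M n)"
  unfolding res_diff_def res_mod_def
  by (rule lin_lin_ext[OF F.module_axioms]) (metis res_basis_syz)

lemma res_aug_Gen: "m \<in> carrier M \<Longrightarrow> res_aug R M (basis_vec R (Gen m)) = m"
  unfolding res_aug_def using lin_ext_basis_vec[OF M, of gen_elem "Gen m"] by simp

lemma basis_vec_Gen: "m \<in> carrier M \<Longrightarrow> basis_vec R (Gen m) \<in> carrier (free_mod R (res_basis R M 0))"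
  by (rule R.basis_vec_closed) simp

lemma res_diff_basis_vec:
  assumes "b \<in> res_basis R M (Suc n)"
  shows "res_diff R M n (basis_vec R b) = syz_elem R b"
  unfolding res_diff_def res_mod_def
  by (rule lin_ext_basis_vec[OF F.module_axioms]) (metis assms res_basis_syz)

lemma res_aug_diff:
  assumes "c \<in> carrier (free_mod R (res_basis R M (Suc 0)))"
  shows "res_aug R M (res_diff R M 0 c) = \<zero>\<^bsub>M\<^esub>"
proof (rule lin_eq_on_basis[OF M lin_comp[OF lin_res_diff lin_res_aug] lin_const_zero[OF M] _ assms])
  fix b assume b: "b \<in> res_basis R M (Suc 0)"
  then show "res_aug R M (res_diff R M 0 (basis_vec R b)) = \<zero>\<^bsub>M\<^esub>"
    unfolding res_diff_basis_vec[OF b] by (auto simp: res_basis_simps syz_elem_syz free_mod_carrier)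
qed

lemma res_diff_diff:
  assumes "c \<in> carrier (free_mod R (res_basis R M (Suc (Suc n))))"
  shows "res_diff R M n (res_diff R M (Suc n) c) = \<zero>\<^bsub>free_mod R (res_basis R M n)\<^esub>"
proof (rule lin_eq_on_basis[OF F.module_axioms lin_comp[OF lin_res_diff lin_res_diff]
      lin_const_zero[OF F.module_axioms] _ assms])
  fix b assume b: "b \<in> res_basis R M (Suc (Suc n))"
  then show "res_diff R M n (res_diff R M (Suc n) (basis_vec R b)) = \<zero>\<^bsub>free_mod R (res_basis R M n)\<^esub>"
    unfolding res_diff_basis_vec[OF b] by (auto simp: res_basis_simps syz_elem_syz free_mod_carrier)
qed

text \<open>Exactness is built into the basis: a cycle \<open>c\<close> itself indexes the basis
  element \<open>syz R c\<close> one degree up, and the differential sends that element to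
  \<open>c\<close>. The same holds in all higher degrees.\<close>

lemma res_aug_exact:
  assumes "c \<in> carrier (free_mod R (res_basis R M 0))" "res_aug R M c = \<zero>\<^bsub>M\<^esub>"
  shows "\<exists>u \<in> carrier (free_mod R (res_basis R M (Suc 0))). c = res_diff R M 0 u"
proof -
  have b: "syz R c \<in> res_basis R M (Suc 0)" using assms by (simp add: res_basis_simps)
  show ?thesis
    using res_diff_basis_vec[OF b] R.basis_vec_closed[OF b] assms by (metis free_mod_carrier syz_elem_syz)
qed

lemma res_diff_exact:
  assumes "c \<in> carrier (free_mod R (res_basis R M (Suc n)))"
    "res_diff R M n c = \<zero>\<^bsub>free_mod R (res_basis R M n)\<^esub>"
  shows "\<exists>u \<in> carrier (free_mod R (res_basis R M (Suc (Suc n)))). c = res_diff R M (Suc n) u"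
proof -
  have b: "syz R c \<in> res_basis R M (Suc (Suc n))" using assms by (simp add: res_basis_simps)
  show ?thesis
    using res_diff_basis_vec[OF b] R.basis_vec_closed[OF b] assms by (metis free_mod_carrier syz_elem_syz)
qed

end

section \<open>Hom modules, subquotients, and the meaning of vanishing Ext\<close>

lemma lin_maps_iff: "f \<in> lin_maps R A C \<longleftrightarrow> lin R A C f \<and> f \<in> extensional (carrier A)"
  by (auto simp: lin_maps_def lin_def hom_def)

text \<open>Extensionality is imposed only on passing to \<open>Hom_mod\<close>. Elsewhere
  \<open>lin\<close> is used, which is stable under composition and sums without restricting maps to
  carriers.\<close>

lemma lin_restrict: "module R A \<Longrightarrow> lin R A C f \<Longrightarrow> restrict f (carrier A) \<in> lin_maps R A C"
  unfolding lin_maps_iff by (auto intro: lin_cong)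

lemma Hom_mod_simps:
  "carrier (Hom_mod R A C) = lin_maps R A C"
  "\<zero>\<^bsub>Hom_mod R A C\<^esub> = (\<lambda>u \<in> carrier A. \<zero>\<^bsub>C\<^esub>)"
  "f \<oplus>\<^bsub>Hom_mod R A C\<^esub> g = (\<lambda>u \<in> carrier A. f u \<oplus>\<^bsub>C\<^esub> g u)"
  "a \<odot>\<^bsub>Hom_mod R A C\<^esub> f = (\<lambda>u \<in> carrier A. a \<odot>\<^bsub>C\<^esub> f u)"
  by (simp_all add: Hom_mod_def)

lemma Hom_mod_module:
  assumes A: "module R A" and C: "module R C"
  shows "module R (Hom_mod R A C)"
proof -
  interpret A: module R A by (rule A)
  interpret C: module R C by (rule C)
  have cl: "f u \<in> carrier C" if "f \<in> lin_maps R A C" "u \<in> carrier A" for f u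
    using that lin_closed by (auto simp: lin_maps_iff)
  note eq = extensionalityI[of _ "carrier A"]
  show ?thesis
  proof (rule moduleI)
    show "abelian_group (Hom_mod R A C)"
    proof (rule abelian_groupI)
      fix f assume f: "f \<in> carrier (Hom_mod R A C)"
      then have "(\<lambda>u \<in> carrier A. \<ominus>\<^bsub>R\<^esub> \<one>\<^bsub>R\<^esub> \<odot>\<^bsub>C\<^esub> f u) \<in> carrier (Hom_mod R A C)"
        using lin_restrict[OF A lin_scale[OF C, of A f "\<ominus>\<^bsub>R\<^esub> \<one>\<^bsub>R\<^esub>"]] by (auto simp: Hom_mod_simps lin_maps_iff)
      moreover have "(\<lambda>u \<in> carrier A. \<ominus>\<^bsub>R\<^esub> \<one>\<^bsub>R\<^esub> \<odot>\<^bsub>C\<^esub> f u) \<oplus>\<^bsub>Hom_mod R A C\<^esub> f = \<zero>\<^bsub>Hom_mod R A C\<^esub>"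
        using cl f by (auto simp: Hom_mod_simps C.smult_l_minus C.M.l_neg fun_eq_iff)
      ultimately show "\<exists>g \<in> carrier (Hom_mod R A C). g \<oplus>\<^bsub>Hom_mod R A C\<^esub> f = \<zero>\<^bsub>Hom_mod R A C\<^esub>" by blast
    next
      fix f g assume "f \<in> carrier (Hom_mod R A C)" "g \<in> carrier (Hom_mod R A C)"
      then show "f \<oplus>\<^bsub>Hom_mod R A C\<^esub> g \<in> carrier (Hom_mod R A C)"
        using lin_restrict[OF A lin_plus[OF C]] by (auto simp: Hom_mod_simps lin_maps_iff)
    next
      show "\<zero>\<^bsub>Hom_mod R A C\<^esub> \<in> carrier (Hom_mod R A C)"
        using lin_restrict[OF A lin_const_zero[OF C]] by (auto simp: Hom_mod_simps)
    next
      fix f assume "f \<in> carrier (Hom_mod R A C)"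
      then show "\<zero>\<^bsub>Hom_mod R A C\<^esub> \<oplus>\<^bsub>Hom_mod R A C\<^esub> f = f"
        by (intro eq) (auto simp: Hom_mod_simps cl lin_maps_iff lin_closed)
    qed (auto simp: Hom_mod_simps cl C.M.a_ac fun_eq_iff)
  next
    fix a f assume "a \<in> carrier R" "f \<in> carrier (Hom_mod R A C)"
    then show "a \<odot>\<^bsub>Hom_mod R A C\<^esub> f \<in> carrier (Hom_mod R A C)"
      using lin_restrict[OF A lin_scale[OF C]] by (auto simp: Hom_mod_simps lin_maps_iff)
  next
    fix f assume "f \<in> carrier (Hom_mod R A C)"
    then show "\<one>\<^bsub>R\<^esub> \<odot>\<^bsub>Hom_mod R A C\<^esub> f = f"
      by (intro eq) (auto simp: Hom_mod_simps cl lin_maps_iff lin_closed)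
  qed (auto simp: Hom_mod_simps cl C.smult_l_distr C.smult_r_distr C.smult_assoc1 fun_eq_iff A.R.is_cring)
qed

text \<open>The cosets of \<open>B\<close> in \<open>Z\<close> are the fibres of \<theta>. Once this
  is known, the set operations that define the subquotient are computed on fibres, where
  representatives do not matter.\<close>

lemma subquotient_mod_iso:
  assumes C: "module R C" and H: "module R H" and Z: "submodule Z R C" and BZ: "B \<subseteq> Z"
    and \<theta>: "\<And>u. u \<in> Z \<Longrightarrow> \<theta> u \<in> carrier H"
      "\<And>u v. u \<in> Z \<Longrightarrow> v \<in> Z \<Longrightarrow> \<theta> (u \<oplus>\<^bsub>C\<^esub> v) = \<theta> u \<oplus>\<^bsub>H\<^esub> \<theta> v"
      "\<And>a u. a \<in> carrier R \<Longrightarrow> u \<in> Z \<Longrightarrow> \<theta> (a \<odot>\<^bsub>C\<^esub> u) = a \<odot>\<^bsub>H\<^esub> \<theta> u"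
    and ker: "\<And>u. u \<in> Z \<Longrightarrow> \<theta> u = \<zero>\<^bsub>H\<^esub> \<longleftrightarrow> u \<in> B"
    and surj: "\<And>h. h \<in> carrier H \<Longrightarrow> \<exists>u \<in> Z. h = \<theta> u"
  shows "mod_iso R (subquotient C Z B) H"
proof -
  interpret C: module R C by (rule C)
  interpret H: module R H by (rule H)
  note Zs = C.submoduleE(4,5)[OF Z]
  have Zc: "u \<in> carrier C" if "u \<in> Z" for u using C.submoduleE(1)[OF Z] that by blast
  have Zm: "u \<ominus>\<^bsub>C\<^esub> v \<in> Z" if "u \<in> Z" "v \<in> Z" for u v
    using that C.submoduleE(3,5)[OF Z] by (simp add: a_minus_def)
  have split: "u = (u \<ominus>\<^bsub>C\<^esub> v) \<oplus>\<^bsub>C\<^esub> v" if "u \<in> Z" "v \<in> Z" for u v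
    using C.eq_plus_minus[OF Zc Zc] that Zc by (simp add: C.M.a_comm)
  have \<theta>m: "\<theta> (u \<ominus>\<^bsub>C\<^esub> v) \<oplus>\<^bsub>H\<^esub> \<theta> v = \<theta> u" if "u \<in> Z" "v \<in> Z" for u v
    using \<theta>(2)[OF Zm[OF that] that(2)] split[OF that] by simp
  have coset: "B +>\<^bsub>C\<^esub> u = {w \<in> Z. \<theta> w = \<theta> u}" if u: "u \<in> Z" for u
  proof (intro equalityI subsetI)
    fix w assume "w \<in> B +>\<^bsub>C\<^esub> u"
    then obtain b where "b \<in> B" "w = b \<oplus>\<^bsub>C\<^esub> u" by (auto simp: a_r_coset_def r_coset_def)
    then show "w \<in> {w \<in> Z. \<theta> w = \<theta> u}" using BZ u ker Zs \<theta> by (auto simp: subset_iff)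
  next
    fix w assume w: "w \<in> {w \<in> Z. \<theta> w = \<theta> u}"
    then have "\<theta> (w \<ominus>\<^bsub>C\<^esub> u) = \<zero>\<^bsub>H\<^esub>" using \<theta>m[of w u] u \<theta>(1) Zm[of w u] by simp
    then have "w \<ominus>\<^bsub>C\<^esub> u \<in> B" using ker Zm w u by blast
    then show "w \<in> B +>\<^bsub>C\<^esub> u" using split[of w u] w u by (auto simp: a_r_coset_def r_coset_def)
  qed
  let ?Q = "subquotient C Z B"
  define F where "F = (\<lambda>X \<in> carrier ?Q. \<theta> (SOME u. u \<in> X))"
  have Q: "carrier ?Q = (\<lambda>u. B +>\<^bsub>C\<^esub> u) ` Z" by (simp add: subquotient_def)
  have F: "F (B +>\<^bsub>C\<^esub> u) = \<theta> u" if u: "u \<in> Z" for u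
  proof -
    have "u \<in> B +>\<^bsub>C\<^esub> u" using u coset by simp
    then have "(SOME w. w \<in> B +>\<^bsub>C\<^esub> u) \<in> B +>\<^bsub>C\<^esub> u" by (rule someI)
    then show ?thesis using u coset by (simp add: F_def Q)
  qed
  have add: "(B +>\<^bsub>C\<^esub> u) \<oplus>\<^bsub>?Q\<^esub> (B +>\<^bsub>C\<^esub> v) = B +>\<^bsub>C\<^esub> (u \<oplus>\<^bsub>C\<^esub> v)" if uv: "u \<in> Z" "v \<in> Z" for u v
  proof -
    have "set_add C {w \<in> Z. \<theta> w = \<theta> u} {w \<in> Z. \<theta> w = \<theta> v} = {w \<in> Z. \<theta> w = \<theta> (u \<oplus>\<^bsub>C\<^esub> v)}"
    proof (intro equalityI subsetI)
      fix w assume "w \<in> set_add C {w \<in> Z. \<theta> w = \<theta> u} {w \<in> Z. \<theta> w = \<theta> v}"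
      then show "w \<in> {w \<in> Z. \<theta> w = \<theta> (u \<oplus>\<^bsub>C\<^esub> v)}"
        using Zs \<theta>(2) uv by (auto simp: set_add_def set_mult_def)
    next
      fix w assume w: "w \<in> {w \<in> Z. \<theta> w = \<theta> (u \<oplus>\<^bsub>C\<^esub> v)}"
      then have "\<theta> (w \<ominus>\<^bsub>C\<^esub> v) \<oplus>\<^bsub>H\<^esub> \<theta> v = \<theta> u \<oplus>\<^bsub>H\<^esub> \<theta> v" using \<theta>m[of w v] \<theta>(2) uv by simp
      then have "\<theta> (w \<ominus>\<^bsub>C\<^esub> v) = \<theta> u" using \<theta>(1) Zm w uv by simp
      then show "w \<in> set_add C {w \<in> Z. \<theta> w = \<theta> u} {w \<in> Z. \<theta> w = \<theta> v}"
        using split[of w v] Zm w uv unfolding set_add_def set_mult_def by auto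
    qed
    then show ?thesis using coset uv Zs by (simp add: subquotient_def)
  qed
  have smult: "a \<odot>\<^bsub>?Q\<^esub> (B +>\<^bsub>C\<^esub> u) = B +>\<^bsub>C\<^esub> (a \<odot>\<^bsub>C\<^esub> u)" if "a \<in> carrier R" "u \<in> Z" for a u
  proof -
    have "(\<Union>w \<in> {w \<in> Z. \<theta> w = \<theta> u}. B +>\<^bsub>C\<^esub> (a \<odot>\<^bsub>C\<^esub> w)) = B +>\<^bsub>C\<^esub> (a \<odot>\<^bsub>C\<^esub> u)"
      using that Zs \<theta>(3) coset by auto
    then show ?thesis using that coset by (simp add: subquotient_def)
  qed
  have "F \<in> lin_maps R ?Q H"
    unfolding lin_maps_iff
  proof (intro conjI linI)
    show "F \<in> extensional (carrier ?Q)" by (simp add: F_def)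
  next
    fix X assume "X \<in> carrier ?Q"
    then show "F X \<in> carrier H" using F \<theta>(1) by (auto simp: Q)
  next
    fix X Y assume "X \<in> carrier ?Q" "Y \<in> carrier ?Q"
    then show "F (X \<oplus>\<^bsub>?Q\<^esub> Y) = F X \<oplus>\<^bsub>H\<^esub> F Y" using F add \<theta>(2) Zs by (auto simp: Q)
  next
    fix a X assume "a \<in> carrier R" "X \<in> carrier ?Q"
    then show "F (a \<odot>\<^bsub>?Q\<^esub> X) = a \<odot>\<^bsub>H\<^esub> F X" using F smult \<theta>(3) Zs by (auto simp: Q)
  qed
  moreover have "bij_betw F (carrier ?Q) (carrier H)"
    unfolding bij_betw_def
  proof
    show "inj_on F (carrier ?Q)" 
    proof (rule inj_onI)
      fix X Y assume "X \<in> carrier ?Q" "Y \<in> carrier ?Q" and eq: "F X = F Y"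
      then obtain u v where uv: "u \<in> Z" "v \<in> Z" "X = B +>\<^bsub>C\<^esub> u" "Y = B +>\<^bsub>C\<^esub> v" by (auto simp: Q)
      then have "\<theta> u = \<theta> v" using eq F by simp
      then show "X = Y" using uv coset by simp
    qed
    show "F ` carrier ?Q = carrier H" using F \<theta>(1) surj by (force simp: Q image_iff)
  qed
  ultimately show ?thesis unfolding mod_iso_def by blast
qed

lemma Ext_zero_extend:
  assumes M: "module R M" and N: "module R N" and zero: "zero_module (Ext R (Suc j) M N)"
    and f: "lin R (free_mod R (res_basis R M (Suc j))) N f"
    and fd: "\<And>c. c \<in> carrier (free_mod R (res_basis R M (Suc (Suc j)))) \<Longrightarrow> f (res_diff R M (Suc j) c) = \<zero>\<^bsub>N\<^esub>"
  shows "\<exists>g. lin R (free_mod R (res_basis R M j)) N g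
    \<and> (\<forall>c \<in> carrier (free_mod R (res_basis R M (Suc j))). f c = g (res_diff R M j c))"
proof -
  interpret M: module R M by (rule M)
  interpret N: module R N by (rule N)
  interpret F: module R "free_mod R X" for X by (rule M.R.free_mod_module)
  let ?C = "Ext_cochain R M N (Suc j)" and ?B = "Ext_coboundaries R M N (Suc j)"
  interpret C: module R ?C unfolding Ext_cochain_def res_mod_def by (rule Hom_mod_module[OF F.module_axioms N])
  let ?f = "restrict f (carrier (res_mod R M (Suc j)))"
  have fC: "?f \<in> carrier ?C"
    using lin_restrict[OF F.module_axioms f] by (simp add: Ext_cochain_def Hom_mod_simps res_mod_def)
  have "?f \<in> Ext_cocycles R M N (Suc j)"
    using fC fd lin_closed[OF lin_res_diff[OF M]]
    by (auto simp: Ext_cocycles_def Ext_codiff_def Ext_cochain_def Hom_mod_simps res_mod_def fun_eq_iff)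
  then have "?B +>\<^bsub>?C\<^esub> ?f \<in> carrier (Ext R (Suc j) M N)" by (simp add: Ext_def subquotient_def)
  then have eq: "?B +>\<^bsub>?C\<^esub> ?f = ?B" using zero by (simp add: zero_module_def) (simp add: Ext_def subquotient_def)
  \<comment> \<open>That zero is a coboundary is what places \<open>?f\<close> in its own coset, and
    thus among the coboundaries.\<close>
  have "restrict (\<lambda>_. \<zero>\<^bsub>N\<^esub>) (carrier (res_mod R M j)) \<in> carrier (Ext_cochain R M N j)"
    unfolding Ext_cochain_def Hom_mod_simps res_mod_def
    by (rule lin_restrict[OF F.module_axioms lin_const_zero[OF N]])
  moreover have "Ext_codiff R M j (restrict (\<lambda>_. \<zero>\<^bsub>N\<^esub>) (carrier (res_mod R M j))) = \<zero>\<^bsub>?C\<^esub>"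
    using lin_closed[OF lin_res_diff[OF M]]
    by (auto simp: Ext_codiff_def Ext_cochain_def Hom_mod_simps res_mod_def fun_eq_iff)
  ultimately have "\<zero>\<^bsub>?C\<^esub> \<in> ?B" by (metis Ext_coboundaries.simps(2) image_eqI)
  then have "\<zero>\<^bsub>?C\<^esub> \<oplus>\<^bsub>?C\<^esub> ?f \<in> ?B +>\<^bsub>?C\<^esub> ?f" unfolding a_r_coset_def r_coset_def by auto
  then have "?f \<in> ?B" using eq C.M.l_zero[OF fC] by simp
  then obtain g where g: "g \<in> carrier (Ext_cochain R M N j)" "?f = Ext_codiff R M j g" by auto
  have "lin R (free_mod R (res_basis R M j)) N g"
    using g(1) by (simp add: Ext_cochain_def Hom_mod_simps lin_maps_iff res_mod_def)
  moreover have "f c = g (res_diff R M j c)" if "c \<in> carrier (free_mod R (res_basis R M (Suc j)))" for c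
    using fun_cong[OF g(2), of c] that by (simp add: Ext_codiff_def res_mod_def)
  ultimately show ?thesis by blast
qed

section \<open>Reduction modulo a principal ideal\<close>

locale principal_quotient = cring S for S :: "('a, 'z) ring_scheme" (structure) +
  fixes x :: 'a
  assumes x_closed [simp]: "x \<in> carrier S"
begin

abbreviation Q :: "'a set ring" where "Q \<equiv> S Quot PIdl x"
abbreviation qr :: "('a set, 'm) module \<Rightarrow> ('a, 'm) module" where "qr \<equiv> quot_restrict S (PIdl x)"
abbreviation q :: "'a \<Rightarrow> 'a set" where "q a \<equiv> PIdl x +> a"

lemma I_ideal: "ideal (PIdl x) S"
  by (rule cgenideal_ideal[OF x_closed])

lemma Q_cring: "cring Q"
  by (rule ideal.quotient_is_cring[OF I_ideal is_cring])

lemma q_hom: "q \<in> ring_hom S Q"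
  by (rule ideal.rcos_ring_hom[OF I_ideal])

lemmas q_simps = ring_hom_closed[OF q_hom] ring_hom_add[OF q_hom] ring_hom_mult[OF q_hom]
  ring_hom_one[OF q_hom]

lemma q_surj: "b \<in> carrier Q \<Longrightarrow> \<exists>a \<in> carrier S. b = q a"
  by (auto simp: FactRing_def A_RCOSETS_def')

lemma q_eq:
  assumes "a \<in> carrier S" "b \<in> carrier S"
  shows "q a = q b \<longleftrightarrow> (\<exists>c \<in> carrier S. a \<ominus> b = c \<otimes> x)"
  using quotient_eq_iff_same_a_r_cos[OF I_ideal assms] by (auto simp: cgenideal_def)

lemma q_zero: "q \<zero> = \<zero>\<^bsub>Q\<^esub>"
  using ring_hom_zero[OF q_hom ring_axioms cring.axioms(1)[OF Q_cring]] .

lemma q_x: "q x = \<zero>\<^bsub>Q\<^esub>"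
  unfolding q_zero[symmetric] using q_eq[of x \<zero>] by (auto simp: a_minus_def intro: bexI[of _ \<one>])

lemma qr_simps:
  "carrier (qr A) = carrier A" "\<zero>\<^bsub>qr A\<^esub> = \<zero>\<^bsub>A\<^esub>" "u \<oplus>\<^bsub>qr A\<^esub> v = u \<oplus>\<^bsub>A\<^esub> v"
  "a \<odot>\<^bsub>qr A\<^esub> u = q a \<odot>\<^bsub>A\<^esub> u"
  by (simp_all add: quot_restrict_def)

lemma qr_module:
  assumes A: "module Q A"
  shows "module S (qr A)"
proof -
  interpret A: module Q A by (rule A)
  show ?thesis
  proof (rule moduleI)
    show "abelian_group (qr A)"
    proof (rule abelian_groupI)
      fix u assume "u \<in> carrier (qr A)"
      then show "\<exists>v \<in> carrier (qr A). v \<oplus>\<^bsub>qr A\<^esub> u = \<zero>\<^bsub>qr A\<^esub>"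
        by (intro bexI[of _ "\<ominus>\<^bsub>A\<^esub> u"]) (auto simp: qr_simps A.M.l_neg)
    qed (auto simp: qr_simps A.M.a_ac)
  qed (auto simp: qr_simps q_simps A.smult_l_distr A.smult_r_distr A.smult_assoc1 is_cring)
qed

lemma qr_killed: "module Q A \<Longrightarrow> v \<in> carrier A \<Longrightarrow> x \<odot>\<^bsub>qr A\<^esub> v = \<zero>\<^bsub>qr A\<^esub>"
  by (simp add: qr_simps q_x module.smult_l_null)

lemma lin_qr: "lin S (qr A) (qr C) f \<longleftrightarrow> lin Q A C f"
proof
  assume f: "lin S (qr A) (qr C) f"
  show "lin Q A C f"
  proof (rule linI)
    fix b u assume "b \<in> carrier Q" "u \<in> carrier A"
    moreover then obtain a where "a \<in> carrier S" "b = q a" using q_surj by blast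
    ultimately show "f (b \<odot>\<^bsub>A\<^esub> u) = b \<odot>\<^bsub>C\<^esub> f u" using lin_smult[OF f, of a u] by (simp add: qr_simps)
  qed (use lin_closed[OF f] lin_add[OF f] in \<open>simp_all add: qr_simps\<close>)
next
  assume f: "lin Q A C f"
  show "lin S (qr A) (qr C) f"
    by (rule linI) (use f in \<open>auto simp: qr_simps q_simps lin_closed lin_add lin_smult\<close>)
qed

definition red :: "('k \<Rightarrow> 'a) \<Rightarrow> 'k \<Rightarrow> 'a set"
  where "red c = (\<lambda>b. q (c b))"

lemma lin_red: "lin S (free_mod S B) (qr (free_mod Q B)) red"
proof (rule linI)
  fix c assume c: "c \<in> carrier (free_mod S B)"
  have "q (c b) = \<zero>\<^bsub>Q\<^esub>" if "c b = \<zero>" for b unfolding that by (rule q_zero)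
  then have "{b. q (c b) \<noteq> \<zero>\<^bsub>Q\<^esub>} \<subseteq> {b. c b \<noteq> \<zero>}" by blast
  then show "red c \<in> carrier (qr (free_mod Q B))"
    using c unfolding qr_simps free_mod_carrier red_def by (auto simp: q_simps intro: finite_subset)
qed (auto simp: red_def qr_simps free_mod_simps q_simps free_mod_carrier)

lemma red_surj:
  assumes c: "c \<in> carrier (free_mod Q B)"
  shows "\<exists>u \<in> carrier (free_mod S B). c = red u"
proof -
  have "\<exists>a. a \<in> carrier S \<and> c b = q a \<and> (c b = \<zero>\<^bsub>Q\<^esub> \<longrightarrow> a = \<zero>)" for b
  proof (cases "c b = \<zero>\<^bsub>Q\<^esub>")
    case True
    then show ?thesis using q_zero by (metis zero_closed)
  next
    case False
    then show ?thesis using q_surj[of "c b"] c by (auto simp: free_mod_carrier)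
  qed
  then obtain u where u: "\<And>b. u b \<in> carrier S" "\<And>b. c b = q (u b)" "\<And>b. c b = \<zero>\<^bsub>Q\<^esub> \<Longrightarrow> u b = \<zero>" by metis
  have "{b. u b \<noteq> \<zero>} \<subseteq> {b. c b \<noteq> \<zero>\<^bsub>Q\<^esub>}" using u(3) by auto
  then have "u \<in> carrier (free_mod S B)"
    using c u(1) unfolding free_mod_carrier by (auto intro: finite_subset)
  then show ?thesis using u(2) by (auto simp: red_def)
qed

lemma red_eq:
  assumes u: "u \<in> carrier (free_mod S B)" and v: "v \<in> carrier (free_mod S B)" and eq: "red u = red v"
  shows "cong_mod x (free_mod S B) u v"
proof -
  have c: "u b \<in> carrier S" "v b \<in> carrier S" for b using u v by (auto simp: free_mod_carrier)
  \<comment> \<open>Again the last conjunct secures finite support of the chosen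
    coordinates.\<close>
  have "\<exists>w. w \<in> carrier S \<and> u b = v b \<oplus> x \<otimes> w \<and> (u b = \<zero> \<and> v b = \<zero> \<longrightarrow> w = \<zero>)" for b
  proof (cases "u b = \<zero> \<and> v b = \<zero>")
    case True
    then show ?thesis by (intro exI[of _ \<zero>]) auto
  next
    case False
    have "q (u b) = q (v b)" using eq by (simp add: red_def fun_eq_iff)
    then obtain w where w: "w \<in> carrier S" "u b \<ominus> v b = w \<otimes> x" using q_eq[OF c] by blast
    have "u b = v b \<oplus> (u b \<ominus> v b)" using c[of b] by (simp add: a_minus_def a_lcomm r_neg)
    then show ?thesis using w False by (auto simp: m_comm)
  qed
  then obtain w where w: "\<And>b. w b \<in> carrier S" "\<And>b. u b = v b \<oplus> x \<otimes> w b"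
    "\<And>b. u b = \<zero> \<Longrightarrow> v b = \<zero> \<Longrightarrow> w b = \<zero>" by metis
  have "{b. w b \<noteq> \<zero>} \<subseteq> {b. u b \<noteq> \<zero>} \<union> {b. v b \<noteq> \<zero>}" using w(3) by auto
  then have "w \<in> carrier (free_mod S B)"
    using u v w(1) unfolding free_mod_carrier by (auto intro: finite_subset)
  then show ?thesis using w(2) unfolding cong_mod_def by (auto simp: free_mod_simps)
qed

lemma red_cong:
  assumes "v \<in> carrier (free_mod S B)" "cong_mod x (free_mod S B) u v"
  shows "red u = red v"
proof -
  have m: "module Q (free_mod Q B)" by (rule cring.free_mod_module[OF Q_cring])
  show ?thesis
    using cong_mod_killed[OF qr_module[OF m] lin_closed[OF lin_red assms(1)]
        lin_cong_mod[OF free_mod_module lin_red x_closed assms]] qr_killed[OF m] by (simp add: qr_simps)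
qed

section \<open>Lifting the standard resolution from S / (x) to S\<close>

context
  fixes M :: "('a set, 'm) module"
  assumes M: "module Q M"
begin

text \<open>Free over \<open>S\<close>, but on the bases of the standard resolution over
  \<open>Q\<close>, which \<open>red\<close> recovers modulo x.\<close>

abbreviation G :: "nat \<Rightarrow> ('a, ('m, 'a set) gen \<Rightarrow> 'a) module"
  where "G j \<equiv> free_mod S (res_basis Q M j)"

lemma Q_free: "module Q (free_mod Q B)"
  by (rule cring.free_mod_module[OF Q_cring])

lemma red_zero: "red \<zero>\<^bsub>free_mod S B\<^esub> = \<zero>\<^bsub>free_mod Q B\<^esub>"
  using lin_zero[OF free_mod_module qr_module[OF Q_free] lin_red, of B] by (simp add: qr_simps)

lemma red_closed: "c \<in> carrier (free_mod S B) \<Longrightarrow> red c \<in> carrier (free_mod Q B)"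
  using lin_closed[OF lin_red] by (simp add: qr_simps)

lemma ex_lifted_diff:
  "\<exists>d. lin S (G (Suc j)) (G j) d \<and> (\<forall>c \<in> carrier (G (Suc j)). res_diff Q M j (red c) = red (d c))"
proof (rule free_lift_exact[OF free_mod_module qr_module[OF Q_free] lin_red])
  show l: "lin S (G (Suc j)) (qr (free_mod Q (res_basis Q M j))) (\<lambda>c. res_diff Q M j (red c))"
    by (rule lin_comp[OF lin_red]) (rule iffD2[OF lin_qr lin_res_diff[OF M]])
  show "\<exists>u \<in> carrier (G j). res_diff Q M j (red c) = red u" if "c \<in> carrier (G (Suc j))" for c
    using red_surj lin_closed[OF l that] by (simp add: qr_simps)
qed

text \<open>The lifts are chosen separately in each degree, so two consecutive ones compose to zero
  only modulo x. This is why \<open>resol_mod\<close> asks for congruences.\<close>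

definition lifted_diff where
  "lifted_diff j = (SOME d. lin S (G (Suc j)) (G j) d
    \<and> (\<forall>c \<in> carrier (G (Suc j)). res_diff Q M j (red c) = red (d c)))"

lemma lifted_diff:
  "lin S (G (Suc j)) (G j) (lifted_diff j)"
  "c \<in> carrier (G (Suc j)) \<Longrightarrow> red (lifted_diff j c) = res_diff Q M j (red c)"
  using someI_ex[OF ex_lifted_diff, of j] by (auto simp: lifted_diff_def)

lemma resol_mod_lifted:
  "resol_mod S x (qr M) (res_basis Q M) lifted_diff (\<lambda>c. res_aug Q M (red c))"
  unfolding resol_mod_def
proof (intro conjI allI ballI impI)
  fix j show "lin S (G (Suc j)) (G j) (lifted_diff j)" by (rule lifted_diff(1))
next
  show "lin S (G 0) (qr M) (\<lambda>c. res_aug Q M (red c))"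
    by (rule lin_comp[OF lin_red]) (rule iffD2[OF lin_qr lin_res_aug[OF M]])
next
  fix m assume "m \<in> carrier (qr M)"
  then have m: "m \<in> carrier M" by (simp add: qr_simps)
  obtain c where "c \<in> carrier (G 0)" "basis_vec Q (Gen m) = red c" using red_surj[OF basis_vec_Gen[OF M m]] by blast
  then show "\<exists>c \<in> carrier (G 0). m = res_aug Q M (red c)" using res_aug_Gen[OF M m] by metis
next
  fix c assume c: "c \<in> carrier (G (Suc 0))"
  then show "res_aug Q M (red (lifted_diff 0 c)) = \<zero>\<^bsub>qr M\<^esub>"
    using res_aug_diff[OF M red_closed[OF c]] by (simp add: lifted_diff qr_simps)
next
  fix c assume c: "c \<in> carrier (G 0)" and "res_aug Q M (red c) = \<zero>\<^bsub>qr M\<^esub>"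
  then obtain v where v: "v \<in> carrier (free_mod Q (res_basis Q M (Suc 0)))" "red c = res_diff Q M 0 v"
    using res_aug_exact[OF M red_closed[OF c]] by (auto simp: qr_simps)
  then obtain u where u: "u \<in> carrier (G (Suc 0))" "v = red u" using red_surj by blast
  then have "red c = red (lifted_diff 0 u)" using v lifted_diff by simp
  then show "\<exists>u \<in> carrier (G (Suc 0)). cong_mod x (G 0) c (lifted_diff 0 u)"
    using red_eq[OF c lin_closed[OF lifted_diff(1) u(1)]] u(1) by blast
next
  fix j c assume c: "c \<in> carrier (G (Suc (Suc j)))"
  note dc = lin_closed[OF lifted_diff(1) c]
  have "red (lifted_diff j (lifted_diff (Suc j) c)) = red \<zero>\<^bsub>G j\<^esub>"
    using res_diff_diff[OF M red_closed[OF c]] by (simp add: lifted_diff(2) c dc red_zero)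
  then show "cong_mod x (G j) (lifted_diff j (lifted_diff (Suc j) c)) \<zero>\<^bsub>G j\<^esub>"
    using red_eq[OF lin_closed[OF lifted_diff(1) dc] abelian_monoid.zero_closed[OF abelian_group.axioms(1)[OF free_mod_abelian_group]]]
    by simp
next
  fix j c assume c: "c \<in> carrier (G (Suc j))" and z: "cong_mod x (G j) (lifted_diff j c) \<zero>\<^bsub>G j\<^esub>"
  have "red (lifted_diff j c) = red \<zero>\<^bsub>G j\<^esub>"
    by (rule red_cong[OF _ z]) (rule abelian_monoid.zero_closed[OF abelian_group.axioms(1)[OF free_mod_abelian_group]])
  then have "res_diff Q M j (red c) = \<zero>\<^bsub>free_mod Q (res_basis Q M j)\<^esub>"
    using c by (simp add: lifted_diff(2)[symmetric] red_zero)
  then obtain v where v: "v \<in> carrier (free_mod Q (res_basis Q M (Suc (Suc j))))" "red c = res_diff Q M (Suc j) v"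
    using res_diff_exact[OF M red_closed[OF c]] by blast
  then obtain u where u: "u \<in> carrier (G (Suc (Suc j)))" "v = red u" using red_surj by blast
  then have "red c = red (lifted_diff (Suc j) u)" using v lifted_diff by simp
  then show "\<exists>u \<in> carrier (G (Suc (Suc j))). cong_mod x (G (Suc j)) c (lifted_diff (Suc j) u)"
    using red_eq[OF c lin_closed[OF lifted_diff(1) u(1)]] u(1) by blast
qed

text \<open>Since x kills \<open>N\<close>, an S-linear map from \<open>G (Suc j)\<close> to
  \<open>N\<close> takes equal values on elements with equal reduction, and so descends to a
  Q-linear map. There the vanishing of Ext over \<open>Q\<close> applies, and composing with
  \<open>red\<close> returns to \<open>S\<close>.\<close>

lemma lifted_vanishing:
  fixes N :: "('a set, 'n) module"
  assumes N: "module Q N" and zero: "zero_module (Ext Q (Suc j) M N)"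
    and f: "lin S (G (Suc j)) (qr N) f"
    and fd: "\<And>c. c \<in> carrier (G (Suc (Suc j))) \<Longrightarrow> f (lifted_diff (Suc j) c) = \<zero>\<^bsub>qr N\<^esub>"
  shows "\<exists>g. lin S (G j) (qr N) g \<and> (\<forall>c \<in> carrier (G (Suc j)). f c = g (lifted_diff j c))"
proof -
  let ?Q = "free_mod Q (res_basis Q M (Suc j))"
  have f_cong: "f u = f v" if u: "u \<in> carrier (G (Suc j))" and v: "v \<in> carrier (G (Suc j))" and eq: "red u = red v" for u v
    using cong_mod_killed[OF qr_module[OF N] lin_closed[OF f v]
        lin_cong_mod[OF free_mod_module f x_closed v red_eq[OF u v eq]]] qr_killed[OF N] by (simp add: qr_simps)
  \<comment> \<open>An arbitrary section of \<open>red\<close>, in general not linear. Linearity of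
    f \<circ> l comes from \<open>f\<close> depending only on reductions.\<close>
  define l where "l c = (SOME u. u \<in> carrier (G (Suc j)) \<and> c = red u)" for c
  have l: "l c \<in> carrier (G (Suc j))" "red (l c) = c" if "c \<in> carrier ?Q" for c
  proof -
    have "\<exists>u. u \<in> carrier (G (Suc j)) \<and> c = red u" using red_surj[OF that] by blast
    then have "l c \<in> carrier (G (Suc j)) \<and> c = red (l c)" unfolding l_def by (rule someI_ex)
    then show "l c \<in> carrier (G (Suc j))" "red (l c) = c" by auto
  qed
  have fl: "f (l (red u)) = f u" if u: "u \<in> carrier (G (Suc j))" for u
    using f_cong[OF l(1) u l(2)] red_closed[OF u] by simp
  have "lin S (qr ?Q) (qr N) (\<lambda>c. f (l c))"
  proof (rule linI)
    fix c assume "c \<in> carrier (qr ?Q)"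
    then show "f (l c) \<in> carrier (qr N)" using l lin_closed[OF f] by (simp add: qr_simps)
  next
    interpret G: module S "G (Suc j)" by (rule free_mod_module)
    fix c c' assume "c \<in> carrier (qr ?Q)" "c' \<in> carrier (qr ?Q)"
    then have "c \<in> carrier ?Q" "c' \<in> carrier ?Q" by (simp_all add: qr_simps)
    note c = l[OF this(1)] l[OF this(2)]
    have "red (l c \<oplus>\<^bsub>G (Suc j)\<^esub> l c') = c \<oplus>\<^bsub>qr ?Q\<^esub> c'" using c lin_add[OF lin_red c(1,3)] by simp
    then show "f (l (c \<oplus>\<^bsub>qr ?Q\<^esub> c')) = f (l c) \<oplus>\<^bsub>qr N\<^esub> f (l c')"
      using fl[OF G.M.a_closed[OF c(1,3)]] lin_add[OF f c(1,3)] by simp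
  next
    interpret G: module S "G (Suc j)" by (rule free_mod_module)
    fix a c assume a: "a \<in> carrier S" and "c \<in> carrier (qr ?Q)"
    then have "c \<in> carrier ?Q" by (simp add: qr_simps)
    note c = l[OF this]
    have "red (a \<odot>\<^bsub>G (Suc j)\<^esub> l c) = a \<odot>\<^bsub>qr ?Q\<^esub> c" using a c lin_smult[OF lin_red a c(1)] by simp
    then show "f (l (a \<odot>\<^bsub>qr ?Q\<^esub> c)) = a \<odot>\<^bsub>qr N\<^esub> f (l c)"
      using fl[OF G.smult_closed[OF a c(1)]] lin_smult[OF f a c(1)] by simp
  qed
  then have "lin Q ?Q N (\<lambda>c. f (l c))" by (simp add: lin_qr)
  moreover have "f (l (res_diff Q M (Suc j) c)) = \<zero>\<^bsub>N\<^esub>"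
    if c: "c \<in> carrier (free_mod Q (res_basis Q M (Suc (Suc j))))" for c
  proof -
    obtain u where u: "u \<in> carrier (G (Suc (Suc j)))" "c = red u" using red_surj[OF c] by blast
    then show ?thesis
      using fl[OF lin_closed[OF lifted_diff(1) u(1)]] fd[OF u(1)] lifted_diff(2)[OF u(1)] by (simp add: qr_simps)
  qed
  ultimately obtain g where g: "lin Q (free_mod Q (res_basis Q M j)) N g"
    "\<And>c. c \<in> carrier ?Q \<Longrightarrow> f (l c) = g (res_diff Q M j c)"
    using Ext_zero_extend[OF M N zero] by metis
  have "lin S (G j) (qr N) (\<lambda>c. g (red c))"
    by (rule lin_comp[OF lin_red]) (simp add: lin_qr g(1))
  moreover have "f c = g (red (lifted_diff j c))" if c: "c \<in> carrier (G (Suc j))" for c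
    using fl[OF c] g(2)[OF red_closed[OF c]] lifted_diff(2)[OF c] by simp
  ultimately show ?thesis by blast
qed

end

end

section \<open>The iterated cone as a resolution modulo s 0\<close>

context ann_chain_module begin

text \<open>Degree 0 of each cone is degree 1 of the resolution before it, so the lowest
  differentials of successive stages are composable. Modulo s 0 they splice presentations of
  successive syzygies into one resolution.\<close>

abbreviation stage_basis where
  "stage_basis T p \<equiv> fst (snd ((cone_step ^^ p) T)) 0"

abbreviation stage_diff where
  "stage_diff T p \<equiv> snd (snd ((cone_step ^^ p) T)) 0"

text \<open>The other scalars may change sign from stage to stage, but s 0 does not, so all stages
  are reduced modulo the same element.\<close>

lemma resol_stages:
  assumes r: "resol s B d"
  shows "\<exists>s' B' d'. (cone_step ^^ p) (s, B, d) = (s', B', d') \<and> resol s' B' d' \<and> s' 0 = s 0"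
proof (induction p)
  case 0
  then show ?case using r by simp
next
  case (Suc p)
  then obtain s' B' d' where 1: "(cone_step ^^ p) (s, B, d) = (s', B', d')" "resol s' B' d'" "s' 0 = s 0"
    by blast
  then show ?case using resol_cone[OF 1(2) mult_lifts_lift_seq[OF 1(2)]] by (simp add: cone_step_eq)
qed

text \<open>The two directions of \<open>cone_kernel\<close> give the two halves: consecutive stage
  differentials compose to zero modulo s 0, and cycles modulo s 0 are boundaries. At the
  augmentation exactness holds even before reduction.\<close>

lemma resol_mod_stages:
  assumes r: "resol s B d" and a: "lin S (free_mod S (B 0)) M a"
    and "\<And>m. m \<in> carrier M \<Longrightarrow> \<exists>c \<in> Fr (B 0). m = a c"
    and "\<And>c. c \<in> Fr (B (Suc 0)) \<Longrightarrow> a (d 0 c) = \<zero>\<^bsub>M\<^esub>"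
    and "\<And>c. c \<in> Fr (B 0) \<Longrightarrow> a c = \<zero>\<^bsub>M\<^esub> \<Longrightarrow> \<exists>u \<in> Fr (B (Suc 0)). c = d 0 u"
  shows "resol_mod S (s 0) M (stage_basis (s, B, d)) (stage_diff (s, B, d)) a"
proof -
  interpret F: module S "free_mod S X" for X :: "'b set" by (rule free_mod_module)
  let ?B = "stage_basis (s, B, d)" and ?d = "stage_diff (s, B, d)"
  have s0: "s 0 \<in> carrier S" using resolD(1)[OF r] by simp
  have st: "\<exists>s' B' d'. resol s' B' d' \<and> s' 0 = s 0 \<and> ?B p = B' 0 \<and> ?d p = d' 0
    \<and> ?B (Suc p) = B' (Suc 0) \<and> ?d (Suc p) = cone_diff s' B' d' (lift_seq s' B' d') 0
    \<and> ?B (Suc (Suc p)) = cone_basis B' (Suc 0)" for p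
  proof -
    obtain s' B' d' where 1: "(cone_step ^^ p) (s, B, d) = (s', B', d')" "resol s' B' d'" "s' 0 = s 0"
      using resol_stages[OF r] by blast
    then show ?thesis by (intro exI[of _ s'] exI[of _ B'] exI[of _ d']) (simp add: cone_step_eq)
  qed
  show ?thesis unfolding resol_mod_def
  proof (intro conjI allI ballI impI)
    fix p
    obtain s' B' d' where "resol s' B' d'" "?B p = B' 0" "?d p = d' 0" "?B (Suc p) = B' (Suc 0)"
      using st[of p] by blast
    then show "lin S (free_mod S (?B (Suc p))) (free_mod S (?B p)) (?d p)"
      using resolD(2) by metis
  next
    show "lin S (free_mod S (?B 0)) M a" using a by simp
  next
    fix m assume "m \<in> carrier M"
    then show "\<exists>c \<in> Fr (?B 0). m = a c" using assms(3) by simp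
  next
    fix c assume "c \<in> Fr (?B (Suc 0))"
    then show "a (?d 0 c) = \<zero>\<^bsub>M\<^esub>" using assms(4) by (simp add: cone_step_eq)
  next
    fix c assume "c \<in> Fr (?B 0)" "a c = \<zero>\<^bsub>M\<^esub>"
    then show "\<exists>u \<in> Fr (?B (Suc 0)). cong_mod (s 0) (free_mod S (?B 0)) c (?d 0 u)"
      using assms(5)[of c] F.cong_mod_refl[OF s0] by (auto simp: cone_step_eq)
  next
    fix p c assume c: "c \<in> Fr (?B (Suc (Suc p)))"
    obtain s' B' d' where 1: "resol s' B' d'" "s' 0 = s 0" "?B p = B' 0" "?d p = d' 0"
      "?B (Suc p) = B' (Suc 0)" "?d (Suc p) = cone_diff s' B' d' (lift_seq s' B' d') 0"
      "?B (Suc (Suc p)) = cone_basis B' (Suc 0)"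
      using st[of p] by blast
    note h = mult_lifts_lift_seq[OF 1(1)]
    have dc: "?d (Suc p) c \<in> Fr (B' (Suc 0))"
      using lin_closed[OF cone_diff_lin[OF 1(1) h, of 0]] c 1 by simp
    then obtain u where u: "u \<in> Fr (B' 0)" "d' 0 (?d (Suc p) c) = s' 0 \<odot>\<^bsub>free_mod S (B' 0)\<^esub> u"
      using cone_kernel[OF 1(1) h dc] c 1 by auto
    then show "cong_mod (s 0) (free_mod S (?B p)) (?d p (?d (Suc p) c)) \<zero>\<^bsub>free_mod S (?B p)\<^esub>"
      using 1 s0 by (auto simp: cong_mod_def)
  next
    fix p c assume c: "c \<in> Fr (?B (Suc p))"
      and z: "cong_mod (s 0) (free_mod S (?B p)) (?d p c) \<zero>\<^bsub>free_mod S (?B p)\<^esub>"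
    obtain s' B' d' where 1: "resol s' B' d'" "s' 0 = s 0" "?B p = B' 0" "?d p = d' 0"
      "?B (Suc p) = B' (Suc 0)" "?d (Suc p) = cone_diff s' B' d' (lift_seq s' B' d') 0"
      "?B (Suc (Suc p)) = cone_basis B' (Suc 0)"
      using st[of p] by blast
    note h = mult_lifts_lift_seq[OF 1(1)]
    have c': "c \<in> Fr (B' (Suc 0))" using c 1 by simp
    obtain u where "u \<in> Fr (B' 0)" "d' 0 c = s' 0 \<odot>\<^bsub>free_mod S (B' 0)\<^esub> u"
      using z 1 s0 by (auto simp: cong_mod_def)
    then obtain v where "v \<in> Fr (cone_basis B' (Suc 0))" "c = cone_diff s' B' d' (lift_seq s' B' d') 0 v"
      using cone_kernel[OF 1(1) h c'] by blast
    then show "\<exists>u \<in> Fr (?B (Suc (Suc p))). cong_mod (s 0) (free_mod S (?B (Suc p))) c (?d (Suc p) u)"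
      using 1 F.cong_mod_refl[OF s0 c'] by auto
  qed
qed

text \<open>By \<open>cone_kernel\<close>, the elements on which \<open>ext_vanish\<close> wants
  \<open>f\<close> to be zero are the boundaries coming from the next stage. So
  \<open>ext_vanish\<close> at stage p is the vanishing of cohomology of the spliced resolution in
  degree p + 1.\<close>

lemma ext_vanish_stages:
  assumes r: "resol s B d"
    and ext: "\<And>f. lin S (free_mod S (stage_basis (s, B, d) (Suc p))) N f \<Longrightarrow>
      (\<And>c. c \<in> Fr (stage_basis (s, B, d) (Suc (Suc p))) \<Longrightarrow> f (stage_diff (s, B, d) (Suc p) c) = \<zero>\<^bsub>N\<^esub>) \<Longrightarrow>
      \<exists>g. lin S (free_mod S (stage_basis (s, B, d) p)) N g
        \<and> (\<forall>c \<in> Fr (stage_basis (s, B, d) (Suc p)). f c = g (stage_diff (s, B, d) p c))"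
  shows "ext_vanish ((cone_step ^^ p) (s, B, d))"
proof -
  obtain s' B' d' where 1: "(cone_step ^^ p) (s, B, d) = (s', B', d')" "resol s' B' d'" "s' 0 = s 0"
    using resol_stages[OF r] by blast
  note h = mult_lifts_lift_seq[OF 1(2)]
  show ?thesis unfolding 1(1) ext_vanish_def prod.case
  proof (intro allI impI, elim conjE)
    fix f assume f: "lin S (free_mod S (B' (Suc 0))) N f"
      and fz: "\<forall>c \<in> Fr (B' (Suc 0)). (\<exists>u \<in> Fr (B' 0). d' 0 c = s' 0 \<odot>\<^bsub>free_mod S (B' 0)\<^esub> u) \<longrightarrow> f c = \<zero>\<^bsub>N\<^esub>"
    have "f (cone_diff s' B' d' (lift_seq s' B' d') 0 c) = \<zero>\<^bsub>N\<^esub>" if c: "c \<in> Fr (cone_basis B' (Suc 0))" for c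
    proof -
      have dc: "cone_diff s' B' d' (lift_seq s' B' d') 0 c \<in> Fr (B' (Suc 0))"
        using lin_closed[OF cone_diff_lin[OF 1(2) h, of 0] c] by simp
      then show ?thesis using cone_kernel[OF 1(2) h dc] fz dc c by blast
    qed
    then show "\<exists>g. lin S (free_mod S (B' 0)) N g \<and> (\<forall>c \<in> Fr (B' (Suc 0)). f c = g (d' 0 c))"
      using ext[of f] f 1 by (simp add: cone_step_eq)
  qed
qed

end

section \<open>The edge map\<close>

lemma Ext_cocycles_iff:
  "f \<in> Ext_cocycles R M N i \<longleftrightarrow> f \<in> lin_maps R (free_mod R (res_basis R M i)) N
    \<and> (\<forall>c \<in> carrier (free_mod R (res_basis R M (Suc i))). f (res_diff R M i c) = \<zero>\<^bsub>N\<^esub>)"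
proof -
  have "Ext_codiff R M i f = \<zero>\<^bsub>Ext_cochain R M N (Suc i)\<^esub> \<longleftrightarrow>
    (\<forall>c \<in> carrier (free_mod R (res_basis R M (Suc i))). f (res_diff R M i c) = \<zero>\<^bsub>N\<^esub>)"
    unfolding Ext_codiff_def Ext_cochain_def Hom_mod_simps res_mod_def
    by (auto simp: fun_eq_iff restrict_def)
  then show ?thesis by (simp add: Ext_cocycles_def Ext_cochain_def Hom_mod_simps res_mod_def)
qed

lemma Ext_cocycles_submodule:
  assumes M: "module R M" and N: "module R N"
  shows "submodule (Ext_cocycles R M N i) R (Ext_cochain R M N i)"
proof -
  interpret M: module R M by (rule M)
  interpret N: module R N by (rule N)
  interpret C: module R "Ext_cochain R M N i"
    unfolding Ext_cochain_def res_mod_def by (rule Hom_mod_module[OF M.R.free_mod_module N])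
  note d = lin_closed[OF lin_res_diff[OF M]]
  have sub: "Ext_cocycles R M N i \<subseteq> carrier (Ext_cochain R M N i)" by (auto simp: Ext_cocycles_def)
  have smult: "a \<odot>\<^bsub>Ext_cochain R M N i\<^esub> f \<in> Ext_cocycles R M N i"
    if a: "a \<in> carrier R" and f: "f \<in> Ext_cocycles R M N i" for a f
  proof -
    have "a \<odot>\<^bsub>Ext_cochain R M N i\<^esub> f \<in> carrier (Ext_cochain R M N i)"
      using a f sub by (intro C.smult_closed) auto
    then show ?thesis
      using a f d by (simp add: Ext_cocycles_iff) (simp add: Ext_cochain_def Hom_mod_simps res_mod_def)
  qed
  show ?thesis
  proof (rule C.submoduleI[OF sub _ _ _ smult])
    show "\<zero>\<^bsub>Ext_cochain R M N i\<^esub> \<in> Ext_cocycles R M N i"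
      using d lin_restrict[OF M.R.free_mod_module lin_const_zero[OF N]] by (simp add: Ext_cocycles_iff) (simp add: Ext_cochain_def Hom_mod_simps res_mod_def)
  next
    fix f assume f: "f \<in> Ext_cocycles R M N i"
    then have "\<ominus>\<^bsub>Ext_cochain R M N i\<^esub> f = \<ominus>\<^bsub>R\<^esub> \<one>\<^bsub>R\<^esub> \<odot>\<^bsub>Ext_cochain R M N i\<^esub> f"
      using sub by (subst C.smult_l_minus) auto
    then show "\<ominus>\<^bsub>Ext_cochain R M N i\<^esub> f \<in> Ext_cocycles R M N i" using smult f by simp
  next
    fix f g assume f: "f \<in> Ext_cocycles R M N i" and g: "g \<in> Ext_cocycles R M N i"
    have "f \<oplus>\<^bsub>Ext_cochain R M N i\<^esub> g \<in> carrier (Ext_cochain R M N i)"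
      using f g sub by (intro C.M.a_closed) auto
    then show "f \<oplus>\<^bsub>Ext_cochain R M N i\<^esub> g \<in> Ext_cocycles R M N i"
      using f g d by (simp add: Ext_cocycles_iff) (simp add: Ext_cochain_def Hom_mod_simps res_mod_def)
  qed
qed

lemma Ext_coboundaries_subset:
  assumes M: "module R M" and N: "module R N"
  shows "Ext_coboundaries R M N i \<subseteq> Ext_cocycles R M N i"
proof (cases i)
  case 0
  show ?thesis
    using subgroup.one_closed[OF submodule.axioms(1)[OF Ext_cocycles_submodule[OF M N, of 0]]] 0 by simp
next
  case (Suc k)
  interpret M: module R M by (rule M)
  interpret N: module R N by (rule N)
  interpret F: module R "free_mod R X" for X by (rule M.R.free_mod_module)
  note d = lin_res_diff[OF M]
  have "Ext_codiff R M k g \<in> Ext_cocycles R M N (Suc k)" if "g \<in> carrier (Ext_cochain R M N k)" for g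
  proof -
    have g: "lin R (free_mod R (res_basis R M k)) N g"
      using that by (simp add: Ext_cochain_def Hom_mod_simps lin_maps_iff res_mod_def)
    show ?thesis
      using lin_restrict[OF F.module_axioms lin_comp[OF d g]] lin_closed[OF d] res_diff_diff[OF M]
        lin_zero[OF F.module_axioms N g]
      by (simp add: Ext_cocycles_iff Ext_codiff_def res_mod_def)
  qed
  then show ?thesis using Suc by auto
qed

section \<open>The edge map on the standard resolution\<close>

locale std_resolution = ann_chain_module S inl inr N
  for S :: "('a, 'z) ring_scheme" (structure) and inl inr :: "('m, 'a) gen \<Rightarrow> ('m, 'a) gen" and N :: "('a, 'n) module" +
  fixes M :: "('a, 'm) module" and s :: "nat \<Rightarrow> 'a"
  assumes M: "module S M" and ann_chain_s: "ann_chain s" and kills_N_s: "kills_N s"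
    and s_M: "\<And>m. m \<in> carrier M \<Longrightarrow> s 0 \<odot>\<^bsub>M\<^esub> m = \<zero>\<^bsub>M\<^esub>"
begin

interpretation N: module S N by (rule N)
interpretation M: module S M by (rule M)
interpretation F: module S "free_mod S X" for X :: "('m, 'a) gen set" by (rule free_mod_module)

abbreviation B where "B \<equiv> res_basis S M"
abbreviation d where "d \<equiv> res_diff S M"
abbreviation e where "e \<equiv> lift_seq s B d"

lemma resol_std: "resol s B d"
  unfolding resol_def
proof (intro conjI allI ballI impI)
  fix c assume c: "c \<in> Fr (B 0)"
  have "res_aug S M (s 0 \<odot>\<^bsub>free_mod S (B 0)\<^esub> c) = \<zero>\<^bsub>M\<^esub>"
    using lin_smult[OF lin_res_aug[OF M] ann_chain_closed[OF ann_chain_s] c] s_M[OF lin_closed[OF lin_res_aug[OF M] c]]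
    by simp
  moreover have "s 0 \<odot>\<^bsub>free_mod S (B 0)\<^esub> c \<in> Fr (B 0)" using c ann_chain_s by (intro F.smult_closed) auto
  ultimately show "\<exists>c' \<in> Fr (B (Suc 0)). d 0 c' = s 0 \<odot>\<^bsub>free_mod S (B 0)\<^esub> c"
    using res_aug_exact[OF M] by metis
qed (rule ann_chain_s lin_res_diff[OF M] res_diff_diff[OF M] res_diff_exact[OF M]; assumption)+

lemmas mult_lifts_e = mult_lifts_lift_seq[OF resol_std]

lemma aug_closed: "c \<in> Fr (B 0) \<Longrightarrow> res_aug S M c \<in> carrier M"
  by (rule lin_closed[OF lin_res_aug[OF M]])

lemma resol_mod_std:
  "resol_mod S (s 0) M (stage_basis (s, B, d)) (stage_diff (s, B, d)) (res_aug S M)"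
proof (rule resol_mod_stages[OF resol_std lin_res_aug[OF M] _ res_aug_diff[OF M] res_aug_exact[OF M]])
  fix m assume "m \<in> carrier M"
  then show "\<exists>c \<in> Fr (B 0). m = res_aug S M c" using res_aug_Gen[OF M] basis_vec_Gen[OF M] by metis
qed

text \<open>
  Following \<open>m\<close> up the resolution along \<open>e\<close> gives a class in degree \<open>i\<close> on which the cocycles of
  degree \<open>i\<close> are evaluated; this is the edge map of the change of rings spectral sequence.
\<close>

definition edge :: "nat \<Rightarrow> ((('m, 'a) gen \<Rightarrow> 'a) \<Rightarrow> 'n) \<Rightarrow> 'm \<Rightarrow> 'n"
  where "edge i f = (\<lambda>m \<in> carrier M. f (e i (basis_vec S (Gen m))))"

lemma cocycleD:
  assumes "f \<in> Ext_cocycles S M N i"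
  shows "lin S (free_mod S (B i)) N f" "f \<in> extensional (Fr (B i))"
    "c \<in> Fr (B (Suc i)) \<Longrightarrow> f (d i c) = \<zero>\<^bsub>N\<^esub>"
  using assms by (auto simp: Ext_cocycles_iff lin_maps_iff)

text \<open>\<open>edge\<close> uses the preimage of m given by \<open>Gen m\<close>, which is not
  additive in m. Any other preimage differs from it by some d 0 v, and f \<circ> e i vanishes on
  these. Linearity of \<open>edge\<close> rests on this freedom of choice.\<close>

lemma edge_aug:
  assumes f: "f \<in> Ext_cocycles S M N i" and c: "c \<in> Fr (B 0)"
  shows "edge i f (res_aug S M c) = f (e i c)"
proof -
  note \<phi> = lin_comp[OF mult_liftsD(1)[OF mult_lifts_e, of i] cocycleD(1)[OF f]] and m = aug_closed[OF c]
  note c0 = basis_vec_Gen[OF M m] and a = lin_res_aug[OF M]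
  let ?c0 = "basis_vec S (Gen (res_aug S M c))"
  have "res_aug S M (c \<ominus>\<^bsub>free_mod S (B 0)\<^esub> ?c0) = \<zero>\<^bsub>M\<^esub>"
    unfolding a_minus_def using lin_add[OF a c F.M.a_inv_closed[OF c0]] lin_neg[OF F.module_axioms M a c0]
      res_aug_Gen[OF M m] M.M.r_neg[OF m] by simp
  then obtain v where v: "v \<in> Fr (B (Suc 0))" "c \<ominus>\<^bsub>free_mod S (B 0)\<^esub> ?c0 = d 0 v"
    using res_aug_exact[OF M F.M.minus_closed[OF c c0]] by blast
  have "c = ?c0 \<oplus>\<^bsub>free_mod S (B 0)\<^esub> d 0 v" using F.eq_plus_minus[OF c c0] v(2) by simp
  then have "f (e i c) = f (e i ?c0) \<oplus>\<^bsub>N\<^esub> f (e i (d 0 v))"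
    using lin_add[OF \<phi> c0 lin_closed[OF lin_res_diff[OF M] v(1)]] by simp
  moreover have "f (e i (d 0 v)) = \<zero>\<^bsub>N\<^esub>"
    by (rule cocycle_mult_lifts_boundary[OF resol_std mult_lifts_e kills_N_s v(1) cocycleD(1,3)[OF f]])
  ultimately show ?thesis using lin_closed[OF \<phi> c0] m by (simp add: edge_def)
qed

lemma edge_closed:
  assumes f: "f \<in> Ext_cocycles S M N i"
  shows "edge i f \<in> lin_maps S M N"
  unfolding lin_maps_iff
proof (intro conjI linI)
  note \<phi> = lin_comp[OF mult_liftsD(1)[OF mult_lifts_e, of i] cocycleD(1)[OF f]] and a = lin_res_aug[OF M]
  show "edge i f \<in> extensional (carrier M)" by (simp add: edge_def)
  have ex: "\<exists>c \<in> Fr (B 0). m = res_aug S M c" if "m \<in> carrier M" for m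
    using res_aug_Gen[OF M that] basis_vec_Gen[OF M that] by metis
  {
    fix m assume "m \<in> carrier M"
    then show "edge i f m \<in> carrier N" using ex edge_aug[OF f] lin_closed[OF \<phi>] by force
  next
    fix m m' assume "m \<in> carrier M" "m' \<in> carrier M"
    then obtain c c' where c: "c \<in> Fr (B 0)" "m = res_aug S M c" "c' \<in> Fr (B 0)" "m' = res_aug S M c'"
      using ex by blast
    show "edge i f (m \<oplus>\<^bsub>M\<^esub> m') = edge i f m \<oplus>\<^bsub>N\<^esub> edge i f m'"
      unfolding c(2,4) lin_add[OF a c(1,3), symmetric]
      using edge_aug[OF f] c(1,3) lin_add[OF \<phi> c(1,3)] F.M.a_closed[OF c(1,3)] by simp
  next
    fix b m assume b: "b \<in> carrier S" and "m \<in> carrier M"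
    then obtain c where c: "c \<in> Fr (B 0)" "m = res_aug S M c" using ex by blast
    show "edge i f (b \<odot>\<^bsub>M\<^esub> m) = b \<odot>\<^bsub>N\<^esub> edge i f m"
      unfolding c(2) lin_smult[OF a b c(1), symmetric]
      using edge_aug[OF f] c(1) lin_smult[OF \<phi> b c(1)] F.smult_closed[OF b c(1)] by simp
  }
qed

lemma edge_zero_iff:
  assumes f: "f \<in> Ext_cocycles S M N i"
  shows "edge i f = \<zero>\<^bsub>Hom_mod S M N\<^esub> \<longleftrightarrow> (\<forall>c \<in> Fr (B 0). f (e i c) = \<zero>\<^bsub>N\<^esub>)"
proof
  assume z: "edge i f = \<zero>\<^bsub>Hom_mod S M N\<^esub>"
  show "\<forall>c \<in> Fr (B 0). f (e i c) = \<zero>\<^bsub>N\<^esub>"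
    using edge_aug[OF f] aug_closed by (simp add: z Hom_mod_simps)
next
  assume "\<forall>c \<in> Fr (B 0). f (e i c) = \<zero>\<^bsub>N\<^esub>"
  then show "edge i f = \<zero>\<^bsub>Hom_mod S M N\<^esub>"
    unfolding edge_def Hom_mod_simps using basis_vec_Gen[OF M] by (intro restrict_ext) blast
qed

text \<open>If f = g \<circ> d k, then f (e (Suc k) c) = s k g (e k c) = 0 because s k kills
  \<open>N\<close>; the other direction is \<open>coboundary_if_zero_on_lifts\<close>. Degree 0 is
  separate: \<open>e 0\<close> is the identity, and zero is the only coboundary.\<close>

lemma edge_kernel:
  assumes ext_vanish: "\<And>p. p < i \<Longrightarrow> ext_vanish ((cone_step ^^ p) (s, B, d))" and f: "f \<in> Ext_cocycles S M N i"
  shows "edge i f = \<zero>\<^bsub>Hom_mod S M N\<^esub> \<longleftrightarrow> f \<in> Ext_coboundaries S M N i"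
proof (cases i)
  case 0
  have "f c = \<zero>\<^bsub>N\<^esub>" if "f = (\<lambda>u \<in> Fr (B 0). \<zero>\<^bsub>N\<^esub>)" "c \<in> Fr (B 0)" for c
    using that by simp
  moreover have "f = (\<lambda>u \<in> Fr (B 0). \<zero>\<^bsub>N\<^esub>)" if "\<forall>c \<in> Fr (B 0). f c = \<zero>\<^bsub>N\<^esub>"
    using cocycleD(2)[OF f] that unfolding 0 by (intro extensionalityI[of _ "Fr (B 0)"]) auto
  ultimately have "(\<forall>c \<in> Fr (B 0). f c = \<zero>\<^bsub>N\<^esub>) \<longleftrightarrow> f = (\<lambda>u \<in> Fr (B 0). \<zero>\<^bsub>N\<^esub>)" by blast
  moreover have "(\<forall>c \<in> Fr (B 0). f (e 0 c) = \<zero>\<^bsub>N\<^esub>) \<longleftrightarrow> (\<forall>c \<in> Fr (B 0). f c = \<zero>\<^bsub>N\<^esub>)"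
    using mult_liftsD(2)[OF mult_lifts_e] by metis
  ultimately show ?thesis using edge_zero_iff[OF f] unfolding 0
    by (simp only: Ext_coboundaries.simps(1) Ext_cochain_def Hom_mod_simps res_mod_def singleton_iff)
next
  case (Suc k)
  note f' = cocycleD[OF f, unfolded Suc]
  have "(\<forall>c \<in> Fr (B 0). f (e (Suc k) c) = \<zero>\<^bsub>N\<^esub>) \<longleftrightarrow> f \<in> Ext_coboundaries S M N (Suc k)"
  proof
    assume z: "\<forall>c \<in> Fr (B 0). f (e (Suc k) c) = \<zero>\<^bsub>N\<^esub>"
    have "\<forall>p \<le> k. ext_vanish ((cone_step ^^ p) (s, B, d))" using ext_vanish Suc by simp
    then obtain h where h: "lin S (free_mod S (B k)) N h" "\<forall>c \<in> Fr (B (Suc k)). f c = h (d k c)"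
      using coboundary_if_zero_on_lifts[OF resol_std kills_N_s _ f'(1,3)] z by blast
    have "f = Ext_codiff S M k (restrict h (Fr (B k)))"
    proof (rule extensionalityI[OF f'(2)])
      fix c assume "c \<in> Fr (B (Suc k))"
      then show "f c = Ext_codiff S M k (restrict h (Fr (B k))) c"
        using h(2) lin_closed[OF lin_res_diff[OF M]] by (simp add: Ext_codiff_def res_mod_def)
    qed (simp add: Ext_codiff_def res_mod_def)
    moreover have "restrict h (Fr (B k)) \<in> carrier (Ext_cochain S M N k)"
      using lin_restrict[OF F.module_axioms h(1)] by (simp add: Ext_cochain_def Hom_mod_simps res_mod_def)
    ultimately show "f \<in> Ext_coboundaries S M N (Suc k)" by simp
  next
    assume "f \<in> Ext_coboundaries S M N (Suc k)"
    then obtain g where g: "lin S (free_mod S (B k)) N g" "f = Ext_codiff S M k g"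
      by (auto simp: Ext_cochain_def Hom_mod_simps res_mod_def lin_maps_iff)
    show "\<forall>c \<in> Fr (B 0). f (e (Suc k) c) = \<zero>\<^bsub>N\<^esub>"
    proof
      fix c assume c: "c \<in> Fr (B 0)"
      note ec = lin_closed[OF mult_liftsD(1)[OF mult_lifts_e] c]
      have "f (e (Suc k) c) = g (s k \<odot>\<^bsub>free_mod S (B k)\<^esub> e k c)"
        using ec mult_liftsD(3)[OF mult_lifts_e c] by (simp add: g(2) Ext_codiff_def res_mod_def)
      also have "\<dots> = \<zero>\<^bsub>N\<^esub>"
        using lin_smult[OF g(1) ann_chain_closed[OF ann_chain_s] ec] kills_N_s lin_closed[OF g(1) ec] by (simp add: kills_N_def)
      finally show "f (e (Suc k) c) = \<zero>\<^bsub>N\<^esub>" .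
    qed
  qed
  then show ?thesis using edge_zero_iff[OF f] unfolding Suc by simp
qed

text \<open>The bound p \<le> i, against p < i for the kernel, arises because a preimage is found by
  injectivity for the cone, whose stages are shifted by one. Together the stages stand for Ext in
  degrees 1 to i + 1.\<close>

lemma edge_surj:
  assumes ext_vanish: "\<And>p. p \<le> i \<Longrightarrow> ext_vanish ((cone_step ^^ p) (s, B, d))" and h: "h \<in> lin_maps S M N"
  shows "\<exists>f \<in> Ext_cocycles S M N i. h = edge i f"
proof -
  note a = lin_res_aug[OF M] and d = lin_res_diff[OF M]
  have h': "lin S M N h" "h \<in> extensional (carrier M)" using h by (auto simp: lin_maps_iff)
  let ?\<phi> = "\<lambda>c. h (res_aug S M c)"
  note \<phi> = lin_comp[OF a h'(1)]
  have \<phi>d: "?\<phi> (d 0 c) = \<zero>\<^bsub>N\<^esub>" if "c \<in> Fr (B (Suc 0))" for c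
    using res_aug_diff[OF M that] lin_zero[OF M N h'(1)] by simp
  have "\<exists>f. lin S (free_mod S (B i)) N f \<and> (\<forall>c \<in> Fr (B (Suc i)). f (d i c) = \<zero>\<^bsub>N\<^esub>)
    \<and> (\<forall>c \<in> Fr (B 0). f (e i c) = ?\<phi> c)"
  proof (cases i)
    case 0
    then show ?thesis using \<phi> \<phi>d mult_liftsD(2)[OF mult_lifts_e] by (intro exI[of _ ?\<phi>]) simp
  next
    case (Suc k)
    then show ?thesis using ex_cocycle_on_lifts[OF resol_std kills_N_s _ \<phi> \<phi>d, of k] ext_vanish by simp
  qed
  then obtain f where f: "lin S (free_mod S (B i)) N f" "\<forall>c \<in> Fr (B (Suc i)). f (d i c) = \<zero>\<^bsub>N\<^esub>"
    "\<forall>c \<in> Fr (B 0). f (e i c) = ?\<phi> c" by blast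
  let ?f = "restrict f (Fr (B i))"
  have "?f \<in> Ext_cocycles S M N i"
    using lin_restrict[OF F.module_axioms f(1)] f(2) lin_closed[OF d] by (simp add: Ext_cocycles_iff)
  moreover have "h = edge i ?f"
  proof (rule extensionalityI[OF h'(2)])
    fix m assume m: "m \<in> carrier M"
    show "h m = edge i ?f m"
      using f(3) basis_vec_Gen[OF M m] res_aug_Gen[OF M m] lin_closed[OF mult_liftsD(1)[OF mult_lifts_e] basis_vec_Gen[OF M m]] m
      by (simp add: edge_def)
  qed (simp add: edge_def)
  ultimately show ?thesis by blast
qed

lemma Ext_mod_iso_Hom:
  assumes ext_vanish: "\<And>p. p \<le> i \<Longrightarrow> ext_vanish ((cone_step ^^ p) (s, B, d))"
  shows "mod_iso S (Ext S i M N) (Hom_mod S M N)"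
  unfolding Ext_def
proof (rule subquotient_mod_iso[where \<theta> = "edge i"])
  let ?C = "Ext_cochain S M N i"
  show "module S ?C" unfolding Ext_cochain_def res_mod_def by (rule Hom_mod_module[OF F.module_axioms N])
  show "module S (Hom_mod S M N)" by (rule Hom_mod_module[OF M N])
  show "submodule (Ext_cocycles S M N i) S ?C" by (rule Ext_cocycles_submodule[OF M N])
  show "Ext_coboundaries S M N i \<subseteq> Ext_cocycles S M N i" by (rule Ext_coboundaries_subset[OF M N])
  note ec = lin_closed[OF mult_liftsD(1)[OF mult_lifts_e, of i] basis_vec_Gen[OF M]]
  fix f assume f: "f \<in> Ext_cocycles S M N i"
  show "edge i f \<in> carrier (Hom_mod S M N)" using edge_closed[OF f] by (simp add: Hom_mod_simps)
  show "edge i f = \<zero>\<^bsub>Hom_mod S M N\<^esub> \<longleftrightarrow> f \<in> Ext_coboundaries S M N i"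
    using edge_kernel[OF ext_vanish f] by simp
  show "edge i (f \<oplus>\<^bsub>?C\<^esub> g) = edge i f \<oplus>\<^bsub>Hom_mod S M N\<^esub> edge i g" if "g \<in> Ext_cocycles S M N i" for g
    using ec by (auto simp: edge_def Ext_cochain_def Hom_mod_simps res_mod_def fun_eq_iff)
  show "edge i (b \<odot>\<^bsub>?C\<^esub> f) = b \<odot>\<^bsub>Hom_mod S M N\<^esub> edge i f" if "b \<in> carrier S" for b
    using ec by (auto simp: edge_def Ext_cochain_def Hom_mod_simps res_mod_def fun_eq_iff)
next
  fix h assume "h \<in> carrier (Hom_mod S M N)"
  then show "\<exists>f \<in> Ext_cocycles S M N i. h = edge i f" using edge_surj[OF ext_vanish] by (simp add: Hom_mod_simps)
qed

end

section \<open>Application to the chain x, y, x, ..\<close>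

lemma (in principal_quotient) Ext_mod_iso_Hom_quot:
  fixes M :: "('a set, 'm) module" and N :: "('a set, 'n) module"
  assumes y: "y \<in> carrier S" and nontriv: "\<one> \<noteq> \<zero>"
    and ann: "annihilator S x = PIdl y" "annihilator S y = PIdl x"
    and M: "module Q M" and N: "module Q N"
    and yN: "\<And>v. v \<in> carrier N \<Longrightarrow> y \<odot>\<^bsub>qr N\<^esub> v = \<zero>\<^bsub>N\<^esub>"
    and zero: "\<And>j. j \<le> i \<Longrightarrow> zero_module (Ext Q (Suc j) M N)"
  shows "mod_iso S (Ext S i (qr M) (qr N)) (Hom_mod S (qr M) (qr N))"
proof -
  \<comment> \<open>All bases must have the type of those of the standard resolution, so the two
    copies are made within \<open>gen\<close> by tagging with \<one> and \<zero>. These tags differ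
    because \<open>S\<close> is nontrivial; the tagged terms are mere labels and stand for no
    syzygies.\<close>
  let ?inl = "\<lambda>g :: ('m, 'a) gen. Syz {|(g, \<one>)|}" and ?inr = "\<lambda>g :: ('m, 'a) gen. Syz {|(g, \<zero>)|}"
  let ?s = "\<lambda>j. if even j then x else y"
  have Syz_eq: "Syz {|(g, a)|} = Syz {|(g', a')|} \<longleftrightarrow> g = g' \<and> a = a'" for g g' :: "('m, 'a) gen" and a a'
    by simp
  interpret E: ann_chain_module S ?inl ?inr "qr N"
  proof (rule ann_chain_module.intro[OF is_cring], rule ann_chain_module_axioms.intro)
    show "inj ?inl" "inj ?inr" "?inl b \<noteq> ?inr b'" for b b'
      using nontriv unfolding inj_def Syz_eq by blast+
    show "module S (qr N)" by (rule qr_module[OF N])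
  qed
  have xN: "x \<odot>\<^bsub>qr N\<^esub> v = \<zero>\<^bsub>N\<^esub>" if "v \<in> carrier N" for v
    using qr_killed[OF N that] by (simp add: qr_simps)
  interpret E: std_resolution S ?inl ?inr "qr N" "qr M" ?s
  proof (rule std_resolution.intro[OF E.ann_chain_module_axioms], rule std_resolution_axioms.intro)
    show "module S (qr M)" by (rule qr_module[OF M])
    show "E.ann_chain ?s" using ann y by (auto simp: E.ann_chain_def)
    show "E.kills_N ?s" using xN yN by (auto simp: E.kills_N_def qr_simps(1,2))
    show "?s 0 \<odot>\<^bsub>qr M\<^esub> m = \<zero>\<^bsub>qr M\<^esub>" if "m \<in> carrier (qr M)" for m
      using qr_killed[OF M] that by (simp add: qr_simps(1))
  qed
  show ?thesis
  proof (rule E.Ext_mod_iso_Hom, rule E.ext_vanish_stages[OF E.resol_std])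
    fix p f assume p: "p \<le> i"
      and f: "lin S (free_mod S (E.stage_basis (?s, E.B, E.d) (Suc p))) (qr N) f"
        "\<And>c. c \<in> E.Fr (E.stage_basis (?s, E.B, E.d) (Suc (Suc p))) \<Longrightarrow>
          f (E.stage_diff (?s, E.B, E.d) (Suc p) c) = \<zero>\<^bsub>qr N\<^esub>"
    have r: "resol_mod S x (qr M) (E.stage_basis (?s, E.B, E.d)) (E.stage_diff (?s, E.B, E.d)) (res_aug S (qr M))"
      using E.resol_mod_std by simp
    show "\<exists>g. lin S (free_mod S (E.stage_basis (?s, E.B, E.d) p)) (qr N) g
      \<and> (\<forall>c \<in> E.Fr (E.stage_basis (?s, E.B, E.d) (Suc p)). f c = g (E.stage_diff (?s, E.B, E.d) p c))"
    \<comment> \<open>The spliced cones and the lifted standard resolution over \<open>Q\<close> are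
      both resolutions modulo x of the same module, so vanishing passes from the second to the
      first.\<close>
    proof (rule comparison_vanishing[where B = "E.stage_basis (?s, E.B, E.d)" and d = "E.stage_diff (?s, E.B, E.d)"
          and j = p and f = f and B' = "res_basis Q M" and d' = "lifted_diff M",
          OF x_closed qr_module[OF M] qr_module[OF N] _ r resol_mod_lifted[OF M]])
      show "x \<odot>\<^bsub>qr N\<^esub> v = \<zero>\<^bsub>qr N\<^esub>" if "v \<in> carrier (qr N)" for v
        using qr_killed[OF N] that by (simp add: qr_simps(1))
    qed (rule lifted_vanishing[OF M N zero[OF p]] f; assumption)+
  qed
qed

text \<open>The identity map is a nonzero element.\<close>

lemma Hom_mod_nonzero:
  assumes "module R M" "\<not> zero_module M"
  shows "\<not> zero_module (Hom_mod R M M)"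
proof
  interpret module R M by fact
  assume "zero_module (Hom_mod R M M)"
  moreover have "restrict (\<lambda>u. u) (carrier M) \<in> lin_maps R M M" by (rule lin_restrict[OF assms(1) lin_id])
  ultimately have "restrict (\<lambda>u. u) (carrier M) = (\<lambda>u \<in> carrier M. \<zero>\<^bsub>M\<^esub>)"
    by (simp add: zero_module_def Hom_mod_simps)
  then have "u = \<zero>\<^bsub>M\<^esub>" if "u \<in> carrier M" for u using that by (metis restrict_apply')
  then show False using assms(2) M.zero_closed unfolding zero_module_def by blast
qed

lemma mod_iso_nonzero:
  assumes "mod_iso R A C" "\<not> zero_module C" "\<zero>\<^bsub>C\<^esub> \<in> carrier C"
  shows "\<not> zero_module A"
proof
  assume A: "zero_module A"
  obtain f where "bij_betw f (carrier A) (carrier C)" using assms(1) by (auto simp: mod_iso_def)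
  then have "carrier C = {f \<zero>\<^bsub>A\<^esub>}" using A by (simp add: zero_module_def bij_betw_def)
  then show False using assms(2,3) by (simp add: zero_module_def)
qed

theorem corollary2p5:
  fixes S :: "'s ring" and x y :: 's and I :: "'s set" and R :: "'s set ring"
  assumes "noetherian_local_ring S" and "exact_zero_divisors S x y"
    and "I = PIdl\<^bsub>S\<^esub> x" and "R = S Quot I"
  shows "(\<forall>(M :: ('s set, 'm) module) (N :: ('s set, 'n) module) (n :: nat).
            module R M \<and> module R N \<and>
            (\<forall>v \<in> carrier N. y \<odot>\<^bsub>quot_restrict S I N\<^esub> v = \<zero>\<^bsub>N\<^esub>) \<and>
            2 \<le> n \<and> (\<forall>i. 1 \<le> i \<and> i \<le> n \<longrightarrow> zero_module (Ext R i M N)) \<longrightarrow>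
            (\<forall>i<n. mod_iso S
                     (Ext S i (quot_restrict S I M) (quot_restrict S I N))
                     (Hom_mod S (quot_restrict S I M) (quot_restrict S I N))))
       \<and> (\<forall>(M :: ('s set, 'm) module) (n :: nat).
            module R M \<and> \<not> zero_module M \<and>
            (\<forall>v \<in> carrier M. y \<odot>\<^bsub>quot_restrict S I M\<^esub> v = \<zero>\<^bsub>M\<^esub>) \<and>
            2 \<le> n \<and> (\<forall>i. 1 \<le> i \<and> i \<le> n \<longrightarrow> zero_module (Ext R i M M)) \<longrightarrow>
            (\<forall>i. 0 < i \<and> i < n \<longrightarrow>
               \<not> zero_module (Ext S i (quot_restrict S I M) (quot_restrict S I M))))"
proof -
  interpret S: cring S using assms(1) by (simp add: noetherian_local_ring_def)
  have xy: "x \<in> carrier S" "y \<in> carrier S" "x \<noteq> \<zero>\<^bsub>S\<^esub>"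
    "annihilator S x = PIdl\<^bsub>S\<^esub> y" "annihilator S y = PIdl\<^bsub>S\<^esub> x"
    using assms(2) by (auto simp: exact_zero_divisors_def)
  interpret principal_quotient S x by unfold_locales (rule xy(1))
  \<comment> \<open>From \<one> = \<zero> it would follow that x = \<zero>.\<close>
  have "\<one>\<^bsub>S\<^esub> \<noteq> \<zero>\<^bsub>S\<^esub>" using xy(1,3) S.l_one S.l_null by metis
  note iso = Ext_mod_iso_Hom_quot[OF xy(2) this xy(4,5)]
  \<comment> \<open>The element types of \<open>M\<close> and \<open>N\<close> are local to this
    fact, so that it can be instantiated once with two types and once with N = M. The hypothesis in
    degrees 1 to i + 1 is available because i < n.\<close>
  have 1: "mod_iso S (Ext S i (qr M) (qr N)) (Hom_mod S (qr M) (qr N))"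
    if "module R M" "module R N" "\<forall>v \<in> carrier N. y \<odot>\<^bsub>quot_restrict S I N\<^esub> v = \<zero>\<^bsub>N\<^esub>"
      "\<forall>i. 1 \<le> i \<and> i \<le> n \<longrightarrow> zero_module (Ext R i M N)" "i < n"
    for M :: "('s set, 'k) module" and N :: "('s set, 'l) module" and n i
    using iso[of M N i] that assms(3,4) by simp
  have 2: "\<not> zero_module (Ext S i (qr M) (qr M))"
    if "module R M" "\<not> zero_module M" "\<forall>v \<in> carrier M. y \<odot>\<^bsub>quot_restrict S I M\<^esub> v = \<zero>\<^bsub>M\<^esub>"
      "\<forall>i. 1 \<le> i \<and> i \<le> n \<longrightarrow> zero_module (Ext R i M M)" "i < n"
    for M :: "('s set, 'k) module" and n i
  proof (rule mod_iso_nonzero[OF 1[OF that(1,1,3,4,5)]])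
    have m: "module S (qr M)" using qr_module that(1) assms(3,4) by simp
    show "\<not> zero_module (Hom_mod S (qr M) (qr M))"
      using Hom_mod_nonzero[OF m] that(2) by (simp add: zero_module_def qr_simps(1,2))
    interpret H: module S "Hom_mod S (qr M) (qr M)" by (rule Hom_mod_module[OF m m])
    show "\<zero>\<^bsub>Hom_mod S (qr M) (qr M)\<^esub> \<in> carrier (Hom_mod S (qr M) (qr M))" by (rule H.M.zero_closed)
  qed
  show ?thesis using 1 2 unfolding assms(3) by blast
qed

end
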